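(* For every $n\in\{1,2,3,\dots\}\cup\{\infty\}$ there is a uniformly closed unital subalgebra $A_n$ of the disk algebra $A(\overline{\mathbb D})$ with $\operatorname{bsr}A_n=n$.
   Context: $\mathbb D=\{z\in\mathbb C:|z|<1\}$ is the open unit disk and $\overline{\mathbb D}$ its closure. The disk algebra $A(\overline{\mathbb D})$ is the algebra (with pointwise operations) of all functions $\overline{\mathbb D}\to\mathbb C$ that are continuous on $\overline{\mathbb D}$ and holomorphic on $\mathbb D$; "uniformly closed" means closed with respect to the supremum norm on $\overline{\mathbb D}$. Let $A$ be a commutative unital algebra with identity element $1$. An $n$-tuple $(f_1,\dots,f_n)\in A^n$ is called invertible if there exists $(x_1,\dots,x_n)\in A^n$ with $\sum_{j=1}^n x_jf_j=1$; the set of all invertible $n$-tuples is denoted by $U_n(A)$. An $(n+1)$-tuple $(f_1,\dots,f_n,g)\in U_{n+1}(A)$ is called reducible if there exists $(a_1,\dots,a_n)\in A^n$ such that $(f_1+a_1g,\dots,f_n+a_ng)\in U_n(A)$. The Bass stable rank $\operatorname{bsr}A$ of $A$ is the smallest integer $n\ge 1$ such that every element of $U_{n+1}(A)$ is reducible; if no such $n$ exists, $\operatorname{bsr}A=\infty$. *)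

theory Defs
  imports "HOL-Analysis.Analysis" "HOL-Algebra.Subrings" "HOL-Library.Extended_Nat"
begin

section \<open>Bass stable rank of a commutative unital ring\<close>

text \<open>
  Tuples in \<open>R\<^sup>n\<close> are extensional functions on \<open>{..<n}\<close>, indexed from \<open>0\<close>. An \<open>(n+1)\<close>-tuple
  \<open>(f\<^sub>1, \<dots>, f\<^sub>n, g)\<close> is a function \<open>f\<close> on \<open>{..<Suc n}\<close>, its last entry \<open>g\<close> being \<open>f n\<close>.
\<close>

definition invertible_tuples :: "('a, 'b) ring_scheme \<Rightarrow> nat \<Rightarrow> (nat \<Rightarrow> 'a) set" where
  "invertible_tuples R n =
     {f \<in> {..<n} \<rightarrow>\<^sub>E carrier R.
        \<exists>x \<in> {..<n} \<rightarrow>\<^sub>E carrier R. (\<Oplus>\<^bsub>R\<^esub>j\<in>{..<n}. x j \<otimes>\<^bsub>R\<^esub> f j) = \<one>\<^bsub>R\<^esub>}"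

definition reducible_tuple :: "('a, 'b) ring_scheme \<Rightarrow> nat \<Rightarrow> (nat \<Rightarrow> 'a) \<Rightarrow> bool" where
  "reducible_tuple R n f \<longleftrightarrow>
     (\<exists>a \<in> {..<n} \<rightarrow>\<^sub>E carrier R.
        (\<lambda>j\<in>{..<n}. f j \<oplus>\<^bsub>R\<^esub> a j \<otimes>\<^bsub>R\<^esub> f n) \<in> invertible_tuples R n)"

text \<open>The infimum of the empty set in \<^typ>\<open>enat\<close> is \<open>\<infinity>\<close>.\<close>

definition bass_stable_rank :: "('a, 'b) ring_scheme \<Rightarrow> enat" where
  "bass_stable_rank R =
     Inf {enat n | n. n \<ge> 1 \<and> (\<forall>f \<in> invertible_tuples R (Suc n). reducible_tuple R n f)}"


section \<open>The disk algebra\<close>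

text \<open>
  Functions on the closed disk are represented by their extensional extensions to \<open>\<complex>\<close>, so that
  equality in the ring is equality on the closed disk.
\<close>

definition disk_algebra :: "(complex \<Rightarrow> complex) ring" where
  "disk_algebra =
     \<lparr>carrier = {f \<in> extensional (cball 0 1).
                   continuous_on (cball 0 1) f \<and> f holomorphic_on ball 0 1},
      mult = (\<lambda>f g. \<lambda>z\<in>cball 0 1. f z * g z),
      one = (\<lambda>z\<in>cball 0 1. 1),
      zero = (\<lambda>z\<in>cball 0 1. 0),
      add = (\<lambda>f g. \<lambda>z\<in>cball 0 1. f z + g z)\<rparr>"

text \<open>A unital subalgebra is a subring (with the same identity) closed under complex scalars.\<close>

definition unital_subalgebra :: "(complex \<Rightarrow> complex) set \<Rightarrow> bool" where
  "unital_subalgebra A \<longleftrightarrow>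
     subring A disk_algebra \<and> (\<forall>c. \<forall>f\<in>A. (\<lambda>z\<in>cball 0 1. c * f z) \<in> A)"

text \<open>
  \<^term>\<open>cfunspace (top_of_set (cball 0 1)) euclidean_metric\<close> is the space of all continuous
  functions on the closed disk (again extensional) with the supremum metric; the disk algebra is
  a subset of it.
\<close>

definition uniformly_closed :: "(complex \<Rightarrow> complex) set \<Rightarrow> bool" where
  "uniformly_closed A \<longleftrightarrow>
     closedin (mtopology_of (cfunspace (top_of_set (cball (0::complex) 1))
                                       (euclidean_metric :: complex metric))) A"

lemma carrier_disk_algebra_subset:
  "carrier disk_algebra \<subseteq>
     mspace (cfunspace (top_of_set (cball (0::complex) 1)) (euclidean_metric :: complex metric))"
proof
  fix f assume "f \<in> carrier disk_algebra"
  then have f: "f \<in> extensional (cball 0 1)" "continuous_on (cball 0 1) f"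
    by (auto simp: disk_algebra_def)
  have "bounded (f ` cball 0 1)"
    using f(2) by (simp add: compact_continuous_image compact_imp_bounded)
  then show "f \<in> mspace (cfunspace (top_of_set (cball 0 1)) euclidean_metric)"
    using f by (simp)
qed

lemma mdist_disk_algebra:
  assumes "f \<in> carrier disk_algebra" "g \<in> carrier disk_algebra"
  shows "mdist (cfunspace (top_of_set (cball (0::complex) 1)) (euclidean_metric :: complex metric)) f g
           = (SUP z\<in>cball 0 1. norm (f z - g z))"
proof -
  have "f \<in> mspace (cfunspace (top_of_set (cball (0::complex) 1)) (euclidean_metric :: complex metric))"
    "g \<in> mspace (cfunspace (top_of_set (cball (0::complex) 1)) (euclidean_metric :: complex metric))"
    using assms carrier_disk_algebra_subset by blast+
  then show ?thesis
    by (auto simp: mdist_cfunspace_eq_mdist_funspace Met_TC.fdist_def Met_TC.fspace_def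
        dist_norm image_def)
qed

lemma restrict_in_disk_algebra:
  assumes "continuous_on (cball 0 1) f" "f holomorphic_on ball 0 1"
  shows "restrict f (cball 0 1) \<in> carrier disk_algebra"
proof -
  have "continuous_on (cball 0 1) (restrict f (cball 0 1))"
    using assms(1) by (rule continuous_on_eq) simp
  moreover have "restrict f (cball 0 1) holomorphic_on ball 0 1"
    using assms(2) by (rule holomorphic_transform) simp
  ultimately show ?thesis
    by (simp add: disk_algebra_def)
qed

lemma disk_algebra_closed:
  assumes "f \<in> carrier disk_algebra" "g \<in> carrier disk_algebra"
  shows "(\<lambda>z\<in>cball 0 1. f z + g z) \<in> carrier disk_algebra"
    and "(\<lambda>z\<in>cball 0 1. f z * g z) \<in> carrier disk_algebra"
    and "(\<lambda>z\<in>cball 0 1. c * f z) \<in> carrier disk_algebra"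
proof -
  have "continuous_on (cball 0 1) f" "f holomorphic_on ball 0 1"
    "continuous_on (cball 0 1) g" "g holomorphic_on ball 0 1"
    using assms by (simp_all add: disk_algebra_def)
  then show "(\<lambda>z\<in>cball 0 1. f z + g z) \<in> carrier disk_algebra"
    "(\<lambda>z\<in>cball 0 1. f z * g z) \<in> carrier disk_algebra"
    "(\<lambda>z\<in>cball 0 1. c * f z) \<in> carrier disk_algebra"
    by (auto intro!: restrict_in_disk_algebra continuous_intros holomorphic_intros
        simp del: restrict_apply)
qed

lemma disk_algebra_simps:
  "f \<otimes>\<^bsub>disk_algebra\<^esub> g = (\<lambda>z\<in>cball 0 1. f z * g z)"
  "f \<oplus>\<^bsub>disk_algebra\<^esub> g = (\<lambda>z\<in>cball 0 1. f z + g z)"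
  "\<one>\<^bsub>disk_algebra\<^esub> = (\<lambda>z\<in>cball 0 1. 1)"
  "\<zero>\<^bsub>disk_algebra\<^esub> = (\<lambda>z\<in>cball 0 1. 0)"
  by (simp_all add: disk_algebra_def)

lemma disk_algebra_extensional: "f \<in> carrier disk_algebra \<Longrightarrow> f \<in> extensional (cball 0 1)"
  by (simp add: disk_algebra_def)

lemma cring_disk_algebra: "cring disk_algebra"
proof (rule cringI)
  have const: "(\<lambda>z\<in>cball 0 1. c) \<in> carrier disk_algebra" for c
    by (intro restrict_in_disk_algebra continuous_intros holomorphic_intros)
  show "abelian_group disk_algebra"
  proof (rule abelian_groupI)
    fix f assume f: "f \<in> carrier disk_algebra"
    show "\<exists>g \<in> carrier disk_algebra. g \<oplus>\<^bsub>disk_algebra\<^esub> f = \<zero>\<^bsub>disk_algebra\<^esub>"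
      using disk_algebra_closed(3)[OF f f, of "-1"]
      by (intro bexI[of _ "\<lambda>z\<in>cball 0 1. - 1 * f z"]) (auto simp: disk_algebra_simps fun_eq_iff)
    show "\<zero>\<^bsub>disk_algebra\<^esub> \<oplus>\<^bsub>disk_algebra\<^esub> f = f"
      using disk_algebra_extensional[OF f]
      by (auto simp: disk_algebra_simps fun_eq_iff extensional_def restrict_def)
  qed (simp_all add: disk_algebra_simps disk_algebra_closed const,
        auto simp: fun_eq_iff restrict_def algebra_simps)
  show "comm_monoid disk_algebra"
  proof (rule comm_monoidI)
    fix f assume f: "f \<in> carrier disk_algebra"
    show "\<one>\<^bsub>disk_algebra\<^esub> \<otimes>\<^bsub>disk_algebra\<^esub> f = f"
      using disk_algebra_extensional[OF f]
      by (auto simp: disk_algebra_simps fun_eq_iff extensional_def restrict_def)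
  qed (simp_all add: disk_algebra_simps disk_algebra_closed const,
        auto simp: fun_eq_iff restrict_def algebra_simps)
qed (auto simp: disk_algebra_simps fun_eq_iff algebra_simps restrict_def)

end

theory Submission
  imports Defs
    "HOL-Complex_Analysis.Complex_Analysis"
    "HOL-Homology.Brouwer_Degree"
    "HOL-Computational_Algebra.Polynomial_Factorial"
    "HOL-Computational_Algebra.Field_as_Ring"
    "HOL-Computational_Algebra.Fundamental_Theorem_Algebra"
begin

text \<open>
  Let \<open>K\<close> be a Cantor set of measure zero on the unit circle. By the Rudin--Carleson theorem every
  continuous function on \<open>K\<close> extends to the disk algebra, and \<open>K\<close> maps onto the Hilbert cube by
  functions \<open>x\<^sub>0, x\<^sub>1, \<dots>\<close>. The algebra attached to a set \<open>J\<close> of indices consists of the functions in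
  the disk algebra that are constant on the common level sets in \<open>K\<close> of the \<open>x\<^sub>j\<close> with \<open>j \<in> J\<close>. Its
  restriction to \<open>K\<close> is the algebra of continuous functions on a cube of dimension \<open>\<bar>J\<bar>\<close>.

  If \<open>\<bar>J\<bar> \<ge> 2m\<close>, then \<open>(\<zeta>\<^sub>1, \<dots>, \<zeta>\<^sub>m, 1 - \<bar>\<zeta>\<bar>\<^sup>2)\<close> on the unit ball of \<open>\<complex>\<^sup>m\<close> lifts to an invertible tuple
  which is not reducible, because the sphere is not a retract of the ball. If \<open>\<bar>J\<bar> < 2n\<close> and \<open>n \<ge> 2\<close>,
  then the invertible \<open>n\<close>-tuples are dense: a Lipschitz map from the cube to \<open>\<complex>\<^sup>n\<close> misses points
  near \<open>0\<close>, which removes the common zeros on \<open>K\<close>, and two polynomials can be made coprime by a small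
  perturbation, which removes those off \<open>K\<close>. Density of the invertible \<open>n\<close>-tuples bounds the Bass
  stable rank by \<open>n\<close>. So \<open>\<bar>J\<bar> = 2n - 2\<close> gives rank \<open>n\<close> for finite \<open>n \<ge> 2\<close>, an infinite \<open>J\<close> gives rank
  \<open>\<infinity>\<close>, and the constants have rank \<open>1\<close>.
\<close>

section \<open>Interpolation on thin subsets of the circle\<close>

text \<open>The numbers fit for a reason of dimension. A tuple of \<open>n\<close> complex functions
  has \<open>2n\<close> real components, so a generic one on a \<open>d\<close>-dimensional cube has
  no common zero when \<open>d < 2n\<close>; the obstruction to \<open>m\<close> functions lives on
  a ball of real dimension \<open>2m\<close>. With \<open>d = 2n - 2\<close> every
  \<open>m < n\<close> is obstructed and \<open>n\<close> is not. The obstacle is that a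
  perturbation must stay in the algebra together with its Bezout coefficients: both have to remain
  constant on the fibres in \<open>K\<close>. Hence zeros are removed first on \<open>K\<close>,
  using functions of the coordinates only, and then off \<open>K\<close> by a perturbation that
  keeps the values on \<open>K\<close> of the tuple and of the coefficients. The second step needs
  two entries: a single nonconstant function with a zero in the open disk is never a uniform limit
  of zero-free functions (Hurwitz), while two polynomials become coprime after a small shift. Hence
  rank \<open>1\<close> is realised separately, by the constants, which form a field. Thinness of
  \<open>K\<close> enters through interpolation: any continuous function on \<open>K\<close>,
  conjugates included, is the restriction of a function in the disk algebra.\<close>

definition disk_fun :: "(complex \<Rightarrow> complex) \<Rightarrow> bool" where
  "disk_fun f \<longleftrightarrow> continuous_on (cball 0 1) f \<and> f holomorphic_on ball 0 1"

lemma disk_fun_const [simp, intro]: "disk_fun (\<lambda>_. c)"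
  by (simp add: disk_fun_def)

lemma disk_fun_add [intro]: "disk_fun f \<Longrightarrow> disk_fun g \<Longrightarrow> disk_fun (\<lambda>z. f z + g z)"
  by (auto simp: disk_fun_def intro: continuous_intros holomorphic_intros)

lemma disk_fun_diff [intro]: "disk_fun f \<Longrightarrow> disk_fun g \<Longrightarrow> disk_fun (\<lambda>z. f z - g z)"
  by (auto simp: disk_fun_def intro: continuous_intros holomorphic_intros)

lemma disk_fun_mult [intro]: "disk_fun f \<Longrightarrow> disk_fun g \<Longrightarrow> disk_fun (\<lambda>z. f z * g z)"
  by (auto simp: disk_fun_def intro: continuous_intros holomorphic_intros)

lemma disk_fun_power [intro]: "disk_fun f \<Longrightarrow> disk_fun (\<lambda>z. f z ^ n)"
  by (auto simp: disk_fun_def intro: continuous_intros holomorphic_intros)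

lemma disk_fun_sum [intro]: "(\<And>i. i \<in> I \<Longrightarrow> disk_fun (f i)) \<Longrightarrow> disk_fun (\<lambda>z. \<Sum>i\<in>I. f i z)"
  by (auto simp: disk_fun_def intro: continuous_intros holomorphic_intros)

lemma disk_fun_divide [intro]:
  "disk_fun f \<Longrightarrow> disk_fun g \<Longrightarrow> (\<And>z. z \<in> cball 0 1 \<Longrightarrow> g z \<noteq> 0) \<Longrightarrow> disk_fun (\<lambda>z. f z / g z)"
  by (auto simp: disk_fun_def intro!: continuous_intros holomorphic_intros)

lemma disk_fun_poly [intro]: "disk_fun (poly p)"
  by (auto simp: disk_fun_def intro!: continuous_intros holomorphic_intros)

lemma disk_fun_continuous_on_subset: "disk_fun f \<Longrightarrow> K \<subseteq> sphere 0 1 \<Longrightarrow> continuous_on K f"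
  by (rule continuous_on_subset[of "cball 0 1"]) (auto simp: disk_fun_def)

lemma disk_fun_bounded:
  assumes "disk_fun f"
  obtains B where "B > 0" "\<And>z. z \<in> cball 0 1 \<Longrightarrow> norm (f z) \<le> B"
proof -
  have "bounded (f ` cball 0 1)"
    using assms by (simp add: disk_fun_def compact_continuous_image compact_imp_bounded)
  then show ?thesis using that by (auto simp: bounded_pos)
qed

lemma disk_fun_uniform_limit:
  assumes "\<And>n::nat. disk_fun (f n)" and "uniform_limit (cball 0 1) f g sequentially"
  shows "disk_fun g"
  using holomorphic_uniform_limit[of 0 1 f sequentially g] assms
  by (auto simp: disk_fun_def)

text \<open>Length zero in a uniform form: finitely many balls of one radius with arbitrarily small
  total size. The centres lie in \<open>Q\<close> because kernels are placed at them.\<close>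

definition finely_coverable :: "'a::metric_space set \<Rightarrow> bool" where
  "finely_coverable Q \<longleftrightarrow>
     (\<forall>\<eta>>0. \<exists>S \<rho>. finite S \<and> S \<subseteq> Q \<and> \<rho> > 0 \<and> real (card S) * \<rho> < \<eta> \<and>
        (\<forall>z\<in>Q. \<exists>\<zeta>\<in>S. dist z \<zeta> \<le> \<rho>))"

text \<open>The function is \<open>k / (1 + k)\<close>, where \<open>k\<close> is a positive multiple of the sum of the kernels
  \<open>1 / (1 + \<rho> - z cnj \<zeta>)\<close>: each of them has positive real part, which is of size \<open>1 / \<rho>\<close>
  at distance \<open>\<rho>\<close> from \<open>\<zeta>\<close>.\<close>

lemma disk_fun_approx_indicator:
  fixes Q :: "complex set"
  assumes Q: "Q \<subseteq> sphere 0 1" and thin: "finely_coverable Q" and "d > 0" "\<epsilon> > 0"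
  obtains h where "disk_fun h" "\<And>z. z \<in> cball 0 1 \<Longrightarrow> norm (h z) \<le> 1"
    "\<And>z. z \<in> Q \<Longrightarrow> norm (h z - 1) \<le> \<epsilon>"
    "\<And>z. z \<in> cball 0 1 \<Longrightarrow> (\<And>q. q \<in> Q \<Longrightarrow> d \<le> dist z q) \<Longrightarrow> norm (h z) \<le> \<epsilon>"
proof -
  \<comment> \<open>Away from \<open>Q\<close> each kernel is at most \<open>2 / d\<close> in norm,
    so \<open>c\<close> times their average is at most \<open>\<epsilon>\<close>.\<close>
  define c where "c = \<epsilon> * d / 2"
  have "c > 0" using assms by (simp add: c_def)
  \<comment> \<open>The first bound makes \<open>Re k\<close> at least \<open>1 / \<epsilon>\<close>
    on \<open>Q\<close>, where one kernel has real part at least \<open>1 / (4 * \<rho>)\<close>;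
    the second gives \<open>\<rho> < d / 2\<close>.\<close>
  define \<eta> where "\<eta> = min (c * \<epsilon> / 4) (d / 2)"
  have "\<eta> > 0" using assms \<open>c > 0\<close> by (simp add: \<eta>_def)
  then obtain S \<rho> where S: "finite S" "S \<subseteq> Q" "\<rho> > 0" "real (card S) * \<rho> < \<eta>"
      "\<And>z. z \<in> Q \<Longrightarrow> \<exists>\<zeta>\<in>S. dist z \<zeta> \<le> \<rho>"
    using thin unfolding finely_coverable_def by metis
  show ?thesis
  proof (cases "Q = {}")
    case True
    show ?thesis by (rule that[of "\<lambda>_. 0"]) (use True \<open>\<epsilon> > 0\<close> in auto)
  next
    case False
    define N where "N = real (card S)"
    have "S \<noteq> {}" using S(5) False by blast
    then have N: "N \<ge> 1" using S(1) by (simp add: N_def Suc_le_eq card_gt_0_iff)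
    have \<rho>: "\<rho> < d / 2" "N * \<rho> < c * \<epsilon> / 4"
    proof -
      have "\<rho> \<le> N * \<rho>" using N S(3) by simp
      then show "\<rho> < d / 2" "N * \<rho> < c * \<epsilon> / 4" using S(4) by (auto simp: \<eta>_def N_def)
    qed
    define w where "w = (\<lambda>\<zeta> z. 1 + of_real \<rho> - z * cnj \<zeta>)"
    define k where "k = (\<lambda>z. of_real (c / N) * (\<Sum>\<zeta>\<in>S. 1 / w \<zeta> z))"
    have \<zeta>: "norm \<zeta> = 1" if "\<zeta> \<in> S" for \<zeta> using that S(2) Q by auto
    have w_ge: "Re (w \<zeta> z) \<ge> \<rho>" if "\<zeta> \<in> S" "z \<in> cball 0 1" for \<zeta> z
    proof -
      have "Re (z * cnj \<zeta>) \<le> norm (z * cnj \<zeta>)" by (rule complex_Re_le_cmod)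
      also have "\<dots> \<le> 1" using that \<zeta> by (simp add: norm_mult)
      finally show ?thesis by (simp add: w_def)
    qed
    have w0: "w \<zeta> z \<noteq> 0" if "\<zeta> \<in> S" "z \<in> cball 0 1" for \<zeta> z
      using w_ge[OF that] S(3) by auto
    have Re_inv: "Re (1 / w \<zeta> z) \<ge> 0" if "\<zeta> \<in> S" "z \<in> cball 0 1" for \<zeta> z
      using w_ge[OF that] S(3) by (simp add: Re_divide)
    have Rek: "Re (k z) = c / N * (\<Sum>\<zeta>\<in>S. Re (1 / w \<zeta> z))" for z
      by (simp add: k_def del: of_real_divide)
    have Rek0: "Re (k z) \<ge> 0" if "z \<in> cball 0 1" for z
      unfolding Rek using \<open>c > 0\<close> N Re_inv that by (intro mult_nonneg_nonneg sum_nonneg) auto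
    have df_k: "disk_fun k"
      unfolding k_def w_def
      by (intro disk_fun_mult disk_fun_sum disk_fun_divide disk_fun_diff disk_fun_const)
        (use w0 in \<open>auto simp: w_def disk_fun_def intro: holomorphic_intros\<close>)
    have norm1k: "norm (1 + k z) \<ge> 1" "norm (1 + k z) \<ge> 1 + Re (k z)"
      if "z \<in> cball 0 1" for z
      using complex_Re_le_cmod[of "1 + k z"] Rek0[OF that] by auto
    have k1: "1 + k z \<noteq> 0" if "z \<in> cball 0 1" for z
      using norm1k(1)[OF that] by auto
    \<comment> \<open>The map \<open>t / (1 + t)\<close> carries the closed right half-plane into
      the unit disk; it is near \<open>1\<close> for large \<open>t\<close> and near
      \<open>0\<close> for small \<open>t\<close>.\<close>
    show ?thesis
    proof (rule that[of "\<lambda>z. k z / (1 + k z)"])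
      show "disk_fun (\<lambda>z. k z / (1 + k z))"
        using df_k k1 by (intro disk_fun_divide disk_fun_add) auto
      show "norm (k z / (1 + k z)) \<le> 1" if z: "z \<in> cball 0 1" for z
      proof -
        have "(norm (k z))\<^sup>2 \<le> (norm (1 + k z))\<^sup>2"
          using Rek0[OF z] unfolding cmod_power2 by (simp add: power2_eq_square algebra_simps)
        then have "norm (k z) \<le> norm (1 + k z)" by (rule power2_le_imp_le) simp
        then show ?thesis using k1[OF z] by (simp add: norm_divide)
      qed
      show "norm (k z / (1 + k z) - 1) \<le> \<epsilon>" if z: "z \<in> Q" for z
      proof -
        have zc: "z \<in> cball 0 1" using z Q by auto
        obtain \<zeta> where z\<zeta>: "\<zeta> \<in> S" "dist z \<zeta> \<le> \<rho>" using S(5)[OF z] by blast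
        have "\<zeta> * cnj \<zeta> = 1" using \<zeta>[OF z\<zeta>(1)] complex_norm_square[of \<zeta>] by simp
        then have "w \<zeta> z = of_real \<rho> - (z - \<zeta>) * cnj \<zeta>" by (simp add: w_def algebra_simps)
        then have "norm (w \<zeta> z) \<le> \<rho> + norm ((z - \<zeta>) * cnj \<zeta>)"
          using norm_triangle_ineq4[of "of_real \<rho>" "(z - \<zeta>) * cnj \<zeta>"] S(3) by simp
        also have "\<dots> \<le> 2 * \<rho>" using z\<zeta> \<zeta> by (simp add: norm_mult dist_norm)
        finally have wle: "(norm (w \<zeta> z))\<^sup>2 \<le> (2 * \<rho>)\<^sup>2" by (intro power_mono) auto
        have wpos: "(norm (w \<zeta> z))\<^sup>2 > 0" using w0[OF z\<zeta>(1) zc] by simp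
        have "1 / (4 * \<rho>) = \<rho> / (2 * \<rho>)\<^sup>2" using S(3) by (simp add: power2_eq_square)
        also have "\<dots> \<le> Re (w \<zeta> z) / (norm (w \<zeta> z))\<^sup>2"
          by (rule frac_le) (use w_ge[OF z\<zeta>(1) zc] S(3) wle wpos in auto)
        also have "\<dots> = Re (1 / w \<zeta> z)" by (simp add: Re_divide cmod_power2)
        also have "\<dots> \<le> (\<Sum>\<zeta>\<in>S. Re (1 / w \<zeta> z))"
          using Re_inv zc S(1) z\<zeta>(1) by (intro member_le_sum) auto
        finally have "c / N * (1 / (4 * \<rho>)) \<le> Re (k z)"
          unfolding Rek using \<open>c > 0\<close> N by (intro mult_left_mono) auto
        moreover have "1 / \<epsilon> \<le> c / N * (1 / (4 * \<rho>))"
          using \<rho>(2) \<open>\<epsilon> > 0\<close> N S(3) by (simp add: field_simps)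
        ultimately have ge: "1 / \<epsilon> \<le> norm (1 + k z)" using norm1k(2)[OF zc] by linarith
        have pos: "norm (1 + k z) > 0" using norm1k(1)[OF zc] by linarith
        have "k z / (1 + k z) - 1 = - 1 / (1 + k z)" using k1[OF zc] by (simp add: field_simps)
        then have "norm (k z / (1 + k z) - 1) = 1 / norm (1 + k z)" by (simp add: norm_divide)
        also have "\<dots> \<le> 1 / (1 / \<epsilon>)" using ge pos \<open>\<epsilon> > 0\<close> by (simp add: field_simps)
        finally show ?thesis using \<open>\<epsilon> > 0\<close> by simp
      qed
      show "norm (k z / (1 + k z)) \<le> \<epsilon>" if z: "z \<in> cball 0 1" "\<And>q. q \<in> Q \<Longrightarrow> d \<le> dist z q" for z
      proof -
        have "norm (1 / w \<zeta> z) \<le> 2 / d" if "\<zeta> \<in> S" for \<zeta>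
        proof -
          have "\<zeta> * cnj \<zeta> = 1" using \<zeta>[OF that] complex_norm_square[of \<zeta>] by simp
          then have "(z - \<zeta>) * cnj \<zeta> = of_real \<rho> - w \<zeta> z" by (simp add: w_def algebra_simps)
          then have "norm ((z - \<zeta>) * cnj \<zeta>) \<le> \<rho> + norm (w \<zeta> z)"
            using norm_triangle_ineq4[of "of_real \<rho>" "w \<zeta> z"] S(3) by simp
          moreover have "norm ((z - \<zeta>) * cnj \<zeta>) \<ge> d"
            using z(2)[of \<zeta>] that S(2) \<zeta>[OF that] by (auto simp: norm_mult dist_norm)
          ultimately have "d / 2 \<le> norm (w \<zeta> z)" using \<rho>(1) by simp
          then have "1 / norm (w \<zeta> z) \<le> 1 / (d / 2)"
            using \<open>d > 0\<close> w0[OF that z(1)] by (intro divide_left_mono mult_pos_pos) auto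
          then show ?thesis by (simp add: norm_divide)
        qed
        then have "norm (\<Sum>\<zeta>\<in>S. 1 / w \<zeta> z) \<le> (\<Sum>\<zeta>\<in>S. 2 / d)" by (rule sum_norm_le)
        then have "norm (\<Sum>\<zeta>\<in>S. 1 / w \<zeta> z) \<le> N * (2 / d)" by (simp add: N_def)
        then have "c / N * norm (\<Sum>\<zeta>\<in>S. 1 / w \<zeta> z) \<le> c / N * (N * (2 / d))"
          using \<open>c > 0\<close> N by (intro mult_left_mono) auto
        also have "\<dots> = \<epsilon>" using N \<open>d > 0\<close> by (simp add: c_def)
        finally have "norm (k z) \<le> \<epsilon>" using \<open>c > 0\<close> N by (simp add: k_def norm_mult norm_divide)
        moreover have "norm (k z / (1 + k z)) \<le> norm (k z)"
          using norm1k(1)[OF z(1)] divide_left_mono[of 1 "norm (1 + k z)" "norm (k z)"] k1[OF z(1)]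
          by (simp add: norm_divide)
        ultimately show ?thesis by linarith
      qed
    qed
  qed
qed

text \<open>Since the pieces are disjoint and compact, functions constant on each piece are
  continuous on \<open>K\<close>, and they approximate every continuous function. Nonempty pieces
  allow values to be sampled.\<close>

definition finely_partitionable :: "'a::metric_space set \<Rightarrow> bool" where
  "finely_partitionable K \<longleftrightarrow>
     (\<forall>\<eta>>0. \<exists>\<P> \<rho>. finite \<P> \<and> \<rho> > 0 \<and> real (card \<P>) * \<rho> < \<eta> \<and> \<Union>\<P> = K \<and> pairwise disjnt \<P> \<and>
        (\<forall>Q\<in>\<P>. compact Q \<and> Q \<noteq> {} \<and> (\<forall>z\<in>Q. \<forall>w\<in>Q. dist z w \<le> \<rho>)))"

text \<open>One point of \<open>Q\<close> is taken from each piece that meets \<open>Q\<close>. Used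
  for the single pieces of a partition and for \<open>K\<close> itself.\<close>

lemma finely_coverable_subset:
  assumes "finely_partitionable K" "Q \<subseteq> K"
  shows "finely_coverable Q"
  unfolding finely_coverable_def
proof (intro allI impI)
  fix \<eta> :: real assume "\<eta> > 0"
  then obtain \<P> \<rho> where P: "finite \<P>" "\<rho> > 0" "real (card \<P>) * \<rho> < \<eta>" "\<Union>\<P> = K"
    "\<forall>P\<in>\<P>. \<forall>z\<in>P. \<forall>w\<in>P. dist z w \<le> \<rho>"
    using assms(1) unfolding finely_partitionable_def by metis
  define \<P>' where "\<P>' = {P \<in> \<P>. P \<inter> Q \<noteq> {}}"
  define c where "c = (\<lambda>P. SOME z. z \<in> P \<inter> Q)"
  have c: "c P \<in> P \<inter> Q" if "P \<in> \<P>'" for P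
    using that unfolding c_def \<P>'_def by (metis (mono_tags, lifting) ex_in_conv mem_Collect_eq someI_ex)
  show "\<exists>S \<rho>. finite S \<and> S \<subseteq> Q \<and> 0 < \<rho> \<and> real (card S) * \<rho> < \<eta> \<and> (\<forall>z\<in>Q. \<exists>\<zeta>\<in>S. dist z \<zeta> \<le> \<rho>)"
  proof (intro exI[of _ "c ` \<P>'"] exI[of _ \<rho>] conjI ballI)
    show "finite (c ` \<P>')" using P(1) by (simp add: \<P>'_def)
    show "c ` \<P>' \<subseteq> Q" using c by blast
    have "card (c ` \<P>') \<le> card \<P>"
      using card_image_le[of \<P>' c] card_mono[of \<P> \<P>'] P(1) by (auto simp: \<P>'_def)
    then have "real (card (c ` \<P>')) * \<rho> \<le> real (card \<P>) * \<rho>" using P(2) by (intro mult_right_mono) auto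
    then show "real (card (c ` \<P>')) * \<rho> < \<eta>" using P(3) by linarith
    fix z assume "z \<in> Q"
    then obtain P where "P \<in> \<P>" "z \<in> P" using assms(2) P(4) by blast
    then have "P \<in> \<P>'" using \<open>z \<in> Q\<close> by (auto simp: \<P>'_def)
    then show "\<exists>\<zeta>\<in>c ` \<P>'. dist z \<zeta> \<le> \<rho>" using c[of P] P(5) \<open>P \<in> \<P>\<close> \<open>z \<in> P\<close> by blast
  qed (use P(2) in auto)
qed

lemma finite_disjoint_compact_separated:
  fixes \<P> :: "'a::heine_borel set set"
  assumes "finite \<P>" "pairwise disjnt \<P>" "\<And>Q. Q \<in> \<P> \<Longrightarrow> compact Q"
  obtains d where "d > 0"
    "\<And>Q Q' z w. Q \<in> \<P> \<Longrightarrow> Q' \<in> \<P> \<Longrightarrow> Q \<noteq> Q' \<Longrightarrow> z \<in> Q \<Longrightarrow> w \<in> Q' \<Longrightarrow> d \<le> dist z w"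
proof -
  have "\<exists>e>0. \<forall>z\<in>Q. \<forall>w\<in>\<Union>(\<P> - {Q}). e \<le> dist z w" if "Q \<in> \<P>" for Q
  proof (rule separate_compact_closed)
    show "compact Q" using assms that by blast
    show "closed (\<Union>(\<P> - {Q}))" using assms by (intro closed_Union) (auto intro: compact_imp_closed)
    show "Q \<inter> \<Union>(\<P> - {Q}) = {}" using assms(2) that by (auto simp: pairwise_def disjnt_def)
  qed
  then obtain e where e: "\<And>Q. Q \<in> \<P> \<Longrightarrow> e Q > 0"
    "\<And>Q z w. Q \<in> \<P> \<Longrightarrow> z \<in> Q \<Longrightarrow> w \<in> \<Union>(\<P> - {Q}) \<Longrightarrow> e Q \<le> dist z w"
    by metis
  \<comment> \<open>The added \<open>1\<close> provides for an empty family.\<close>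
  have "Min (insert 1 (e ` \<P>)) > 0" using e(1) assms(1) by simp
  moreover have "Min (insert 1 (e ` \<P>)) \<le> e Q" if "Q \<in> \<P>" for Q using assms(1) that by simp
  moreover have "w \<in> \<Union>(\<P> - {Q})" if "Q' \<in> \<P>" "Q \<noteq> Q'" "w \<in> Q'" for Q Q' w using that by blast
  ultimately show ?thesis using e(2) by (meson order_trans that)
qed

text \<open>On small pieces \<open>g\<close> is nearly constant, so sampled values times approximate
  indicators of the pieces are summed. The bound \<open>2 * B\<close> does not grow with the number
  of pieces, because a point of the disk is close to at most one of them.\<close>

lemma disk_fun_interpolation_step:
  fixes g :: "complex \<Rightarrow> complex"
  assumes K: "compact K" "K \<subseteq> sphere 0 1" "finely_partitionable K"
    and g: "continuous_on K g" "\<And>z. z \<in> K \<Longrightarrow> norm (g z) \<le> B" and "B > 0"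
  obtains f where "disk_fun f" "\<And>z. z \<in> cball 0 1 \<Longrightarrow> norm (f z) \<le> 2 * B"
    "\<And>z. z \<in> K \<Longrightarrow> norm (f z - g z) \<le> B / 2"
proof (cases "K = {}")
  case True
  show ?thesis by (rule that[of "\<lambda>_. 0"]) (use True \<open>B > 0\<close> in auto)
next
  case False
  have "uniformly_continuous_on K g" using g(1) K(1) by (rule compact_uniformly_continuous)
  moreover have "B / 4 > 0" using \<open>B > 0\<close> by simp
  ultimately obtain \<delta> where \<delta>: "\<delta> > 0"
    "\<And>z w. z \<in> K \<Longrightarrow> w \<in> K \<Longrightarrow> dist z w < \<delta> \<Longrightarrow> dist (g z) (g w) < B / 4"
    unfolding uniformly_continuous_on_def by metis
  then obtain \<P> \<rho> where P: "finite \<P>" "\<rho> > 0" "real (card \<P>) * \<rho> < \<delta>" "\<Union>\<P> = K" "pairwise disjnt \<P>"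
    "\<And>Q. Q \<in> \<P> \<Longrightarrow> compact Q \<and> Q \<noteq> {} \<and> (\<forall>z\<in>Q. \<forall>w\<in>Q. dist z w \<le> \<rho>)"
    using K(3) unfolding finely_partitionable_def by metis
  define N where "N = real (card \<P>)"
  have "\<P> \<noteq> {}" using False P(4) by blast
  then have N: "N \<ge> 1" using P(1) by (simp add: N_def Suc_le_eq card_gt_0_iff)
  have "\<rho> \<le> N * \<rho>" using N P(2) by simp
  then have \<rho>: "\<rho> < \<delta>" using P(3) by (simp add: N_def)
  obtain d where d: "d > 0"
    "\<And>Q Q' z w. Q \<in> \<P> \<Longrightarrow> Q' \<in> \<P> \<Longrightarrow> Q \<noteq> Q' \<Longrightarrow> z \<in> Q \<Longrightarrow> w \<in> Q' \<Longrightarrow> d \<le> dist z w"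
    using finite_disjoint_compact_separated[OF P(1,5)] P(6) by metis
  \<comment> \<open>The \<open>N\<close> errors of the indicators add up to \<open>1 / 4\<close>:
    their norms sum to at most \<open>5 / 4\<close> at any point, and on \<open>K\<close> the error
    is \<open>B / 4\<close> from them and \<open>B / 4\<close> from the oscillation of
    \<open>g\<close>.\<close>
  define \<epsilon> where "\<epsilon> = 1 / (4 * N)"
  have \<epsilon>: "\<epsilon> > 0" "N * \<epsilon> = 1 / 4" using N by (auto simp: \<epsilon>_def)
  define G where "G = (\<lambda>Q h. disk_fun h \<and> (\<forall>z\<in>cball 0 1. norm (h z) \<le> 1) \<and> (\<forall>z\<in>Q. norm (h z - 1) \<le> \<epsilon>) \<and>
     (\<forall>z\<in>cball 0 1. (\<forall>q\<in>Q. d / 2 \<le> dist z q) \<longrightarrow> norm (h z) \<le> \<epsilon>))"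
  have "\<exists>h. G Q h" if "Q \<in> \<P>" for Q
  proof -
    have "Q \<subseteq> K" using that P(4) by blast
    then have "Q \<subseteq> sphere 0 1" "finely_coverable Q"
      using K(2) finely_coverable_subset[OF K(3)] by auto
    from disk_fun_approx_indicator[OF this, of "d / 2" \<epsilon>] show ?thesis
      unfolding G_def using d(1) \<epsilon>(1) by (smt (verit) half_gt_zero)
  qed
  then obtain h where "\<And>Q. Q \<in> \<P> \<Longrightarrow> G Q (h Q)" by metis
  then have h: "\<And>Q. Q \<in> \<P> \<Longrightarrow> disk_fun (h Q)"
    "\<And>Q z. Q \<in> \<P> \<Longrightarrow> z \<in> cball 0 1 \<Longrightarrow> norm (h Q z) \<le> 1"
    "\<And>Q z. Q \<in> \<P> \<Longrightarrow> z \<in> Q \<Longrightarrow> norm (h Q z - 1) \<le> \<epsilon>"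
    "\<And>Q z. Q \<in> \<P> \<Longrightarrow> z \<in> cball 0 1 \<Longrightarrow> (\<And>q. q \<in> Q \<Longrightarrow> d / 2 \<le> dist z q) \<Longrightarrow> norm (h Q z) \<le> \<epsilon>"
    unfolding G_def by blast+
  define v where "v = (\<lambda>Q. g (SOME z. z \<in> Q))"
  have pt: "(SOME z. z \<in> Q) \<in> Q" if "Q \<in> \<P>" for Q using P(6)[OF that] by (simp add: some_in_eq)
  have v: "norm (v Q) \<le> B" if "Q \<in> \<P>" for Q
    unfolding v_def using g(2) pt[OF that] that P(4) by blast
  show ?thesis
  proof (rule that[of "\<lambda>z. \<Sum>Q\<in>\<P>. v Q * h Q z"])
    show "disk_fun (\<lambda>z. \<Sum>Q\<in>\<P>. v Q * h Q z)"
      using h(1) by (intro disk_fun_sum disk_fun_mult disk_fun_const)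
    show "norm (\<Sum>Q\<in>\<P>. v Q * h Q z) \<le> 2 * B" if z: "z \<in> cball 0 1" for z
    proof -
      have "(\<Sum>Q\<in>\<P>. norm (h Q z)) \<le> 1 + N * \<epsilon>"
      proof (cases "\<exists>Q\<in>\<P>. \<exists>q\<in>Q. dist z q < d / 2")
        case True
        then obtain Q0 q0 where Q0: "Q0 \<in> \<P>" "q0 \<in> Q0" "dist z q0 < d / 2" by blast
        have "norm (h Q z) \<le> \<epsilon>" if "Q \<in> \<P>" "Q \<noteq> Q0" for Q
        proof (rule h(4)[OF that(1) z])
          fix q assume "q \<in> Q"
          then have "d \<le> dist q0 q" using d(2)[of Q0 Q q0 q] that Q0 by blast
          then show "d / 2 \<le> dist z q" using Q0(3) dist_triangle2[of q0 q z] by (simp add: dist_commute)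
        qed
        then have "(\<Sum>Q\<in>\<P> - {Q0}. norm (h Q z)) \<le> of_nat (card (\<P> - {Q0})) * \<epsilon>"
          by (intro sum_bounded_above) auto
        also have "\<dots> \<le> N * \<epsilon>"
          using \<epsilon>(1) card_mono[of \<P> "\<P> - {Q0}"] P(1) by (intro mult_right_mono) (auto simp: N_def)
        finally show ?thesis using h(2)[OF Q0(1) z] by (subst sum.remove[OF P(1) Q0(1)]) simp
      next
        case False
        have "(\<Sum>Q\<in>\<P>. norm (h Q z)) \<le> of_nat (card \<P>) * \<epsilon>"
          using False z by (intro sum_bounded_above h(4)) force+
        then show ?thesis by (simp add: N_def)
      qed
      then have le2: "(\<Sum>Q\<in>\<P>. norm (h Q z)) \<le> 2" using \<epsilon>(2) by simp
      have "norm (\<Sum>Q\<in>\<P>. v Q * h Q z) \<le> (\<Sum>Q\<in>\<P>. B * norm (h Q z))"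
        by (rule sum_norm_le) (use v in \<open>auto simp: norm_mult intro: mult_right_mono\<close>)
      also have "\<dots> = B * (\<Sum>Q\<in>\<P>. norm (h Q z))" by (simp add: sum_distrib_left)
      also have "\<dots> \<le> B * 2" using le2 \<open>B > 0\<close> by (intro mult_left_mono) auto
      finally show ?thesis by simp
    qed
    show "norm ((\<Sum>Q\<in>\<P>. v Q * h Q z) - g z) \<le> B / 2" if z: "z \<in> K" for z
    proof -
      obtain Q0 where Q0: "Q0 \<in> \<P>" "z \<in> Q0" using z P(4) by blast
      have zc: "z \<in> cball 0 1" using z K(2) by auto
      have 1: "norm (v Q0 - g z) \<le> B / 4"
      proof -
        have "dist (SOME z. z \<in> Q0) z < \<delta>" using P(6)[OF Q0(1)] pt[OF Q0(1)] Q0(2) \<rho> by fastforce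
        then have "dist (v Q0) (g z) < B / 4" unfolding v_def using pt[OF Q0(1)] Q0 z P(4) by (intro \<delta>(2)) auto
        then show ?thesis by (simp add: dist_norm)
      qed
      have small: "norm (h Q z - (if Q = Q0 then 1 else 0)) \<le> \<epsilon>" if "Q \<in> \<P>" for Q
      proof (cases "Q = Q0")
        case True then show ?thesis using h(3)[OF Q0] by simp
      next
        case False
        have "norm (h Q z) \<le> \<epsilon>"
          by (rule h(4)[OF that zc]) (use d(2)[OF Q0(1) that _ Q0(2)] False d(1) in fastforce)
        then show ?thesis using False by simp
      qed
      have term_le: "norm (v Q * (h Q z - (if Q = Q0 then 1 else 0))) \<le> B * \<epsilon>" if "Q \<in> \<P>" for Q
        unfolding norm_mult using \<open>B > 0\<close> by (intro mult_mono v small that) auto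
      have "(\<Sum>Q\<in>\<P>. v Q * (if Q = Q0 then 1 else 0)) = v Q0"
        using P(1) Q0(1) by (simp add: if_distrib cong: if_cong)
      then have "(\<Sum>Q\<in>\<P>. v Q * h Q z) - v Q0 = (\<Sum>Q\<in>\<P>. v Q * (h Q z - (if Q = Q0 then 1 else 0)))"
        by (simp only: right_diff_distrib sum_subtractf)
      also have "norm \<dots> \<le> of_nat (card \<P>) * (B * \<epsilon>)"
        using term_le by (intro order_trans[OF norm_sum] sum_bounded_above)
      also have "\<dots> = B * (N * \<epsilon>)" by (simp add: N_def)
      finally have "norm ((\<Sum>Q\<in>\<P>. v Q * h Q z) - v Q0) \<le> B / 4" using \<epsilon>(2) by simp
      with 1 norm_triangle_ineq[of "(\<Sum>Q\<in>\<P>. v Q * h Q z) - v Q0" "v Q0 - g z"] show ?thesis by simp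
    qed
  qed
qed

text \<open>The Rudin--Carleson theorem, by successive approximation.\<close>

lemma disk_fun_interpolation:
  fixes g :: "complex \<Rightarrow> complex"
  assumes K: "compact K" "K \<subseteq> sphere 0 1" "finely_partitionable K"
    and g: "continuous_on K g" "\<And>z. z \<in> K \<Longrightarrow> norm (g z) \<le> B" and "B > 0"
  obtains f where "disk_fun f" "\<And>z. z \<in> cball 0 1 \<Longrightarrow> norm (f z) \<le> 4 * B" "\<And>z. z \<in> K \<Longrightarrow> f z = g z"
proof -
  \<comment> \<open>\<open>R\<close> bounds the correction at stage \<open>n\<close> by twice the
    remaining error, so the corrections sum to \<open>4 * B\<close>. The clause for
    \<open>n = 0\<close> starts at zero, so the telescoping sums are the \<open>F n\<close>
    themselves.\<close>
  define P where "P = (\<lambda>n F. disk_fun F \<and> (\<forall>z\<in>K. norm (F z - g z) \<le> B / 2 ^ n) \<and> (n = 0 \<longrightarrow> F = (\<lambda>_. 0)))"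
  define R where "R = (\<lambda>n (F :: complex \<Rightarrow> complex) F'. \<forall>z\<in>cball 0 1. norm (F' z - F z) \<le> 2 * (B / 2 ^ n))"
  have "\<exists>F. \<forall>n. P n (F n) \<and> R n (F n) (F (Suc n))"
  proof (rule dependent_nat_choice)
    show "\<exists>F. P 0 F" using g(2) by (auto simp: P_def)
    fix F n assume F: "P n F"
    have "continuous_on K F" using F disk_fun_continuous_on_subset[OF _ K(2)] by (simp add: P_def)
    then have "continuous_on K (\<lambda>z. g z - F z)" using g(1) by (intro continuous_intros)
    moreover have "norm (g z - F z) \<le> B / 2 ^ n" if "z \<in> K" for z
      using F that by (auto simp: P_def norm_minus_commute)
    ultimately obtain f where f: "disk_fun f" "\<And>z. z \<in> cball 0 1 \<Longrightarrow> norm (f z) \<le> 2 * (B / 2 ^ n)"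
      "\<And>z. z \<in> K \<Longrightarrow> norm (f z - (g z - F z)) \<le> B / 2 ^ n / 2"
      using disk_fun_interpolation_step[OF K, of "\<lambda>z. g z - F z" "B / 2 ^ n"] \<open>B > 0\<close> by auto
    show "\<exists>F'. P (Suc n) F' \<and> R n F F'"
    proof (intro exI[of _ "\<lambda>z. F z + f z"] conjI)
      show "P (Suc n) (\<lambda>z. F z + f z)"
        using F f(1) f(3) by (auto simp: P_def algebra_simps)
      show "R n F (\<lambda>z. F z + f z)" using f(2) by (simp add: R_def)
    qed
  qed
  then obtain F where F: "\<And>n. P n (F n)" "\<And>n. R n (F n) (F (Suc n))" by blast
  have geo: "(\<lambda>n. 2 * (B / 2 ^ n)) sums (4 * B)"
    using sums_mult[OF geometric_sums[of "1/2 :: real"], of "2 * B"] by (simp add: power_divide)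
  define f where "f = (\<lambda>z. suminf (\<lambda>n. F (Suc n) z - F n z))"
  have ulim: "uniform_limit (cball 0 1) (\<lambda>n z. \<Sum>i<n. F (Suc i) z - F i z) f sequentially"
    unfolding f_def using F(2) geo
    by (intro Weierstrass_m_test[where M = "\<lambda>n. 2 * (B / 2 ^ n)"]) (auto simp: R_def sums_iff)
  have F0: "F 0 z = 0" for z using F(1)[of 0] by (simp add: P_def)
  have tele: "(\<lambda>n z. \<Sum>i<n. F (Suc i) z - F i z) = F"
  proof (intro ext)
    show "(\<Sum>i<n. F (Suc i) z - F i z) = F n z" for n z
      using sum_lessThan_telescope[of "\<lambda>i. F i z" n] by (simp only: F0 diff_0_right)
  qed
  have lim: "uniform_limit (cball 0 1) F f sequentially"
    using ulim unfolding tele .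
  show ?thesis
  proof (rule that[of f])
    show "disk_fun f" using lim by (rule disk_fun_uniform_limit[rotated]) (use F(1) in \<open>simp add: P_def\<close>)
    show "norm (f z) \<le> 4 * B" if "z \<in> cball 0 1" for z
    proof -
      have "norm (f z) \<le> suminf (\<lambda>n. 2 * (B / 2 ^ n))" unfolding f_def
        using F(2) that geo by (intro norm_suminf_le) (auto simp: R_def sums_iff)
      then show ?thesis using geo by (simp add: sums_iff)
    qed
    show "f z = g z" if "z \<in> K" for z
    proof (rule LIMSEQ_unique)
      show "(\<lambda>n. F n z) \<longlonglongrightarrow> f z"
        using lim by (rule tendsto_uniform_limitI) (use that K(2) in auto)
      have "(\<lambda>n. B / 2 ^ n) \<longlonglongrightarrow> 0" by real_asymp
      then have "(\<lambda>n. F n z - g z) \<longlonglongrightarrow> 0"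
        by (rule Lim_null_comparison[rotated]) (use F(1) that in \<open>auto simp: P_def\<close>)
      then show "(\<lambda>n. F n z) \<longlonglongrightarrow> g z" by (simp add: LIM_zero_iff)
    qed
  qed
qed

text \<open>The approximate indicator misses \<open>1\<close> on \<open>K\<close> by at most
  \<open>\<epsilon>\<close>; interpolating this defect exactly costs only
  \<open>4 * \<epsilon>\<close> in norm, whence the bound \<open>5\<close> and, away from
  \<open>K\<close>, \<open>5 * \<epsilon> \<le> \<eta>\<close>.\<close>

lemma disk_fun_decaying_extension_of_one:
  fixes K :: "complex set"
  assumes K: "compact K" "K \<subseteq> sphere 0 1" "finely_partitionable K" and "d > 0" "\<eta> > 0"
  obtains f where "disk_fun f" "\<And>z. z \<in> cball 0 1 \<Longrightarrow> norm (f z) \<le> 5" "\<And>z. z \<in> K \<Longrightarrow> f z = 1"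
    "\<And>z. z \<in> cball 0 1 \<Longrightarrow> (\<And>w. w \<in> K \<Longrightarrow> d \<le> dist z w) \<Longrightarrow> norm (f z) \<le> \<eta>"
proof -
  define \<epsilon> where "\<epsilon> = min 1 (\<eta> / 5)"
  have \<epsilon>: "0 < \<epsilon>" "\<epsilon> \<le> 1" "5 * \<epsilon> \<le> \<eta>" using \<open>\<eta> > 0\<close> by (auto simp: \<epsilon>_def)
  obtain h where h: "disk_fun h" "\<And>z. z \<in> cball 0 1 \<Longrightarrow> norm (h z) \<le> 1"
    "\<And>z. z \<in> K \<Longrightarrow> norm (h z - 1) \<le> \<epsilon>"
    "\<And>z. z \<in> cball 0 1 \<Longrightarrow> (\<And>q. q \<in> K \<Longrightarrow> d \<le> dist z q) \<Longrightarrow> norm (h z) \<le> \<epsilon>"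
    using disk_fun_approx_indicator[OF K(2) finely_coverable_subset[OF K(3) order_refl] \<open>d > 0\<close> \<epsilon>(1)]
    by metis
  have "continuous_on K h" using h(1) K(2) by (rule disk_fun_continuous_on_subset)
  then have "continuous_on K (\<lambda>z. 1 - h z)" by (intro continuous_intros)
  then obtain e where e: "disk_fun e" "\<And>z. z \<in> cball 0 1 \<Longrightarrow> norm (e z) \<le> 4 * \<epsilon>"
    "\<And>z. z \<in> K \<Longrightarrow> e z = 1 - h z"
    using disk_fun_interpolation[OF K, of "\<lambda>z. 1 - h z" \<epsilon>] \<epsilon>(1) h(3)
    by (auto simp: norm_minus_commute)
  show ?thesis
  proof (rule that[of "\<lambda>z. h z + e z"])
    show "disk_fun (\<lambda>z. h z + e z)" using h e by blast
    show "norm (h z + e z) \<le> 5" if "z \<in> cball 0 1" for z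
      using norm_triangle_ineq[of "h z" "e z"] h(2)[OF that] e(2)[OF that] \<epsilon> by linarith
    show "h z + e z = 1" if "z \<in> K" for z using e(3)[OF that] by simp
    show "norm (h z + e z) \<le> \<eta>" if "z \<in> cball 0 1" "\<And>w. w \<in> K \<Longrightarrow> d \<le> dist z w" for z
      using norm_triangle_ineq[of "h z" "e z"] h(4)[OF that] e(2)[OF that(1)] \<epsilon> by linarith
  qed
qed

section \<open>A Cantor set over the Hilbert cube\<close>

text \<open>For \<open>q < 1/2\<close> distinct digit sequences have distinct sums, which form a
  Cantor set; for \<open>q = 1/2\<close> this is the binary expansion, which is onto
  \<open>{0..1}\<close>.\<close>

definition digit_sum :: "real \<Rightarrow> (nat \<Rightarrow> bool) \<Rightarrow> real" where
  "digit_sum q b = suminf (\<lambda>i. of_bool (b i) * q ^ Suc i)"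

context
  fixes q :: real
  assumes q: "0 < q" "q < 1"
begin

lemma geometric_sums_Suc: "(\<lambda>i. q ^ Suc i) sums (q / (1 - q))"
  using sums_mult[OF geometric_sums[of q], of q] q by simp

lemma digit_sum_summable: "summable (\<lambda>i. of_bool (b i) * q ^ Suc i)"
  by (rule summable_comparison_test'[where N = 0 and g = "\<lambda>i. q ^ Suc i"])
    (use geometric_sums_Suc q in \<open>auto simp: sums_iff\<close>)

lemma digit_sum_nonneg: "0 \<le> digit_sum q b"
  unfolding digit_sum_def by (rule suminf_nonneg[OF digit_sum_summable]) (use q in auto)

lemma digit_sum_le: "digit_sum q b \<le> q / (1 - q)"
proof -
  have "digit_sum q b \<le> suminf (\<lambda>i. q ^ Suc i)"
    unfolding digit_sum_def using geometric_sums_Suc q digit_sum_summable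
    by (intro suminf_le) (auto simp: sums_iff)
  then show ?thesis using geometric_sums_Suc by (simp add: sums_iff)
qed

lemma digit_sum_rec: "digit_sum q b = q * (of_bool (b 0) + digit_sum q (\<lambda>i. b (Suc i)))"
proof -
  have "digit_sum q b = suminf (\<lambda>i. of_bool (b (Suc i)) * q ^ Suc (Suc i)) + of_bool (b 0) * q ^ Suc 0"
    unfolding digit_sum_def by (subst suminf_split_head[OF digit_sum_summable]) simp
  also have "suminf (\<lambda>i. of_bool (b (Suc i)) * q ^ Suc (Suc i)) = q * digit_sum q (\<lambda>i. b (Suc i))"
    unfolding digit_sum_def by (subst suminf_mult[OF digit_sum_summable, symmetric]) (simp add: mult_ac)
  finally show ?thesis by (simp add: algebra_simps)
qed

lemma digit_sum_diff_le:
  assumes "\<And>i. i < k \<Longrightarrow> b i = b' i"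
  shows "\<bar>digit_sum q b - digit_sum q b'\<bar> \<le> q ^ k * (q / (1 - q))"
  using assms
proof (induction k arbitrary: b b')
  case 0
  show ?case using digit_sum_nonneg[of b] digit_sum_nonneg[of b'] digit_sum_le[of b] digit_sum_le[of b']
    by simp
next
  case (Suc k)
  have "b 0 = b' 0" using Suc.prems by simp
  then have "digit_sum q b - digit_sum q b'
      = q * (digit_sum q (\<lambda>i. b (Suc i)) - digit_sum q (\<lambda>i. b' (Suc i)))"
    using digit_sum_rec[of b] digit_sum_rec[of b'] by (simp add: algebra_simps)
  then have "\<bar>digit_sum q b - digit_sum q b'\<bar>
      = q * \<bar>digit_sum q (\<lambda>i. b (Suc i)) - digit_sum q (\<lambda>i. b' (Suc i))\<bar>"
    using q by (simp add: abs_mult)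
  also have "\<dots> \<le> q * (q ^ k * (q / (1 - q)))"
    using Suc.prems q by (intro mult_left_mono Suc.IH) auto
  finally show ?case by (simp add: mult_ac)
qed

lemma continuous_on_digit_sum: "continuous_on UNIV (digit_sum q)"
proof -
  have "uniform_limit UNIV (\<lambda>n b. \<Sum>i<n. of_bool (b i) * q ^ Suc i) (digit_sum q) sequentially"
    unfolding digit_sum_def [abs_def] using geometric_sums_Suc q
    by (intro Weierstrass_m_test[where M = "\<lambda>i. q ^ Suc i"]) (auto simp: sums_iff)
  moreover have "continuous_on UNIV (\<lambda>b::nat \<Rightarrow> bool. of_bool (b i) :: real)" for i
    by (rule continuous_on_compose2[OF Topological_Spaces.continuous_on_discrete[of UNIV "of_bool :: bool \<Rightarrow> real"]
        continuous_on_product_coordinates[of i]]) simp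
  then have "continuous_on UNIV (\<lambda>b::nat \<Rightarrow> bool. \<Sum>i<n. of_bool (b i) * q ^ Suc i)" for n
    by (intro continuous_intros)
  ultimately show ?thesis
    by (intro uniform_limit_theorem[where F = sequentially]) auto
qed

text \<open>The tail is at most \<open>q / (1 - q) < 1\<close>, less than one unit of the leading
  digit, so the leading digit can be read off.\<close>

lemma digit_sum_eqD:
  assumes "q < 1 / 2" and eq: "digit_sum q b = digit_sum q b'"
  shows "b 0 = b' 0" "digit_sum q (\<lambda>i. b (Suc i)) = digit_sum q (\<lambda>i. b' (Suc i))"
proof -
  define s where "s = digit_sum q (\<lambda>i. b (Suc i))"
  define s' where "s' = digit_sum q (\<lambda>i. b' (Suc i))"
  have "q / (1 - q) < 1" using q assms(1) by (simp add: field_simps)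
  then have bounds: "0 \<le> s" "s < 1" "0 \<le> s'" "s' < 1"
    using digit_sum_nonneg digit_sum_le unfolding s_def s'_def by (auto intro: le_less_trans)
  have "q * (of_bool (b 0) + s) = digit_sum q b" unfolding s_def by (rule digit_sum_rec[symmetric])
  also have "\<dots> = digit_sum q b'" by (rule eq)
  also have "\<dots> = q * (of_bool (b' 0) + s')" unfolding s'_def by (rule digit_sum_rec)
  finally have "of_bool (b 0) + s = of_bool (b' 0) + s'" using q by simp
  then show "b 0 = b' 0" "s = s'" using bounds by (cases "b 0"; cases "b' 0"; simp)+
qed

lemma inj_digit_sum:
  assumes "q < 1 / 2"
  shows "inj (digit_sum q)"
proof (rule injI)
  fix b b' :: "nat \<Rightarrow> bool"
  assume "digit_sum q b = digit_sum q b'"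
  then have "b n = b' n" for n
  proof (induction n arbitrary: b b')
    case 0
    then show ?case by (rule digit_sum_eqD(1)[OF assms])
  next
    case (Suc n)
    show ?case using digit_sum_eqD(2)[OF assms Suc.prems] by (rule Suc.IH)
  qed
  then show "b = b'" by (rule ext)
qed

end

lemma binary_expansion_exists:
  assumes "0 \<le> y" "y \<le> 1"
  shows "\<exists>b. digit_sum (1/2) b = y"
proof -
  \<comment> \<open>Greedy expansion: \<open>r n\<close> is the remainder after \<open>n\<close>
    digits, rescaled by \<open>2 ^ n\<close>; it stays in \<open>{0..1}\<close>, and
    \<open>y = 1\<close> receives only digits \<open>1\<close>.\<close>
  define r where "r = rec_nat y (\<lambda>_ r. 2 * r - of_bool (r \<ge> 1 / 2))"
  define b where "b = (\<lambda>n. r n \<ge> 1 / 2)"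
  have r0: "r 0 = y" and rS: "r (Suc n) = 2 * r n - of_bool (b n)" for n
    by (simp_all add: r_def b_def)
  have bd: "0 \<le> r n \<and> r n \<le> 1" for n
    by (induction n) (use assms in \<open>auto simp: r0 rS b_def\<close>)
  have eq: "(\<Sum>i<n. of_bool (b i) * (1/2) ^ Suc i) = y - (1/2) ^ n * r n" for n
    by (induction n) (simp_all add: r0 rS field_simps)
  have "(\<lambda>n. (1/2) ^ n * r n) \<longlonglongrightarrow> 0"
  proof (rule Lim_null_comparison)
    show "\<forall>\<^sub>F n in sequentially. norm ((1/2) ^ n * r n) \<le> (1/2) ^ n"
      using bd by (intro always_eventually allI) (simp add: abs_mult mult_left_le)
    show "(\<lambda>n. (1/2) ^ n :: real) \<longlonglongrightarrow> 0" by (rule LIMSEQ_realpow_zero) auto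
  qed
  then have "(\<lambda>n. y - (1/2) ^ n * r n) \<longlonglongrightarrow> y - 0" by (intro tendsto_intros)
  then have "(\<lambda>i. of_bool (b i) * (1/2) ^ Suc i) sums y" unfolding sums_def eq by simp
  then show ?thesis unfolding digit_sum_def by (auto simp: sums_iff)
qed

lemma dist_cis_le: "dist (cis s) (cis t) \<le> \<bar>s - t\<bar>"
proof -
  have "cis s - cis t = cis t * (cis (s - t) - 1)" by (simp add: algebra_simps cis_mult)
  then have "dist (cis s) (cis t) = norm (cis (s - t) - 1)" by (simp add: dist_norm norm_mult)
  also have "\<dots> = 2 * \<bar>sin ((s - t) / 2)\<bar>" using dist_exp_i_1[of "s - t"] by (simp add: cis_conv_exp)
  also have "\<dots> \<le> \<bar>s - t\<bar>" using abs_sin_x_le_abs_x[of "(s - t) / 2"] by simp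
  finally show ?thesis .
qed

lemma compact_UNIV_Cantor: "compact (UNIV :: (nat \<Rightarrow> bool) set)"
proof -
  have "compact (UNIV :: bool set)" by (simp add: finite_imp_compact)
  then have "compact_space (product_topology (\<lambda>_::nat. euclidean :: bool topology) UNIV)"
    by (subst compact_space_product_topology) (simp add: compact_space_def)
  then show ?thesis by (simp add: euclidean_product_topology compact_space_def)
qed

text \<open>One pair of \<open>K\<close> and \<open>x\<close> serves every rank above
  \<open>1\<close>; only the set of coordinates varies. Surjectivity is onto the whole Hilbert cube,
  so all coordinates can be prescribed at once.\<close>

locale boundary_cube =
  fixes K :: "complex set" and x :: "nat \<Rightarrow> complex \<Rightarrow> real"
  assumes compact_K: "compact K" and K_sphere: "K \<subseteq> sphere 0 1" and fine_K: "finely_partitionable K"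
    and cont_x: "\<And>j. continuous_on K (x j)" and x_range: "\<And>j z. z \<in> K \<Longrightarrow> x j z \<in> {0..1}"
    and x_onto: "\<And>y. (\<And>j. y j \<in> {0..1}) \<Longrightarrow> \<exists>z\<in>K. \<forall>j. x j z = y j"

text \<open>Bit sequences are placed on the circle as a Cantor set; splitting the bits into
  countably many sequences and reading each as a binary expansion gives the coordinates.\<close>

lemma boundary_cube_exists: "\<exists>K x. boundary_cube K x"
proof -
  \<comment> \<open>The ratio \<open>1/4\<close> is below \<open>1/2\<close>, so the sums are
    injective; they are at most \<open>1/3\<close>, so \<open>cis\<close> is injective on them; and
    \<open>2 ^ k\<close> pieces of diameter at most \<open>(1/4) ^ k\<close> have total size at most
    \<open>(1/2) ^ k\<close>.\<close>
  define \<phi> where "\<phi> = (\<lambda>b. cis (digit_sum (1/4) b))"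
  have cont_\<phi>: "continuous_on UNIV \<phi>"
    unfolding \<phi>_def cis_conv_exp using continuous_on_digit_sum[of "1/4"] by (intro continuous_intros) auto
  have "inj \<phi>"
  proof (rule injI)
    fix b b' assume eq: "\<phi> b = \<phi> b'"
    have "0 \<le> digit_sum (1/4) b \<and> digit_sum (1/4) b \<le> pi" for b
      using digit_sum_nonneg[of "1/4" b] digit_sum_le[of "1/4" b] pi_gt3 by simp
    moreover have "cos (digit_sum (1/4) b) = cos (digit_sum (1/4) b')"
      using eq by (simp add: \<phi>_def complex_eq_iff)
    ultimately have "digit_sum (1/4) b = digit_sum (1/4) b'" by (metis cos_inj_pi)
    then show "b = b'" by (rule injD[OF inj_digit_sum, rotated -1]) simp_all
  qed
  define K where "K = range \<phi>"
  define \<beta> where "\<beta> = the_inv_into UNIV \<phi>"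
  have \<beta>: "\<beta> (\<phi> b) = b" for b unfolding \<beta>_def using \<open>inj \<phi>\<close> by (simp add: the_inv_f_f)
  have cont_\<beta>: "continuous_on K \<beta>"
    unfolding K_def \<beta>_def using cont_\<phi> compact_UNIV_Cantor \<open>inj \<phi>\<close> by (rule continuous_on_inv_into)
  define x where "x = (\<lambda>j z. digit_sum (1/2) (\<lambda>i. \<beta> z (prod_encode (j, i))))"
  show ?thesis
  proof (rule exI[of _ K], rule exI[of _ x], unfold_locales)
    show "compact K" unfolding K_def using cont_\<phi> compact_UNIV_Cantor by (rule compact_continuous_image)
    show "K \<subseteq> sphere 0 1" by (auto simp: K_def \<phi>_def)
    show "continuous_on K (x j)" for j
    proof -
      have "continuous_on K (\<lambda>z. \<beta> z (prod_encode (j, i)))" for i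
        using continuous_on_compose2[OF continuous_on_product_coordinates cont_\<beta>] by simp
      then have "continuous_on K (\<lambda>z i. \<beta> z (prod_encode (j, i)))" by (intro continuous_on_coordinatewise_then_product)
      then show ?thesis
        unfolding x_def using continuous_on_compose2[OF continuous_on_digit_sum[of "1/2"]] by auto
    qed
    show "x j z \<in> {0..1}" if "z \<in> K" for j z
      using digit_sum_nonneg[of "1/2"] digit_sum_le[of "1/2"] by (simp add: x_def)
    show "\<exists>z\<in>K. \<forall>j. x j z = y j" if y: "\<And>j. y j \<in> {0..1}" for y
    proof -
      have "\<forall>j. \<exists>b. digit_sum (1/2) b = y j" using y binary_expansion_exists by simp
      then obtain b where b: "\<And>j. digit_sum (1/2) (b j) = y j" by metis
      define c where "c = (\<lambda>n. b (fst (prod_decode n)) (snd (prod_decode n)))"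
      have "x j (\<phi> c) = y j" for j by (simp add: x_def \<beta> c_def b)
      then show ?thesis by (auto simp: K_def)
    qed
    show "finely_partitionable K"
      unfolding finely_partitionable_def
    proof (intro allI impI)
      fix \<eta> :: real assume "\<eta> > 0"
      then obtain k where k: "(1/2) ^ k < \<eta>" using real_arch_pow_inv[of \<eta> "1/2"] by auto
      define C where "C = (\<lambda>S. {b. \<forall>i<k. b i = (i \<in> S)})"
      define \<P> where "\<P> = (\<lambda>S. \<phi> ` C S) ` Pow {..<k}"
      have "card \<P> \<le> 2 ^ k"
        using card_image_le[of "Pow {..<k}" "\<lambda>S. \<phi> ` C S"] by (simp add: \<P>_def card_Pow)
      then have "real (card \<P>) \<le> 2 ^ k" by (simp flip: of_nat_le_iff)
      then have "real (card \<P>) * (1/4) ^ k \<le> 2 ^ k * (1/4) ^ k" by (rule mult_right_mono) simp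
      also have "\<dots> = (1/2) ^ k" by (simp flip: power_mult_distrib)
      finally have card: "real (card \<P>) * (1/4) ^ k < \<eta>" using k by simp
      have compact_C: "compact (\<phi> ` C S)" for S
      proof -
        have "closed {b :: nat \<Rightarrow> bool. b i = (i \<in> S)}" for i
          by (intro closed_Collect_eq continuous_on_const) simp
        then have "closed (\<Inter>i\<in>{..<k}. {b :: nat \<Rightarrow> bool. b i = (i \<in> S)})" by blast
        also have "(\<Inter>i\<in>{..<k}. {b :: nat \<Rightarrow> bool. b i = (i \<in> S)}) = C S" by (auto simp: C_def)
        finally have "compact (C S)" using compact_UNIV_Cantor compact_Int_closed[of UNIV "C S"] by simp
        then show ?thesis using cont_\<phi> by (intro compact_continuous_image) (auto intro: continuous_on_subset)
      qed
      have ne: "C S \<noteq> {}" for S by (auto simp: C_def intro!: exI[of _ "\<lambda>i. i \<in> S"])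
      have disj: "pairwise disjnt \<P>"
      proof -
        have "\<phi> ` C S \<inter> \<phi> ` C T = {}" if ST: "S \<subseteq> {..<k}" "T \<subseteq> {..<k}" "S \<noteq> T" for S T
        proof (rule ccontr)
          assume "\<phi> ` C S \<inter> \<phi> ` C T \<noteq> {}"
          then obtain b b' where b: "b \<in> C S" "b' \<in> C T" and "\<phi> b = \<phi> b'" by fast
          then have "b = b'" by (intro injD[OF \<open>inj \<phi>\<close>])
          then have S: "b i = (i \<in> S)" and T: "b i = (i \<in> T)" if "i < k" for i
            using that \<open>b \<in> C S\<close> \<open>b' \<in> C T\<close> unfolding C_def by blast+
          have "i \<in> S \<longleftrightarrow> i \<in> T" for i using ST(1,2) S[of i] T[of i] by blast
          then have "S = T" by (rule Set.set_eqI)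
          then show False using ST(3) by blast
        qed
        then show ?thesis unfolding \<P>_def pairwise_image pairwise_def disjnt_def by blast
      qed
      have diam: "dist (\<phi> b) (\<phi> b') \<le> (1/4) ^ k" if "b \<in> C S" "b' \<in> C S" for b b' S
      proof -
        have "dist (\<phi> b) (\<phi> b') \<le> \<bar>digit_sum (1/4) b - digit_sum (1/4) b'\<bar>"
          unfolding \<phi>_def by (rule dist_cis_le)
        also have "\<dots> \<le> (1/4) ^ k * ((1/4) / (1 - 1/4))"
          by (rule digit_sum_diff_le) (use that in \<open>auto simp: C_def\<close>)
        also have "\<dots> \<le> (1/4) ^ k" by simp
        finally show ?thesis .
      qed
      have un: "\<Union>\<P> = K"
      proof -
        have "b \<in> C {i. i < k \<and> b i}" for b by (auto simp: C_def)
        moreover have "{i. i < k \<and> b i} \<in> Pow {..<k}" for b by auto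
        ultimately have "\<exists>S\<in>Pow {..<k}. \<phi> b \<in> \<phi> ` C S" for b by blast
        then show ?thesis by (auto simp: \<P>_def K_def)
      qed
      show "\<exists>\<P> \<rho>. finite \<P> \<and> \<rho> > 0 \<and> real (card \<P>) * \<rho> < \<eta> \<and> \<Union>\<P> = K \<and> pairwise disjnt \<P> \<and>
        (\<forall>Q\<in>\<P>. compact Q \<and> Q \<noteq> {} \<and> (\<forall>z\<in>Q. \<forall>w\<in>Q. dist z w \<le> \<rho>))"
        using card un disj compact_C ne diam
        by (intro exI[of _ \<P>] exI[of _ "(1/4) ^ k"] conjI) (auto simp: \<P>_def)
    qed
  qed
qed

section \<open>Removing common zeros on the Cantor set\<close>

text \<open>This replaces the passage to the quotient of \<open>K\<close> by the coordinates. Pairs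
  whose values differ by at least \<open>\<epsilon>\<close> form a compact set, on which the
  coordinate distance is positive and so has a positive minimum.\<close>

lemma uniform_continuity_over_coordinates:
  fixes f :: "'a::metric_space \<Rightarrow> 'b::metric_space" and x :: "'i \<Rightarrow> 'a \<Rightarrow> real"
  assumes K: "compact K" and f: "continuous_on K f" and x: "\<And>j. j \<in> I \<Longrightarrow> continuous_on K (x j)"
    and fib: "\<And>z w. z \<in> K \<Longrightarrow> w \<in> K \<Longrightarrow> (\<And>j. j \<in> I \<Longrightarrow> x j z = x j w) \<Longrightarrow> f z = f w"
    and I: "finite I" and "\<epsilon> > 0"
  obtains \<eta> where "\<eta> > 0"
    "\<And>z w. z \<in> K \<Longrightarrow> w \<in> K \<Longrightarrow> (\<Sum>j\<in>I. \<bar>x j z - x j w\<bar>) < \<eta> \<Longrightarrow> dist (f z) (f w) < \<epsilon>"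
proof -
  define D where "D = (\<lambda>p. \<Sum>j\<in>I. \<bar>x j (fst p) - x j (snd p)\<bar>)"
  define T where "T = {p \<in> K \<times> K. \<epsilon> \<le> dist (f (fst p)) (f (snd p))}"
  have fst_snd: "continuous_on (K \<times> K) (\<lambda>p. h (fst p))" "continuous_on (K \<times> K) (\<lambda>p. h (snd p))"
    if "continuous_on K h" for h :: "'a \<Rightarrow> 'c::topological_space"
    by (rule continuous_on_compose2[OF that]; force intro: continuous_intros)+
  have "continuous_on (K \<times> K) (\<lambda>p. dist (f (fst p)) (f (snd p)))"
    using fst_snd[OF f] by (intro continuous_intros)
  then have "closed T"
    unfolding T_def using K
    by (intro continuous_on_closed_Collect_le continuous_on_const closed_Times compact_imp_closed)
  moreover have "T \<subseteq> K \<times> K" by (auto simp: T_def)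
  ultimately have "compact T"
    using compact_Int_closed[OF compact_Times[OF K K], of T] by (simp add: Int_absorb1)
  have "continuous_on (K \<times> K) D"
    unfolding D_def using fst_snd[OF x] by (intro continuous_intros)
  then have D: "continuous_on T D" using \<open>T \<subseteq> K \<times> K\<close> by (rule continuous_on_subset)
  show ?thesis
  proof (cases "T = {}")
    case True
    show ?thesis by (rule that[of 1]) (use True in \<open>force simp: T_def\<close>)+
  next
    case False
    then obtain p where p: "p \<in> T" "\<And>q. q \<in> T \<Longrightarrow> D p \<le> D q"
      using continuous_attains_inf[OF \<open>compact T\<close> _ D] by blast
    have "D p \<noteq> 0"
    proof
      assume "D p = 0"
      then have "x j (fst p) = x j (snd p)" if "j \<in> I" for j
        using that I by (simp add: D_def sum_nonneg_eq_0_iff)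
      then have "f (fst p) = f (snd p)" using p(1) by (intro fib) (auto simp: T_def)
      then show False using p(1) \<open>\<epsilon> > 0\<close> by (simp add: T_def)
    qed
    moreover have "D p \<ge> 0" by (simp add: D_def sum_nonneg)
    ultimately show ?thesis
    proof (intro that[of "D p"])
      fix z w assume zw: "z \<in> K" "w \<in> K" "(\<Sum>j\<in>I. \<bar>x j z - x j w\<bar>) < D p"
      then have "\<not> D p \<le> D (z, w)" by (simp add: D_def)
      then have "(z, w) \<notin> T" using p(2) by blast
      then show "dist (f z) (f w) < \<epsilon>" using zw by (simp add: T_def)
    qed simp
  qed
qed

text \<open>McShane's infimal convolution.\<close>

lemma Lipschitz_approximation_over_coordinates:
  fixes u :: "'a::metric_space \<Rightarrow> real" and x :: "'i \<Rightarrow> 'a \<Rightarrow> real"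
  assumes K: "compact K" and u: "continuous_on K u" and x: "\<And>j. j \<in> I \<Longrightarrow> continuous_on K (x j)"
    and fib: "\<And>z w. z \<in> K \<Longrightarrow> w \<in> K \<Longrightarrow> (\<And>j. j \<in> I \<Longrightarrow> x j z = x j w) \<Longrightarrow> u z = u w"
    and I: "finite I" and "\<epsilon> > 0"
  obtains g L where "L > 0"
    "\<And>z w. z \<in> K \<Longrightarrow> w \<in> K \<Longrightarrow> \<bar>g z - g w\<bar> \<le> L * (\<Sum>j\<in>I. \<bar>x j z - x j w\<bar>)"
    "\<And>z. z \<in> K \<Longrightarrow> \<bar>g z - u z\<bar> \<le> \<epsilon>"
proof -
  define D where "D = (\<lambda>z w. \<Sum>j\<in>I. \<bar>x j z - x j w\<bar>)"
  have D_eq: "D z w = (\<Sum>j\<in>I. \<bar>x j z - x j w\<bar>)" for z w by (simp add: D_def)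
  have D0: "D z z = 0" and D_nonneg: "0 \<le> D z w" for z w
    by (auto simp: D_def sum_nonneg)
  have D_sym: "D z w = D w z" for z w by (simp add: D_def abs_minus_commute)
  have D_tri: "D z w \<le> D z y + D y w" for z y w
    unfolding D_def sum.distrib[symmetric] by (rule sum_mono) auto
  obtain \<eta> where \<eta>: "\<eta> > 0" "\<And>z w. z \<in> K \<Longrightarrow> w \<in> K \<Longrightarrow> D z w < \<eta> \<Longrightarrow> dist (u z) (u w) < \<epsilon>"
    unfolding D_def by (rule uniform_continuity_over_coordinates[of K u I x \<epsilon>, OF K u x fib I \<open>\<epsilon> > 0\<close>]) blast+
  have "bounded (u ` K)" using u K by (simp add: compact_continuous_image compact_imp_bounded)
  then obtain M where M: "M > 0" "\<And>z. z \<in> K \<Longrightarrow> \<bar>u z\<bar> \<le> M" by (auto simp: bounded_pos)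
  \<comment> \<open>Where \<open>D z w \<ge> \<eta>\<close>, the penalty \<open>L * D z w\<close> is
    at least \<open>2 * M\<close>, hence at least the oscillation of \<open>u\<close>; so only
    points with \<open>D z w < \<eta>\<close> can pull the infimum below \<open>u z\<close>, and by
    at most \<open>\<epsilon>\<close>.\<close>
  define L where "L = 2 * M / \<eta>"
  have "L > 0" using M \<eta> by (simp add: L_def)
  define g where "g = (\<lambda>z. INF w\<in>K. u w + L * D z w)"
  have bdd: "bdd_below ((\<lambda>w. u w + L * D z w) ` K)" for z
  proof (rule bdd_belowI2)
    fix w assume "w \<in> K"
    then show "- M \<le> u w + L * D z w"
      using M(2)[of w] mult_nonneg_nonneg[of L "D z w"] \<open>L > 0\<close> D_nonneg[of z w] by linarith
  qed
  have g_le: "g z \<le> u w + L * D z w" if "w \<in> K" for z w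
    unfolding g_def using bdd that by (rule cINF_lower)
  have g_mono: "g z \<le> g z' + L * D z z'" if "K \<noteq> {}" for z z'
  proof -
    have "g z - L * D z z' \<le> u w + L * D z' w" if "w \<in> K" for w
    proof -
      have "L * D z w \<le> L * (D z z' + D z' w)" using D_tri \<open>L > 0\<close> by (intro mult_left_mono) auto
      then show ?thesis using g_le[OF that, of z] by (simp add: algebra_simps)
    qed
    then have "g z - L * D z z' \<le> g z'"
      unfolding g_def[of] by (intro cINF_greatest) (use that in \<open>auto simp: g_def\<close>)
    then show ?thesis by simp
  qed
  show ?thesis
  proof (rule that[of L g])
    show "\<bar>g z - g w\<bar> \<le> L * (\<Sum>j\<in>I. \<bar>x j z - x j w\<bar>)" if "z \<in> K" "w \<in> K" for z w
    proof -
      have "K \<noteq> {}" using that by blast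
      then show ?thesis using g_mono[of z w] g_mono[of w z] D_sym[of w z]
        by (simp add: abs_le_iff flip: D_eq)
    qed
    show "\<bar>g z - u z\<bar> \<le> \<epsilon>" if z: "z \<in> K" for z
    proof -
      have "g z \<le> u z" using g_le[OF z, of z] D0 by simp
      moreover have "u z - \<epsilon> \<le> g z"
        unfolding g_def
      proof (rule cINF_greatest)
        fix w assume w: "w \<in> K"
        show "u z - \<epsilon> \<le> u w + L * D z w"
        proof (cases "D z w < \<eta>")
          case True
          then have "\<bar>u z - u w\<bar> < \<epsilon>" using \<eta>(2) z w by (simp add: dist_real_def)
          moreover have "0 \<le> L * D z w" using \<open>L > 0\<close> D_nonneg[of z w] by simp
          ultimately show ?thesis by linarith
        next
          case False
          then have "L * \<eta> \<le> L * D z w" using \<open>L > 0\<close> by (intro mult_left_mono) auto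
          then have "2 * M \<le> L * D z w" using \<eta>(1) by (simp add: L_def)
          then show ?thesis using M(2)[OF z] M(2)[OF w] \<open>\<epsilon> > 0\<close> by linarith
        qed
      qed (use z in blast)
      ultimately show ?thesis using \<open>\<epsilon> > 0\<close> by linarith
    qed
  qed (rule \<open>L > 0\<close>)
qed

text \<open>A Lipschitz image of a \<open>d\<close>-dimensional cube cannot meet all points of a fine grid
  in dimension \<open>e > d\<close>.\<close>

lemma Lipschitz_image_misses_point:
  fixes x g :: "nat \<Rightarrow> 'a \<Rightarrow> real"
  assumes x: "\<And>j z. j < d \<Longrightarrow> z \<in> K \<Longrightarrow> x j z \<in> {0..1}"
    and g: "\<And>i z w. i < e \<Longrightarrow> z \<in> K \<Longrightarrow> w \<in> K \<Longrightarrow> \<bar>g i z - g i w\<bar> \<le> L * (\<Sum>j<d. \<bar>x j z - x j w\<bar>)"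
    and "d < e" "\<delta> > 0" "L > 0"
  obtains c where "\<And>i. \<bar>c i\<bar> \<le> \<delta>" "\<And>z. z \<in> K \<Longrightarrow> \<exists>i<e. g i z \<noteq> c i"
proof -
  \<comment> \<open>On a cell of mesh \<open>1 / N\<close> with \<open>N = A * M\<close>, this
    choice makes \<open>g i\<close> vary by less than the grid spacing
    \<open>\<delta> / M\<close>.\<close>
  obtain A where A: "real A * \<delta> > L * real d" using reals_Archimedean3[OF \<open>\<delta> > 0\<close>] by blast
  have "0 \<le> L * real d" using \<open>L > 0\<close> by simp
  then have "A > 0" using A \<open>\<delta> > 0\<close> by (cases A) auto
  \<comment> \<open>There are \<open>M ^ e \<ge> M * M ^ d\<close> grid points, but at most
    \<open>(N + 1) ^ d \<le> (2 * A) ^ d * M ^ d\<close> cells; \<open>M > (2 * A) ^ d\<close> makes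
    the grid larger.\<close>
  define M where "M = Suc ((2 * A) ^ d)"
  have "M > 0" by (simp add: M_def)
  then have M: "real M > 0" by simp
  define N where "N = A * M"
  have "N > 0" using \<open>A > 0\<close> by (simp add: N_def M_def)
  define cell where "cell = (\<lambda>z. \<lambda>j\<in>{..<d}. nat \<lfloor>real N * x j z\<rfloor>)"
  have cell_mem: "cell z \<in> {..<d} \<rightarrow>\<^sub>E {..N}" if "z \<in> K" for z
  proof -
    have "nat \<lfloor>real N * x j z\<rfloor> \<le> N" if "j < d" for j
    proof -
      have "real N * x j z \<le> real N" using x[OF that \<open>z \<in> K\<close>] by (simp add: mult_left_le)
      then show ?thesis by linarith
    qed
    then show ?thesis by (auto simp: cell_def)
  qed
  have close: "\<bar>g i z - g i w\<bar> < \<delta> / real M"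
    if "z \<in> K" "w \<in> K" "cell z = cell w" "i < e" for z w i
  proof -
    have "\<bar>x j z - x j w\<bar> \<le> 1 / real N" if "j < d" for j
    proof -
      have "nat \<lfloor>real N * x j z\<rfloor> = nat \<lfloor>real N * x j w\<rfloor>"
        using fun_cong[OF \<open>cell z = cell w\<close>, of j] that by (simp add: cell_def)
      moreover have "0 \<le> real N * x j z" "0 \<le> real N * x j w"
        using x[OF that \<open>z \<in> K\<close>] x[OF that \<open>w \<in> K\<close>] by auto
      ultimately have "\<bar>real N * x j z - real N * x j w\<bar> \<le> 1" by linarith
      then have "real N * \<bar>x j z - x j w\<bar> \<le> 1"
        by (simp add: abs_mult flip: right_diff_distrib)
      then show ?thesis using \<open>N > 0\<close> by (simp add: field_simps)
    qed
    then have "(\<Sum>j<d. \<bar>x j z - x j w\<bar>) \<le> real d * (1 / real N)"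
      using sum_bounded_above[of "{..<d}" "\<lambda>j. \<bar>x j z - x j w\<bar>" "1 / real N"] by simp
    then have "L * (\<Sum>j<d. \<bar>x j z - x j w\<bar>) \<le> L * (real d * (1 / real N))"
      using \<open>L > 0\<close> by (intro mult_left_mono) auto
    also have "\<dots> < \<delta> / real M"
    proof -
      show ?thesis using A \<open>A > 0\<close> M by (simp add: N_def field_simps)
    qed
    finally show ?thesis using g[OF \<open>i < e\<close> that(1,2)] by linarith
  qed
  define pt where "pt = (\<lambda>a i. if i < e then \<delta> * real (a i) / real M else 0)"
  have "\<exists>a\<in>{..<e} \<rightarrow>\<^sub>E {..<M}. \<forall>z\<in>K. \<exists>i<e. g i z \<noteq> pt a i"
  proof (rule ccontr)
    assume "\<not> ?thesis"
    then have "\<forall>a\<in>{..<e} \<rightarrow>\<^sub>E {..<M}. \<exists>z\<in>K. \<forall>i<e. g i z = pt a i" by blast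
    then obtain z where z: "\<And>a. a \<in> {..<e} \<rightarrow>\<^sub>E {..<M} \<Longrightarrow> z a \<in> K"
      "\<And>a i. a \<in> {..<e} \<rightarrow>\<^sub>E {..<M} \<Longrightarrow> i < e \<Longrightarrow> g i (z a) = pt a i" by metis
    \<comment> \<open>Two grid points attained on the same cell differ by less than the spacing in
      every coordinate, so they coincide.\<close>
    have "inj_on (\<lambda>a. cell (z a)) ({..<e} \<rightarrow>\<^sub>E {..<M})"
    proof (rule inj_onI)
      fix a b assume ab: "a \<in> {..<e} \<rightarrow>\<^sub>E {..<M}" "b \<in> {..<e} \<rightarrow>\<^sub>E {..<M}" "cell (z a) = cell (z b)"
      have "a i = b i" if "i < e" for i
      proof -
        have "\<bar>pt a i - pt b i\<bar> < \<delta> / real M"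
          using close[OF z(1)[OF ab(1)] z(1)[OF ab(2)] ab(3) that] z(2)[OF ab(1) that] z(2)[OF ab(2) that]
          by simp
        then have "\<bar>\<delta> / real M * (real (a i) - real (b i))\<bar> < \<delta> / real M * 1"
          using that by (simp add: pt_def algebra_simps)
        moreover have "\<delta> / real M > 0" using \<open>\<delta> > 0\<close> M by simp
        ultimately have "\<bar>real (a i) - real (b i)\<bar> < 1"
          by (simp only: abs_mult mult_less_cancel_left_pos abs_of_pos)
        then show ?thesis by linarith
      qed
      then show "a = b" by (intro PiE_ext[OF ab(1,2)]) auto
    qed
    moreover have "(\<lambda>a. cell (z a)) ` ({..<e} \<rightarrow>\<^sub>E {..<M}) \<subseteq> {..<d} \<rightarrow>\<^sub>E {..N}"
      using z(1) cell_mem by blast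
    ultimately have "card ({..<e} \<rightarrow>\<^sub>E {..<M}) \<le> card ({..<d} \<rightarrow>\<^sub>E {..N})"
      by (rule card_inj_on_le) (simp add: finite_PiE)
    then have "M ^ e \<le> Suc N ^ d" by (simp add: card_PiE)
    also have "\<dots> \<le> (2 * A * M) ^ d" using \<open>N > 0\<close> by (intro power_mono) (auto simp: N_def)
    also have "\<dots> = (2 * A) ^ d * M ^ d" by (simp add: power_mult_distrib)
    also have "\<dots> < M * M ^ d" by (simp add: M_def)
    also have "\<dots> \<le> M ^ e" using \<open>d < e\<close> power_increasing[of "Suc d" e M] by (simp add: M_def)
    finally show False by simp
  qed
  then obtain a where a: "a \<in> {..<e} \<rightarrow>\<^sub>E {..<M}" "\<And>z. z \<in> K \<Longrightarrow> \<exists>i<e. g i z \<noteq> pt a i" by blast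
  have "\<bar>pt a i\<bar> \<le> \<delta>" for i
    proof (cases "i < e")
      case True
      then have "a i \<in> {..<M}" using PiE_mem[OF a(1), of i] by simp
      then have "real (a i) \<le> real M" by simp
      then show ?thesis using True \<open>\<delta> > 0\<close> M by (simp add: pt_def field_simps)
    qed (use \<open>\<delta> > 0\<close> in \<open>simp add: pt_def\<close>)
  then show ?thesis using a(2) by (rule that)
qed

text \<open>Real and imaginary parts are replaced by Lipschitz functions of the coordinates. Their
  joint image misses a small vector \<open>c\<close> because \<open>d < 2 * n\<close>, and
  subtracting \<open>c\<close> removes the common zeros.\<close>

lemma perturb_to_no_common_zero:
  fixes f :: "nat \<Rightarrow> 'a::metric_space \<Rightarrow> complex" and x :: "nat \<Rightarrow> 'a \<Rightarrow> real"
  assumes K: "compact K" and x: "\<And>j. j < d \<Longrightarrow> continuous_on K (x j)"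
    and x01: "\<And>j z. j < d \<Longrightarrow> z \<in> K \<Longrightarrow> x j z \<in> {0..1}"
    and f: "\<And>k. k < n \<Longrightarrow> continuous_on K (f k)"
    and fib: "\<And>k z w. k < n \<Longrightarrow> z \<in> K \<Longrightarrow> w \<in> K \<Longrightarrow> (\<And>j. j < d \<Longrightarrow> x j z = x j w) \<Longrightarrow> f k z = f k w"
    and "d < 2 * n" "\<epsilon> > 0"
  shows "\<exists>G. (\<forall>k<n. continuous_on K (G k)) \<and>
    (\<forall>k<n. \<forall>z\<in>K. \<forall>w\<in>K. (\<forall>j<d. x j z = x j w) \<longrightarrow> G k z = G k w) \<and>
    (\<forall>k<n. \<forall>z\<in>K. norm (G k z - f k z) \<le> \<epsilon>) \<and> (\<forall>z\<in>K. \<exists>k<n. G k z \<noteq> 0)"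
proof -
  define u where "u = (\<lambda>i z. if even i then Re (f (i div 2) z) else Im (f (i div 2) z))"
  \<comment> \<open>Two real components, each changed once by the approximation and once by the
    shift \<open>c\<close>, contribute \<open>4 * \<delta>\<close> in all.\<close>
  define \<delta> where "\<delta> = \<epsilon> / 4"
  have "\<delta> > 0" using \<open>\<epsilon> > 0\<close> by (simp add: \<delta>_def)
  define R where "R = (\<lambda>i g L. L > 0 \<and> (\<forall>z\<in>K. \<forall>w\<in>K. \<bar>g z - g w\<bar> \<le> L * (\<Sum>j<d. \<bar>x j z - x j w\<bar>)) \<and>
      (\<forall>z\<in>K. \<bar>g z - u i z\<bar> \<le> \<delta>))"
  have "\<exists>g L. R i g L" if "i < 2 * n" for i
  proof -
    have i: "i div 2 < n" using that by linarith
    have u: "continuous_on K (u i)"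
      unfolding u_def using f[OF i] by (cases "even i") (simp_all add: continuous_on_Re continuous_on_Im)
    have u_fib: "u i z = u i w" if "z \<in> K" "w \<in> K" "\<And>j. j \<in> {..<d} \<Longrightarrow> x j z = x j w" for z w
      using fib[OF i that(1,2)] that(3) by (simp add: u_def)
    have x': "continuous_on K (x j)" if "j \<in> {..<d}" for j using x that by simp
    obtain g L where "L > 0"
      "\<And>z w. z \<in> K \<Longrightarrow> w \<in> K \<Longrightarrow> \<bar>g z - g w\<bar> \<le> L * (\<Sum>j<d. \<bar>x j z - x j w\<bar>)"
      "\<And>z. z \<in> K \<Longrightarrow> \<bar>g z - u i z\<bar> \<le> \<delta>"
      by (rule Lipschitz_approximation_over_coordinates[OF K u x' u_fib finite_lessThan \<open>\<delta> > 0\<close>]) blast+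
    then show ?thesis unfolding R_def by blast
  qed
  then obtain g L where "\<And>i. i < 2 * n \<Longrightarrow> R i (g i) (L i)" by metis
  then have g: "\<And>i. i < 2 * n \<Longrightarrow> L i > 0"
    "\<And>i z w. i < 2 * n \<Longrightarrow> z \<in> K \<Longrightarrow> w \<in> K \<Longrightarrow> \<bar>g i z - g i w\<bar> \<le> L i * (\<Sum>j<d. \<bar>x j z - x j w\<bar>)"
    "\<And>i z. i < 2 * n \<Longrightarrow> z \<in> K \<Longrightarrow> \<bar>g i z - u i z\<bar> \<le> \<delta>"
    unfolding R_def by blast+
  define L' where "L' = (\<Sum>i<2*n. L i) + 1"
  have L': "L i \<le> L'" if "i < 2 * n" for i
    using member_le_sum[of i "{..<2*n}" L] that g(1)[THEN less_imp_le] by (simp add: L'_def)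
  have "(\<Sum>i<2*n. L i) \<ge> 0" using g(1) by (intro sum_nonneg) (simp add: less_imp_le)
  then have "L' > 0" by (simp add: L'_def)
  have g': "\<bar>g i z - g i w\<bar> \<le> L' * (\<Sum>j<d. \<bar>x j z - x j w\<bar>)" if "i < 2 * n" "z \<in> K" "w \<in> K" for i z w
    by (rule order_trans[OF g(2)[OF that]]) (intro mult_right_mono L' that sum_nonneg abs_ge_zero)
  obtain c where c: "\<And>i. \<bar>c i\<bar> \<le> \<delta>" "\<And>z. z \<in> K \<Longrightarrow> \<exists>i<2*n. g i z \<noteq> c i"
    by (rule Lipschitz_image_misses_point[OF x01 g' \<open>d < 2 * n\<close> \<open>\<delta> > 0\<close> \<open>L' > 0\<close>]) blast+
  have cont_g: "continuous_on K (g i)" if "i < 2 * n" for i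
    unfolding continuous_on_def
  proof
    fix z assume z: "z \<in> K"
    have "continuous_on K (\<lambda>w. L' * (\<Sum>j<d. \<bar>x j w - x j z\<bar>))"
      using x by (intro continuous_intros) auto
    then have "((\<lambda>w. L' * (\<Sum>j<d. \<bar>x j w - x j z\<bar>)) \<longlongrightarrow> L' * (\<Sum>j<d. \<bar>x j z - x j z\<bar>)) (at z within K)"
      using z unfolding continuous_on_def by blast
    then have lim0: "((\<lambda>w. L' * (\<Sum>j<d. \<bar>x j w - x j z\<bar>)) \<longlongrightarrow> 0) (at z within K)" by simp
    have "((\<lambda>w. g i w - g i z) \<longlongrightarrow> 0) (at z within K)"
      by (rule Lim_null_comparison[OF _ lim0])
        (use g'[OF that] z in \<open>auto simp: eventually_at_filter\<close>)
    then show "(g i \<longlongrightarrow> g i z) (at z within K)" by (simp add: LIM_zero_iff)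
  qed
  define G where "G = (\<lambda>k z. Complex (g (2*k) z - c (2*k)) (g (2*k+1) z - c (2*k+1)))"
  show ?thesis
  proof (intro exI[of _ G] conjI allI impI ballI)
    fix k assume k: "k < n"
    show "continuous_on K (G k)"
      unfolding G_def Complex_eq using k by (intro continuous_intros cont_g) auto
    show "G k z = G k w" if "z \<in> K" "w \<in> K" "\<forall>j<d. x j z = x j w" for z w
    proof -
      have "g i z = g i w" if "i < 2 * n" for i using g'[OF that \<open>z \<in> K\<close> \<open>w \<in> K\<close>] \<open>\<forall>j<d. x j z = x j w\<close> by simp
      then show ?thesis using k by (simp add: G_def)
    qed
    show "norm (G k z - f k z) \<le> \<epsilon>" if z: "z \<in> K" for z
    proof -
      have "\<bar>g (2*k) z - Re (f k z)\<bar> \<le> \<delta>" "\<bar>g (2*k+1) z - Im (f k z)\<bar> \<le> \<delta>"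
        using g(3)[of "2*k", OF _ z] g(3)[of "2*k+1", OF _ z] k by (auto simp: u_def)
      moreover have "norm (G k z - f k z)
          \<le> \<bar>g (2*k) z - c (2*k) - Re (f k z)\<bar> + \<bar>g (2*k+1) z - c (2*k+1) - Im (f k z)\<bar>"
        using cmod_le[of "G k z - f k z"] by (simp add: G_def)
      ultimately show ?thesis
        using c(1)[of "2*k"] c(1)[of "2*k+1"] unfolding \<delta>_def by linarith
    qed
  next
    fix z assume "z \<in> K"
    then obtain i where i: "i < 2 * n" "g i z \<noteq> c i" using c(2) by blast
    then have "G (i div 2) z \<noteq> 0"
      by (cases "even i") (auto simp: G_def complex_eq_iff elim!: evenE oddE)
    then show "\<exists>k<n. G k z \<noteq> 0" using i(1) by (intro exI[of _ "i div 2"]) auto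
  qed
qed

section \<open>The topological obstruction\<close>

text \<open>Otherwise \<open>H\<close> divided by its norm retracts the ball onto the sphere, and
  radial scaling followed by this retraction contracts the sphere. Vectors are sequences vanishing
  from \<open>N\<close> on, so that the sphere is literally \<open>nsphere (N - 1)\<close>.\<close>

lemma no_nonvanishing_extension:
  fixes H :: "(nat \<Rightarrow> real) \<Rightarrow> nat \<Rightarrow> real"
  assumes "N \<ge> 1"
    and cont: "\<And>i. i < N \<Longrightarrow> continuous_on {y. (\<forall>i\<ge>N. y i = 0) \<and> (\<Sum>i<N. (y i)\<^sup>2) \<le> 1} (\<lambda>y. H y i)"
    and sphere: "\<And>y i. (\<forall>i\<ge>N. y i = 0) \<Longrightarrow> (\<Sum>i<N. (y i)\<^sup>2) = 1 \<Longrightarrow> i < N \<Longrightarrow> H y i = y i"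
  shows "\<exists>y. (\<forall>i\<ge>N. y i = 0) \<and> (\<Sum>i<N. (y i)\<^sup>2) \<le> 1 \<and> (\<forall>i<N. H y i = 0)"
proof (rule ccontr)
  define B where "B = {y :: nat \<Rightarrow> real. (\<forall>i\<ge>N. y i = 0) \<and> (\<Sum>i<N. (y i)\<^sup>2) \<le> 1}"
  define S where "S = {y :: nat \<Rightarrow> real. (\<forall>i\<ge>N. y i = 0) \<and> (\<Sum>i<N. (y i)\<^sup>2) = 1}"
  assume "\<not> ?thesis"
  then have nz: "\<exists>i<N. H y i \<noteq> 0" if "y \<in> B" for y using that unfolding B_def by blast
  define \<nu> where "\<nu> = (\<lambda>y. sqrt (\<Sum>i<N. (H y i)\<^sup>2))"
  define r where "r = (\<lambda>y i. if i < N then H y i / \<nu> y else 0)"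
  have pos: "(\<Sum>i<N. (H y i)\<^sup>2) > 0" if y: "y \<in> B" for y
  proof -
    obtain i where "i < N" "H y i \<noteq> 0" using nz[OF y] by blast
    then show ?thesis by (intro sum_pos2[of _ i]) auto
  qed
  have \<nu>: "\<nu> y > 0" "(\<nu> y)\<^sup>2 = (\<Sum>i<N. (H y i)\<^sup>2)" if "y \<in> B" for y
    using pos[OF that] by (simp_all add: \<nu>_def)
  have \<nu>0: "\<nu> y \<noteq> 0" if "y \<in> B" for y using \<nu>(1)[OF that] by simp
  have cont_r: "continuous_on B r"
  proof (rule continuous_on_coordinatewise_then_product)
    fix i
    have H: "continuous_on B (\<lambda>y. H y i)" if "i < N" for i using cont[OF that] by (simp add: B_def)
    have "continuous_on B \<nu>" unfolding \<nu>_def by (intro continuous_intros H) auto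
    then have "continuous_on B (\<lambda>y. H y i / \<nu> y)" if "i < N"
      by (intro continuous_intros H that ballI \<nu>0)
    then show "continuous_on B (\<lambda>y. r y i)" unfolding r_def by (cases "i < N") auto
  qed
  have r_S: "r y \<in> S" if y: "y \<in> B" for y
  proof -
    have "(\<Sum>i<N. (r y i)\<^sup>2) = (\<Sum>i<N. (H y i)\<^sup>2 / (\<nu> y)\<^sup>2)"
      by (rule sum.cong) (auto simp: r_def power_divide)
    also have "\<dots> = 1" using \<nu>[OF y] pos[OF y] by (simp flip: sum_divide_distrib)
    finally show ?thesis by (simp add: S_def r_def)
  qed
  have r_id: "r y = y" if y: "y \<in> S" for y
  proof
    fix i
    have H: "H y i = y i" if "i < N" for i using sphere y that by (simp add: S_def)
    then have "\<nu> y = 1" using y by (simp add: \<nu>_def S_def)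
    then show "r y i = y i" using H y by (auto simp: r_def S_def)
  qed
  have scale: "(\<lambda>i. t * y i) \<in> B" if "t \<in> {0..1}" "y \<in> S" for t y
  proof -
    have "(\<Sum>i<N. (t * y i)\<^sup>2) = t\<^sup>2" using that by (simp add: power_mult_distrib S_def flip: sum_distrib_left)
    also have "\<dots> \<le> 1" using that by (simp add: power_le_one)
    finally show ?thesis using that by (simp add: B_def S_def)
  qed
  define h where "h = (\<lambda>p :: real \<times> (nat \<Rightarrow> real). r (\<lambda>i. fst p * snd p i))"
  have "continuous_on ({0..1} \<times> S) (\<lambda>p i. fst p * snd p i)"
    by (intro continuous_on_coordinatewise_then_product continuous_on_mult continuous_on_fst continuous_on_id
        continuous_on_compose2[OF continuous_on_product_coordinates continuous_on_snd]) auto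
  then have "continuous_on ({0..1} \<times> S) h"
    unfolding h_def by (rule continuous_on_compose2[OF cont_r]) (use scale in auto)
  moreover have "h ` ({0..1} \<times> S) \<subseteq> S" unfolding h_def using r_S scale by auto
  moreover have "h (0, y) = r (\<lambda>_. 0)" "y \<in> S \<Longrightarrow> h (1, y) = y" for y
    by (simp_all add: h_def r_id)
  ultimately have "homotopic_with_canon (\<lambda>_. True) S S (\<lambda>_. r (\<lambda>_. 0)) id"
    by (subst homotopic_with)
      (auto intro!: exI[of _ h] simp: prod_topology_subtopology_eu image_subset_iff_funcset)
  then have "contractible S"
    unfolding contractible_def using homotopic_with_sym by blast
  moreover have "nsphere (N - 1) = top_of_set S"
    using \<open>N \<ge> 1\<close> unfolding nsphere S_def euclidean_product_topology
    by (rule_tac arg_cong[where f = "top_of_set"]) (auto simp: lessThan_Suc_atMost[symmetric] Suc_le_eq)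
  ultimately show False
    using non_contractible_space_nsphere[of "N - 1"] by simp
qed

section \<open>Removing common zeros on the disk\<close>

text \<open>The dilation \<open>f (r * z)\<close> is uniformly close to \<open>f\<close> and
  holomorphic on the disk of radius \<open>1 / r > 1\<close>, so its Taylor series converges
  uniformly on the closed unit disk.\<close>

lemma disk_fun_polynomial_approximation:
  assumes f: "disk_fun f" and "\<epsilon> > 0"
  obtains p where "\<And>z. z \<in> cball 0 1 \<Longrightarrow> norm (poly p z - f z) \<le> \<epsilon>"
proof -
  have "uniformly_continuous_on (cball 0 1) f"
    using f by (simp add: disk_fun_def compact_uniformly_continuous)
  then obtain \<delta> where \<delta>: "\<delta> > 0"
    "\<And>z w. z \<in> cball 0 1 \<Longrightarrow> w \<in> cball 0 1 \<Longrightarrow> dist z w < \<delta> \<Longrightarrow> dist (f z) (f w) < \<epsilon> / 2"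
    using \<open>\<epsilon> > 0\<close> unfolding uniformly_continuous_on_def by (metis half_gt_zero)
  define r where "r = max (1/2) (1 - \<delta> / 2)"
  have r: "0 < r" "r < 1" "1 - r < \<delta>" using \<delta>(1) by (auto simp: r_def max_def)
  define F where "F = (\<lambda>z. f (of_real r * z))"
  have in_ball: "of_real r * z \<in> ball 0 1" if "z \<in> ball 0 (1 / r)" for z :: complex
    using that r by (simp add: norm_mult field_simps)
  have "F holomorphic_on ball 0 (1 / r)"
  proof -
    have "(f \<circ> (\<lambda>z. of_real r * z)) holomorphic_on ball 0 (1 / r)"
      by (rule holomorphic_on_compose_gen[where t = "ball 0 1"])
        (use f in_ball in \<open>auto simp: disk_fun_def intro!: holomorphic_intros\<close>)
    then show ?thesis by (simp add: F_def o_def)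
  qed
  define a where "a = (\<lambda>n. (deriv ^^ n) F 0 / fact n)"
  have sums: "(\<lambda>n. a n * z ^ n) sums F z" if "z \<in> ball 0 (1 / r)" for z
    using holomorphic_power_series[OF \<open>F holomorphic_on ball 0 (1 / r)\<close> that] by (simp add: a_def)
  \<comment> \<open>A radius strictly between \<open>1\<close> and \<open>1 / r\<close>: convergence
    at \<open>s\<close> yields absolute convergence at \<open>1\<close>.\<close>
  define s where "s = (1 + 1 / r) / 2"
  have s: "1 < s" "s < 1 / r" using r by (auto simp: s_def field_simps)
  then have "summable (\<lambda>n. a n * of_real s ^ n)"
    using sums[of "of_real s"] by (simp add: sums_iff)
  then have "summable (\<lambda>n. norm (a n * 1 ^ n))"
    by (rule powser_insidea) (use s in simp)
  then have summ: "summable (\<lambda>n. norm (a n))" by simp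
  have "uniform_limit (cball 0 1) (\<lambda>n z. \<Sum>i<n. a i * z ^ i) (\<lambda>z. suminf (\<lambda>i. a i * z ^ i)) sequentially"
    by (rule Weierstrass_m_test[OF _ summ])
      (auto simp: norm_mult norm_power intro!: mult_left_le power_le_one)
  then have "\<forall>\<^sub>F n in sequentially. \<forall>z\<in>cball 0 1. dist (\<Sum>i<n. a i * z ^ i) (suminf (\<lambda>i. a i * z ^ i)) < \<epsilon> / 2"
    using \<open>\<epsilon> > 0\<close> by (intro uniform_limitD) auto
  then have "\<exists>n. \<forall>z\<in>cball 0 1. dist (\<Sum>i<n. a i * z ^ i) (suminf (\<lambda>i. a i * z ^ i)) < \<epsilon> / 2"
    by (rule eventually_happens'[OF sequentially_bot])
  then obtain n where n: "\<And>z. z \<in> cball 0 1 \<Longrightarrow> dist (\<Sum>i<n. a i * z ^ i) (suminf (\<lambda>i. a i * z ^ i)) < \<epsilon> / 2"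
    by blast
  show ?thesis
  proof (rule that[of "\<Sum>i<n. Polynomial.monom (a i) i"])
    fix z :: complex assume z: "z \<in> cball 0 1"
    have "z \<in> ball 0 (1 / r)" using z s by simp
    then have "(suminf (\<lambda>i. a i * z ^ i)) = F z" using sums by (simp add: sums_iff)
    then have 1: "norm (poly (\<Sum>i<n. Polynomial.monom (a i) i) z - F z) < \<epsilon> / 2"
      using n[OF z] by (simp add: poly_sum poly_monom dist_norm)
    have "of_real r * z - z = of_real (r - 1) * z" by (simp add: algebra_simps)
    then have "norm (of_real r * z - z) = \<bar>r - 1\<bar> * norm z"
      by (simp only: norm_mult norm_of_real)
    also have "\<dots> = (1 - r) * norm z" using r by simp
    also have "\<dots> \<le> 1 - r" using z r by (simp add: mult_left_le)
    finally have "dist (of_real r * z) z < \<delta>" using r(3) by (simp add: dist_norm)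
    moreover have "of_real r * z \<in> cball 0 1" using z r by (simp add: norm_mult mult_le_one)
    ultimately have "dist (F z) (f z) < \<epsilon> / 2" unfolding F_def using z by (intro \<delta>(2))
    then show "norm (poly (\<Sum>i<n. Polynomial.monom (a i) i) z - f z) \<le> \<epsilon>"
      using 1 norm_triangle_ineq[of "poly (\<Sum>i<n. Polynomial.monom (a i) i) z - F z" "F z - f z"]
      by (simp add: dist_norm)
  qed
qed

text \<open>The gcd has no root, so it is constant by the fundamental theorem of algebra;
  \<open>p \<noteq> 0\<close> excludes the gcd \<open>0\<close>.\<close>

lemma bezout_if_no_common_root:
  fixes p q :: "complex poly"
  assumes "p \<noteq> 0" "\<And>z. poly p z = 0 \<Longrightarrow> poly q z \<noteq> 0"
  obtains a b where "a * p + b * q = 1"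
proof -
  have "is_unit (gcd p q)"
  proof -
    have "gcd p q \<noteq> 0" using assms(1) by simp
    moreover have "poly (gcd p q) z \<noteq> 0" for z
    proof
      assume "poly (gcd p q) z = 0"
      then have "[:- z, 1:] dvd gcd p q" by (simp add: poly_eq_0_iff_dvd)
      then have "[:- z, 1:] dvd p" "[:- z, 1:] dvd q" 
        using dvd_trans[OF _ gcd_dvd1] dvd_trans[OF _ gcd_dvd2] by auto
      then show False using assms(2)[of z] by (simp add: poly_eq_0_iff_dvd)
    qed
    then have "constant (poly (gcd p q))" 
      using Fundamental_Theorem_Algebra.fundamental_theorem_of_algebra[of "gcd p q"] by blast
    then have "degree (gcd p q) = 0" by (simp add: constant_degree)
    ultimately show ?thesis using is_unit_iff_degree by blast
  qed
  then have "gcd p q = 1" using is_unit_gcd_iff by blast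
  then show ?thesis using bezout_coefficients_fst_snd[of p q] that by simp
qed

text \<open>Coprimality of the first two entries suffices. A constant shift of the second achieves
  it unless it cancels the value at one of the finitely many roots of the first, so small shifts are
  available.\<close>

lemma unimodular_polynomial_approximation:
  fixes f :: "nat \<Rightarrow> complex \<Rightarrow> complex"
  assumes f: "\<And>j. j < n \<Longrightarrow> disk_fun (f j)" and "n \<ge> 2" "\<epsilon> > 0"
  obtains p q where "\<And>j z. j < n \<Longrightarrow> z \<in> cball 0 1 \<Longrightarrow> norm (poly (p j) z - f j z) \<le> \<epsilon>"
    "\<And>z. (\<Sum>j<n. poly (q j) z * poly (p j) z) = 1"
proof -
  have "\<forall>j. \<exists>p. j < n \<longrightarrow> (\<forall>z\<in>cball 0 1. norm (poly p z - f j z) \<le> \<epsilon> / 2)"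
    using disk_fun_polynomial_approximation[OF f, of _ "\<epsilon> / 2"] \<open>\<epsilon> > 0\<close> by (metis half_gt_zero)
  then obtain p where p: "\<And>j z. j < n \<Longrightarrow> z \<in> cball 0 1 \<Longrightarrow> norm (poly (p j) z - f j z) \<le> \<epsilon> / 2"
    by metis
  \<comment> \<open>The zero polynomial has infinitely many roots, so it is first replaced by a
    small constant.\<close>
  define p0 where "p0 = (if p 0 = 0 then [:of_real (\<epsilon> / 2):] else p 0)"
  have p0: "p0 \<noteq> 0" "norm (poly p0 z - poly (p 0) z) \<le> \<epsilon> / 2" for z
    using \<open>\<epsilon> > 0\<close> by (auto simp: p0_def)
  define I where "I = complex_of_real ` {0<..<\<epsilon> / 2}"
  define R where "R = (\<lambda>z. - poly (p 1) z) ` {z. poly p0 z = 0}"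
  have "infinite I"
    using \<open>\<epsilon> > 0\<close> unfolding I_def by (subst finite_image_iff) (auto simp: inj_on_def infinite_Ioo)
  moreover have "finite R"
    unfolding R_def using poly_roots_finite[OF p0(1)] by simp
  ultimately have "\<not> I \<subseteq> R" using finite_subset[of I R] by blast
  then obtain t where t: "t \<in> {0<..<\<epsilon> / 2}" "complex_of_real t \<notin> R" unfolding I_def by blast
  define p1 where "p1 = p 1 + [:of_real t:]"
  have p1: "norm (poly p1 z - poly (p 1) z) \<le> \<epsilon> / 2" for z
    using t(1) by (simp add: p1_def)
  have "poly p1 z \<noteq> 0" if "poly p0 z = 0" for z
  proof
    assume "poly p1 z = 0"
    then have "of_real t = - poly (p 1) z" by (simp add: p1_def add_eq_0_iff)
    then show False using t(2) that unfolding R_def by blast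
  qed
  then obtain a b where ab: "a * p0 + b * p1 = 1" using bezout_if_no_common_root[OF p0(1)] by blast
  define P where "P = (\<lambda>j::nat. if j = 0 then p0 else if j = 1 then p1 else p j)"
  define q where "q = (\<lambda>j::nat. if j = 0 then a else if j = 1 then b else 0 :: complex poly)"
  show ?thesis
  proof (rule that[of P q])
    show "norm (poly (P j) z - f j z) \<le> \<epsilon>" if "j < n" "z \<in> cball 0 1" for j z
    proof -
      have "norm (poly (P j) z - poly (p j) z) \<le> \<epsilon> / 2"
        using p0(2)[of z] p1[of z] \<open>\<epsilon> > 0\<close> by (simp add: P_def)
      then show ?thesis
        using p[OF that] norm_triangle_ineq[of "poly (P j) z - poly (p j) z" "poly (p j) z - f j z"] by simp
    qed
    show "(\<Sum>j<n. poly (q j) z * poly (P j) z) = 1" for z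
    proof -
      have "(\<Sum>j<n. poly (q j) z * poly (P j) z) = (\<Sum>j\<in>{0,1}. poly (q j) z * poly (P j) z)"
        using \<open>n \<ge> 2\<close> by (intro sum.mono_neutral_right) (auto simp: q_def)
      also have "\<dots> = poly (a * p0 + b * p1) z" by (simp add: q_def P_def)
      finally show ?thesis by (simp add: ab)
    qed
  qed
qed

text \<open>Off a neighbourhood of \<open>K\<close> the perturbed tuple is close to polynomials with an explicit Bezout
  identity \<open>\<Sum> q p = 1\<close>; near \<open>K\<close> the given functions \<open>X\<close> are almost Bezout coefficients. With
  \<open>u = \<Sum> q f\<close> and \<open>h = \<Sum> X f\<close>, the product \<open>(1 - u) (1 - h) ^ m\<close> is small on the whole disk, and
  \<open>1 - (1 - u) (1 - h) ^ m\<close> lies in the ideal generated by the perturbed tuple.\<close>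

lemma unimodular_perturbation_fixing_boundary_set:
  fixes F X :: "nat \<Rightarrow> complex \<Rightarrow> complex"
  assumes K: "compact K" "K \<subseteq> sphere 0 1" "finely_partitionable K"
    and F: "\<And>j. j < n \<Longrightarrow> disk_fun (F j)" and X: "\<And>j. j < n \<Longrightarrow> disk_fun (X j)"
    and XF: "\<And>z. z \<in> K \<Longrightarrow> (\<Sum>j<n. X j z * F j z) = 1"
    and "n \<ge> 2" "\<epsilon> > 0"
  shows "\<exists>f y. (\<forall>j<n. disk_fun (f j)) \<and> (\<forall>j<n. disk_fun (y j)) \<and>
    (\<forall>j<n. \<forall>z\<in>cball 0 1. norm (f j z - F j z) \<le> \<epsilon>) \<and>
    (\<forall>j<n. \<forall>z\<in>K. f j z = F j z) \<and> (\<forall>j<n. \<forall>z\<in>K. y j z = X j z) \<and>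
    (\<forall>z\<in>cball 0 1. (\<Sum>j<n. y j z * f j z) = 1)"
proof -
  have KD: "K \<subseteq> cball 0 1" using K(2) by auto
  define h0 where "h0 = (\<lambda>z. \<Sum>j<n. X j z * F j z)"
  have df_h0: "disk_fun h0" unfolding h0_def using F X by (intro disk_fun_sum disk_fun_mult) auto
  obtain B0 where B0: "B0 > 0" "\<And>z. z \<in> cball 0 1 \<Longrightarrow> norm (1 - h0 z) \<le> B0"
    using disk_fun_bounded[OF disk_fun_diff[OF disk_fun_const df_h0]] by blast
  \<comment> \<open>A bound for \<open>1 - h\<close>, where \<open>h\<close> is \<open>h0\<close>
    computed with the perturbed tuple and lies within \<open>1 / 4\<close> of it.\<close>
  define B where "B = max 1 (B0 + 1 / 4)"
  have "B \<ge> 1" by (simp add: B_def)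
  have "uniformly_continuous_on (cball 0 1) h0"
    using df_h0 by (simp add: disk_fun_def compact_uniformly_continuous)
  then obtain d where d: "d > 0"
    "\<And>z w. z \<in> cball 0 1 \<Longrightarrow> w \<in> cball 0 1 \<Longrightarrow> dist z w < d \<Longrightarrow> dist (h0 z) (h0 w) < 1 / 4"
    unfolding uniformly_continuous_on_def by (metis zero_less_divide_1_iff zero_less_numeral)
  have "\<exists>M>0. \<forall>z\<in>cball 0 1. norm (X j z) \<le> M" if "j < n" for j
    using disk_fun_bounded[OF X[OF that]] by metis
  then obtain M where M: "\<And>j. j < n \<Longrightarrow> M j > 0"
    "\<And>j z. j < n \<Longrightarrow> z \<in> cball 0 1 \<Longrightarrow> norm (X j z) \<le> M j" by metis
  define M' where "M' = (\<Sum>j<n. M j) + 1"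
  have "(\<Sum>j<n. M j) \<ge> 0" using M(1) by (intro sum_nonneg) (simp add: less_imp_le)
  then have "M' > 0" by (simp add: M'_def)
  \<comment> \<open>\<open>21 = 1 + 4 * 5\<close>: the polynomial error, plus a correction of norm
    at most \<open>4 * \<epsilon>'\<close> times a cutoff bounded by \<open>5\<close>. The second
    bound keeps \<open>h\<close> within \<open>1 / 4\<close> of \<open>h0\<close>.\<close>
  define \<epsilon>' where "\<epsilon>' = min (\<epsilon> / 21) (1 / (84 * M'))"
  have "\<epsilon>' > 0" using \<open>\<epsilon> > 0\<close> \<open>M' > 0\<close> by (simp add: \<epsilon>'_def)
  have \<epsilon>': "21 * \<epsilon>' \<le> \<epsilon>" "M' * (21 * \<epsilon>') \<le> 1 / 4"
  proof -
    show "21 * \<epsilon>' \<le> \<epsilon>" by (simp add: \<epsilon>'_def)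
    have "M' * (21 * \<epsilon>') \<le> M' * (21 * (1 / (84 * M')))"
      using \<open>M' > 0\<close> by (intro mult_left_mono) (auto simp: \<epsilon>'_def)
    then show "M' * (21 * \<epsilon>') \<le> 1 / 4" using \<open>M' > 0\<close> by simp
  qed
  obtain p q where pq: "\<And>j z. j < n \<Longrightarrow> z \<in> cball 0 1 \<Longrightarrow> norm (poly (p j) z - F j z) \<le> \<epsilon>'"
    "\<And>z. (\<Sum>j<n. poly (q j) z * poly (p j) z) = 1"
    by (rule unimodular_polynomial_approximation[of n F \<epsilon>', OF F \<open>n \<ge> 2\<close> \<open>\<epsilon>' > 0\<close>]) blast+
  \<comment> \<open>The correction is what the polynomial lacks on \<open>K\<close>; multiplied by
    \<open>\<psi>\<close>, which is \<open>1\<close> on \<open>K\<close> and small away from it, it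
    restores the values of \<open>F\<close> on \<open>K\<close>.\<close>
  define E where "E = (\<lambda>j e. disk_fun e \<and> (\<forall>z\<in>cball 0 1. norm (e z) \<le> 4 * \<epsilon>') \<and>
    (\<forall>z\<in>K. e z = F j z - poly (p j) z))"
  have "\<exists>e. E j e" if j: "j < n" for j
  proof -
    have "continuous_on K (\<lambda>z. F j z - poly (p j) z)"
      by (intro disk_fun_continuous_on_subset[OF _ K(2)] disk_fun_diff F j disk_fun_poly)
    then obtain e where "disk_fun e" "\<And>z. z \<in> cball 0 1 \<Longrightarrow> norm (e z) \<le> 4 * \<epsilon>'"
      "\<And>z. z \<in> K \<Longrightarrow> e z = F j z - poly (p j) z"
    proof (rule disk_fun_interpolation[OF K _ _ \<open>\<epsilon>' > 0\<close>])
      show "norm (F j z - poly (p j) z) \<le> \<epsilon>'" if "z \<in> K" for z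
      using pq(1)[OF j, of z] that KD by (auto simp: norm_minus_commute)
    qed blast+
    then show ?thesis unfolding E_def by blast
  qed
  then obtain e where "\<And>j. j < n \<Longrightarrow> E j (e j)" by metis
  then have e: "\<And>j. j < n \<Longrightarrow> disk_fun (e j)"
    "\<And>j z. j < n \<Longrightarrow> z \<in> cball 0 1 \<Longrightarrow> norm (e j z) \<le> 4 * \<epsilon>'"
    "\<And>j z. j < n \<Longrightarrow> z \<in> K \<Longrightarrow> e j z = F j z - poly (p j) z"
    unfolding E_def by blast+
  define w where "w = (\<lambda>z. \<Sum>j<n. poly (q j) z * e j z)"
  have df_w: "disk_fun w" unfolding w_def using e(1) by (intro disk_fun_sum disk_fun_mult) auto
  obtain W where W: "W > 0" "\<And>z. z \<in> cball 0 1 \<Longrightarrow> norm (w z) \<le> W"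
    using disk_fun_bounded[OF df_w] by blast
  \<comment> \<open>Near \<open>K\<close>, where \<open>norm (1 - h z) \<le> 1 / 2\<close>, the
    power beats the bound \<open>5 * W\<close> of \<open>1 - u\<close>. Away from \<open>K\<close>
    the power may reach \<open>B ^ m\<close>, and \<open>\<eta>\<close>, chosen after
    \<open>m\<close>, compensates for it.\<close>
  obtain m where m: "(1/2) ^ m < 1 / (10 * W)"
    using real_arch_pow_inv[of "1 / (10 * W)" "1/2"] W(1) by auto
  define \<eta> where "\<eta> = 1 / (2 * W * B ^ m)"
  have "\<eta> > 0" using W(1) \<open>B \<ge> 1\<close> by (simp add: \<eta>_def)
  obtain \<psi> where \<psi>: "disk_fun \<psi>" "\<And>z. z \<in> cball 0 1 \<Longrightarrow> norm (\<psi> z) \<le> 5" "\<And>z. z \<in> K \<Longrightarrow> \<psi> z = 1"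
    "\<And>z. z \<in> cball 0 1 \<Longrightarrow> (\<And>w. w \<in> K \<Longrightarrow> d \<le> dist z w) \<Longrightarrow> norm (\<psi> z) \<le> \<eta>"
    by (rule disk_fun_decaying_extension_of_one[OF K \<open>d > 0\<close> \<open>\<eta> > 0\<close>]) blast+
  define f where "f = (\<lambda>j z. poly (p j) z + e j z * \<psi> z)"
  have df_f: "disk_fun (f j)" if "j < n" for j
    unfolding f_def using e(1)[OF that] \<psi>(1) by (intro disk_fun_add disk_fun_mult disk_fun_poly)
  have f_K: "f j z = F j z" if "j < n" "z \<in> K" for j z
    using e(3)[OF that] \<psi>(3)[OF that(2)] by (simp add: f_def)
  have f_close: "norm (f j z - F j z) \<le> 21 * \<epsilon>'" if "j < n" "z \<in> cball 0 1" for j z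
  proof -
    have "norm (e j z * \<psi> z) \<le> (4 * \<epsilon>') * 5"
      unfolding norm_mult using e(2)[OF that] \<psi>(2)[OF that(2)] \<open>\<epsilon>' > 0\<close> by (intro mult_mono) auto
    then show ?thesis
      using pq(1)[OF that] norm_triangle_ineq[of "poly (p j) z - F j z" "e j z * \<psi> z"]
      by (simp add: f_def algebra_simps)
  qed
  define h where "h = (\<lambda>z. \<Sum>j<n. X j z * f j z)"
  define u where "u = (\<lambda>z. \<Sum>j<n. poly (q j) z * f j z)"
  have df_h: "disk_fun h" unfolding h_def using X df_f by (intro disk_fun_sum disk_fun_mult) auto
  have h_close: "norm (h z - h0 z) \<le> 1 / 4" if z: "z \<in> cball 0 1" for z
  proof -
    have "norm (h z - h0 z) = norm (\<Sum>j<n. X j z * (f j z - F j z))"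
      by (simp add: h_def h0_def sum_subtractf right_diff_distrib)
    also have "\<dots> \<le> (\<Sum>j<n. M j * (21 * \<epsilon>'))"
    proof (rule sum_norm_le)
      fix j assume "j \<in> {..<n}"
      then show "norm (X j z * (f j z - F j z)) \<le> M j * (21 * \<epsilon>')"
        unfolding norm_mult using M f_close z by (intro mult_mono) (auto intro: less_imp_le)
    qed
    also have "\<dots> \<le> M' * (21 * \<epsilon>')"
      unfolding sum_distrib_right[symmetric] M'_def using \<open>\<epsilon>' > 0\<close> by (intro mult_right_mono) auto
    finally show ?thesis using \<epsilon>'(2) by linarith
  qed
  have h_K: "h z = 1" if "z \<in> K" for z using f_K XF that by (simp add: h_def)
  have h_bound: "norm (1 - h z) \<le> B" if z: "z \<in> cball 0 1" for z
    using norm_triangle_ineq[of "1 - h0 z" "h0 z - h z"] B0(2)[OF z] h_close[OF z]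
    by (simp add: B_def norm_minus_commute)
  have u_eq: "u z = 1 + \<psi> z * w z" for z
  proof -
    have "u z = (\<Sum>j<n. poly (q j) z * poly (p j) z) + (\<Sum>j<n. \<psi> z * (poly (q j) z * e j z))"
      unfolding u_def f_def sum.distrib[symmetric] by (simp add: algebra_simps)
    then show ?thesis by (simp add: pq(2) w_def sum_distrib_left)
  qed
  define U where "U = (\<lambda>z. 1 - (1 - u z) * (1 - h z) ^ m)"
  have df_u: "disk_fun u" unfolding u_def using df_f by (intro disk_fun_sum disk_fun_mult disk_fun_poly) auto
  have df_U: "disk_fun U"
    unfolding U_def using df_u df_h by (intro disk_fun_diff disk_fun_mult disk_fun_power disk_fun_const)
  have U_close: "norm (1 - U z) \<le> 1 / 2" if z: "z \<in> cball 0 1" for z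
  proof -
    have eq: "norm (1 - U z) = norm (\<psi> z) * norm (w z) * norm (1 - h z) ^ m"
      by (simp add: U_def u_eq norm_mult norm_power)
    show ?thesis
    proof (cases "\<exists>v\<in>K. dist z v < d")
      case True
      then obtain v where v: "v \<in> K" "dist z v < d" by blast
      then have "norm (h0 z - 1) < 1 / 4"
        using d(2)[OF z _ v(2)] KD XF[OF v(1)] by (auto simp: h0_def dist_norm)
      then have "norm (1 - h z) \<le> 1 / 2"
        using h_close[OF z] norm_triangle_ineq[of "h z - h0 z" "h0 z - 1"] by (simp add: norm_minus_commute)
      then have "norm (\<psi> z) * norm (w z) * norm (1 - h z) ^ m \<le> 5 * W * (1/2) ^ m"
        using \<psi>(2)[OF z] W z by (intro mult_mono power_mono) auto
      also have "\<dots> \<le> 1 / 2" using m W(1) by (simp add: field_simps)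
      finally show ?thesis using eq by simp
    next
      case False
      then have "norm (\<psi> z) \<le> \<eta>" using z by (intro \<psi>(4)) force+
      then have "norm (\<psi> z) * norm (w z) * norm (1 - h z) ^ m \<le> \<eta> * W * B ^ m"
        using W z h_bound[OF z] \<open>\<eta> > 0\<close> by (intro mult_mono power_mono) auto
      also have "\<dots> = 1 / 2" using W(1) \<open>B \<ge> 1\<close> by (simp add: \<eta>_def)
      finally show ?thesis using eq by simp
    qed
  qed
  have U0: "U z \<noteq> 0" if "z \<in> cball 0 1" for z using U_close[OF that] by auto
  \<comment> \<open>\<open>U\<close> expands as \<open>h\<close> times a geometric sum in
    \<open>1 - h\<close>, plus \<open>(1 - h) ^ m * u\<close>, and both \<open>h\<close> and
    \<open>u\<close> are combinations of the \<open>f j\<close>.\<close>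
  define c where "c = (\<lambda>j z. X j z * (\<Sum>i<m. (1 - h z) ^ i) + (1 - h z) ^ m * poly (q j) z)"
  have df_c: "disk_fun (c j)" if "j < n" for j
    unfolding c_def using X[OF that] df_h
    by (intro disk_fun_add disk_fun_mult disk_fun_sum disk_fun_power disk_fun_diff disk_fun_const disk_fun_poly)
  have c_U: "(\<Sum>j<n. c j z * f j z) = U z" for z
  proof -
    have "(\<Sum>j<n. c j z * f j z) = (\<Sum>i<m. (1 - h z) ^ i) * h z + (1 - h z) ^ m * u z"
      unfolding c_def h_def u_def sum_distrib_left sum.distrib[symmetric] distrib_right
      by (simp add: mult_ac sum_distrib_left sum_distrib_right)
    also have "(\<Sum>i<m. (1 - h z) ^ i) * h z = 1 - (1 - h z) ^ m"
      using one_diff_power_eq[of "1 - h z" m] by (simp add: mult.commute)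
    finally show ?thesis by (simp add: U_def algebra_simps)
  qed
  \<comment> \<open>The quotients \<open>c j / U\<close> are Bezout coefficients. Weighted by
    \<open>1 - h\<close>, which vanishes on \<open>K\<close>, they complete \<open>X\<close> to a
    solution that agrees with \<open>X\<close> on \<open>K\<close>.\<close>
  define y where "y = (\<lambda>j z. X j z + (1 - h z) * (c j z / U z))"
  show ?thesis
  proof (rule exI[of _ f], rule exI[of _ y], intro conjI allI impI ballI)
    show "disk_fun (f j)" if "j < n" for j using df_f[OF that] .
    show "disk_fun (y j)" if "j < n" for j
      unfolding y_def using X[OF that] df_h df_c[OF that] df_U U0
      by (intro disk_fun_add disk_fun_mult disk_fun_diff disk_fun_divide disk_fun_const)
    show "norm (f j z - F j z) \<le> \<epsilon>" if "j < n" "z \<in> cball 0 1" for j z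
      using f_close[OF that] \<epsilon>'(1) by linarith
    show "f j z = F j z" if "j < n" "z \<in> K" for j z using f_K[OF that] .
    show "y j z = X j z" if "j < n" "z \<in> K" for j z using h_K[OF that(2)] by (simp add: y_def)
    show "(\<Sum>j<n. y j z * f j z) = 1" if z: "z \<in> cball 0 1" for z
    proof -
      have "y j z * f j z = X j z * f j z + (1 - h z) / U z * (c j z * f j z)" for j
        by (simp add: y_def algebra_simps)
      then have "(\<Sum>j<n. y j z * f j z) = h z + (1 - h z) / U z * (\<Sum>j<n. c j z * f j z)"
        by (simp add: sum.distrib h_def sum_distrib_left)
      then show ?thesis using U0[OF z] by (simp add: c_U)
    qed
  qed
qed

section \<open>Functions constant on fibres\<close>

definition fib_fun :: "complex set \<Rightarrow> (nat \<Rightarrow> complex \<Rightarrow> real) \<Rightarrow> nat set \<Rightarrow> (complex \<Rightarrow> complex) \<Rightarrow> bool" where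
  "fib_fun K x J f \<longleftrightarrow>
     disk_fun f \<and> (\<forall>z\<in>K. \<forall>w\<in>K. (\<forall>j\<in>J. x j z = x j w) \<longrightarrow> f z = f w)"

lemma fib_funI:
  assumes "disk_fun f" "\<And>z w. z \<in> K \<Longrightarrow> w \<in> K \<Longrightarrow> (\<And>j. j \<in> J \<Longrightarrow> x j z = x j w) \<Longrightarrow> f z = f w"
  shows "fib_fun K x J f"
  unfolding fib_fun_def using assms by blast

lemma fib_fun_disk_fun: "fib_fun K x J f \<Longrightarrow> disk_fun f"
  by (simp add: fib_fun_def)

lemma fib_funD:
  "fib_fun K x J f \<Longrightarrow> z \<in> K \<Longrightarrow> w \<in> K \<Longrightarrow> (\<And>j. j \<in> J \<Longrightarrow> x j z = x j w) \<Longrightarrow> f z = f w"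
  unfolding fib_fun_def by blast

lemma fib_fun_const: "fib_fun K x J (\<lambda>_. c)"
  by (rule fib_funI) auto

lemma fib_fun_map2:
  assumes f: "fib_fun K x J f" and g: "fib_fun K x J g" and "disk_fun (\<lambda>z. h (f z) (g z))"
  shows "fib_fun K x J (\<lambda>z. h (f z) (g z))"
  using assms(3)
proof (rule fib_funI)
  fix z w assume zw: "z \<in> K" "w \<in> K" "\<And>j. j \<in> J \<Longrightarrow> x j z = x j w"
  show "h (f z) (g z) = h (f w) (g w)"
    using fib_funD[OF f zw] fib_funD[OF g zw] by (rule arg_cong2)
qed

lemma fib_fun_add: "fib_fun K x J f \<Longrightarrow> fib_fun K x J g \<Longrightarrow> fib_fun K x J (\<lambda>z. f z + g z)"
  by (rule fib_fun_map2) (auto dest: fib_fun_disk_fun)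

lemma fib_fun_diff: "fib_fun K x J f \<Longrightarrow> fib_fun K x J g \<Longrightarrow> fib_fun K x J (\<lambda>z. f z - g z)"
  by (rule fib_fun_map2) (auto dest: fib_fun_disk_fun)

lemma fib_fun_mult: "fib_fun K x J f \<Longrightarrow> fib_fun K x J g \<Longrightarrow> fib_fun K x J (\<lambda>z. f z * g z)"
  by (rule fib_fun_map2) (auto dest: fib_fun_disk_fun)

lemma fib_fun_divide:
  "fib_fun K x J f \<Longrightarrow> fib_fun K x J g \<Longrightarrow> (\<And>z. z \<in> cball 0 1 \<Longrightarrow> g z \<noteq> 0) \<Longrightarrow>
     fib_fun K x J (\<lambda>z. f z / g z)"
  by (rule fib_fun_map2) (auto dest: fib_fun_disk_fun)

lemma fib_fun_sum:
  "(\<And>i. i \<in> I \<Longrightarrow> fib_fun K x J (f i)) \<Longrightarrow> fib_fun K x J (\<lambda>z. \<Sum>i\<in>I. f i z)"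
  by (induction I rule: infinite_finite_induct) (auto intro: fib_fun_const fib_fun_add)

text \<open>The stable range condition for plain functions, with identities required only on the
  closed disk, so that no \<open>restrict\<close> intrudes.\<close>

definition function_stable_range :: "((complex \<Rightarrow> complex) \<Rightarrow> bool) \<Rightarrow> nat \<Rightarrow> bool" where
  "function_stable_range F m \<longleftrightarrow>
     (\<forall>f x. (\<forall>j\<le>m. F (f j) \<and> F (x j)) \<and> (\<forall>z\<in>cball 0 1. (\<Sum>j\<le>m. x j z * f j z) = 1) \<longrightarrow>
       (\<exists>a u. (\<forall>j<m. F (a j) \<and> F (u j)) \<and>
         (\<forall>z\<in>cball 0 1. (\<Sum>j<m. u j z * (f j z + a j z * f m z)) = 1)))"

text \<open>The Bass stable rank is at most the topological stable rank: approximate the Bezout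
  coefficients of the first \<open>n\<close> entries by an invertible tuple.\<close>

lemma function_stable_range_if_dense:
  assumes dense: "\<And>f \<epsilon>. (\<And>j. j < n \<Longrightarrow> fib_fun K x J (f j)) \<Longrightarrow> \<epsilon> > 0 \<Longrightarrow>
      \<exists>g y. (\<forall>j<n. fib_fun K x J (g j) \<and> fib_fun K x J (y j)) \<and>
        (\<forall>j<n. \<forall>z\<in>cball 0 1. norm (g j z - f j z) \<le> \<epsilon>) \<and>
        (\<forall>z\<in>cball 0 1. (\<Sum>j<n. y j z * g j z) = 1)"
  shows "function_stable_range (fib_fun K x J) n"
  unfolding function_stable_range_def
proof (intro allI impI, elim conjE)
  fix f v :: "nat \<Rightarrow> complex \<Rightarrow> complex"
  assume fv: "\<forall>j\<le>n. fib_fun K x J (f j) \<and> fib_fun K x J (v j)"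
    and one: "\<forall>z\<in>cball 0 1. (\<Sum>j\<le>n. v j z * f j z) = 1"
  have "\<exists>B>0. \<forall>z\<in>cball 0 1. norm (f j z) \<le> B" if "j < n" for j
    using disk_fun_bounded[of "f j"] fv that fib_fun_disk_fun less_imp_le by metis
  then obtain B where B: "\<And>j. j < n \<Longrightarrow> B j > 0"
    "\<And>j z. j < n \<Longrightarrow> z \<in> cball 0 1 \<Longrightarrow> norm (f j z) \<le> B j" by metis
  define B' where "B' = (\<Sum>j<n. B j) + 1"
  have "(\<Sum>j<n. B j) \<ge> 0" using B(1) by (intro sum_nonneg) (simp add: less_imp_le)
  then have "B' > 0" by (simp add: B'_def)
  have fv': "fib_fun K x J (v j)" if "j < n" for j using fv that by simp
  \<comment> \<open>Errors of this size change the Bezout sum by at most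
    \<open>(B' - 1) / (2 * B') < 1\<close>, so \<open>U\<close> has no zero.\<close>
  have "1 / (2 * B') > 0" using \<open>B' > 0\<close> by simp
  from dense[of v, OF fv' this] obtain g y where
    gy: "\<And>j. j < n \<Longrightarrow> fib_fun K x J (g j)" "\<And>j. j < n \<Longrightarrow> fib_fun K x J (y j)"
    and g: "\<And>j z. j < n \<Longrightarrow> z \<in> cball 0 1 \<Longrightarrow> norm (g j z - v j z) \<le> 1 / (2 * B')"
    and yg: "\<And>z. z \<in> cball 0 1 \<Longrightarrow> (\<Sum>j<n. y j z * g j z) = 1"
    by blast
  \<comment> \<open>The approximation \<open>g\<close> replaces \<open>v\<close> except at the last
    entry. Adding \<open>y j * v n * f n\<close> to each \<open>f j\<close> turns
    \<open>\<Sum> g f\<close> into \<open>U\<close>, since \<open>\<Sum> y g = 1\<close>; division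
    by \<open>U\<close> finishes.\<close>
  define U where "U = (\<lambda>z. (\<Sum>j<n. g j z * f j z) + v n z * f n z)"
  have fib_U: "fib_fun K x J U"
    unfolding U_def using gy fv by (intro fib_fun_add fib_fun_sum fib_fun_mult) auto
  have U0: "U z \<noteq> 0" if z: "z \<in> cball 0 1" for z
  proof -
    have "(\<Sum>j<n. v j z * f j z) + v n z * f n z = 1"
      using one z by (simp flip: lessThan_Suc_atMost)
    then have last: "v n z * f n z = 1 - (\<Sum>j<n. v j z * f j z)" by (simp add: eq_diff_eq add.commute)
    have "U z - 1 = (\<Sum>j<n. (g j z - v j z) * f j z)"
      unfolding U_def last left_diff_distrib sum_subtractf by simp
    also have "norm \<dots> \<le> (\<Sum>j<n. 1 / (2 * B') * B j)"
    proof (rule sum_norm_le)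
      fix j assume "j \<in> {..<n}"
      then show "norm ((g j z - v j z) * f j z) \<le> 1 / (2 * B') * B j"
        unfolding norm_mult using g B(2) z \<open>B' > 0\<close> by (intro mult_mono) auto
    qed
    also have "\<dots> = 1 / (2 * B') * (B' - 1)" by (simp add: sum_distrib_left B'_def)
    also have "\<dots> < 1" using \<open>B' > 0\<close> by (simp add: field_simps)
    finally show ?thesis by auto
  qed
  show "\<exists>a u. (\<forall>j<n. fib_fun K x J (a j) \<and> fib_fun K x J (u j)) \<and>
      (\<forall>z\<in>cball 0 1. (\<Sum>j<n. u j z * (f j z + a j z * f n z)) = 1)"
  proof (intro exI conjI allI impI ballI)
    show "fib_fun K x J (\<lambda>z. y j z * v n z)" "fib_fun K x J (\<lambda>z. g j z / U z)" if "j < n" for j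
      using gy[OF that] fv fib_U U0 by (auto intro!: fib_fun_mult fib_fun_divide)
    fix z :: complex assume z: "z \<in> cball 0 1"
    have "g j z / U z * (f j z + y j z * v n z * f n z)
        = (g j z * f j z + v n z * f n z * (y j z * g j z)) / U z" for j
      by (simp add: algebra_simps add_divide_distrib)
    then have "(\<Sum>j<n. g j z / U z * (f j z + y j z * v n z * f n z))
        = ((\<Sum>j<n. g j z * f j z) + v n z * f n z * (\<Sum>j<n. y j z * g j z)) / U z"
      by (simp only: sum.distrib sum_distrib_left flip: sum_divide_distrib)
    also have "\<dots> = 1" using U0[OF z] yg[OF z] by (simp add: U_def)
    finally show "(\<Sum>j<n. g j z / U z * (f j z + y j z * v n z * f n z)) = 1" .
  qed
qed

section \<open>Both bounds for the stable range over a cube\<close>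

context boundary_cube
begin

lemma K_cball: "K \<subseteq> cball 0 1"
  using K_sphere by auto

lemma fib_fun_continuous_on: "fib_fun K x J f \<Longrightarrow> continuous_on K f"
  using fib_fun_disk_fun K_sphere by (rule disk_fun_continuous_on_subset)

lemma interpolation_bounded:
  assumes "continuous_on K g" "\<And>z. z \<in> K \<Longrightarrow> norm (g z) \<le> B" "B > 0"
  shows "\<exists>f. disk_fun f \<and> (\<forall>z\<in>cball 0 1. norm (f z) \<le> 4 * B) \<and> (\<forall>z\<in>K. f z = g z)"
  by (rule disk_fun_interpolation[OF compact_K K_sphere fine_K assms]) blast+

lemma interpolation:
  assumes "continuous_on K g"
  shows "\<exists>f. disk_fun f \<and> (\<forall>z\<in>K. f z = g z)"
proof -
  have "bounded (g ` K)" using assms compact_K by (simp add: compact_continuous_image compact_imp_bounded)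
  then obtain B where "B > 0" "\<And>z. z \<in> K \<Longrightarrow> norm (g z) \<le> B" by (auto simp: bounded_pos)
  then show ?thesis using interpolation_bounded[OF assms] by blast
qed

lemma fib_fun_interpolant:
  assumes "disk_fun f" "\<And>z. z \<in> K \<Longrightarrow> f z = g z"
    "\<And>z w. z \<in> K \<Longrightarrow> w \<in> K \<Longrightarrow> (\<And>j. j \<in> J \<Longrightarrow> x j z = x j w) \<Longrightarrow> g z = g w"
  shows "fib_fun K x J f"
  using assms by (intro fib_funI) metis+

text \<open>On \<open>K\<close> the zeros are removed by functions of the coordinates, whose
  conjugates divided by the sum of squares are Bezout coefficients, again functions of the
  coordinates. Both tuples are interpolated, and the zeros off \<open>K\<close> are removed without
  altering the values of either on \<open>K\<close>.\<close>

lemma invertible_tuples_dense: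
  assumes f: "\<And>k. k < n \<Longrightarrow> fib_fun K x {..<d} (f k)" and "d < 2 * n" "n \<ge> 2" "\<epsilon> > 0"
  shows "\<exists>g y. (\<forall>j<n. fib_fun K x {..<d} (g j) \<and> fib_fun K x {..<d} (y j)) \<and>
        (\<forall>j<n. \<forall>z\<in>cball 0 1. norm (g j z - f j z) \<le> \<epsilon>) \<and>
        (\<forall>z\<in>cball 0 1. (\<Sum>j<n. y j z * g j z) = 1)"
proof -
  have cont_f: "continuous_on K (f k)" if "k < n" for k using f[OF that] by (rule fib_fun_continuous_on)
  have f_fib: "f k z = f k w" if "k < n" "z \<in> K" "w \<in> K" "\<And>j. j < d \<Longrightarrow> x j z = x j w" for k z w
    using fib_funD[OF f[OF that(1)] that(2,3)] that(4) by simp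
  \<comment> \<open>Interpolation costs a factor \<open>4\<close>, which makes
    \<open>\<epsilon> / 2\<close>; the other half is left for the perturbation off
    \<open>K\<close>.\<close>
  have "\<epsilon> / 8 > 0" using \<open>\<epsilon> > 0\<close> by simp
  have "\<exists>G. (\<forall>k<n. continuous_on K (G k)) \<and>
    (\<forall>k<n. \<forall>z\<in>K. \<forall>w\<in>K. (\<forall>j<d. x j z = x j w) \<longrightarrow> G k z = G k w) \<and>
    (\<forall>k<n. \<forall>z\<in>K. norm (G k z - f k z) \<le> \<epsilon> / 8) \<and> (\<forall>z\<in>K. \<exists>k<n. G k z \<noteq> 0)"
    by (rule perturb_to_no_common_zero[OF compact_K cont_x x_range cont_f f_fib
          \<open>d < 2 * n\<close> \<open>\<epsilon> / 8 > 0\<close>])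
  then obtain G where G0: "\<forall>k<n. continuous_on K (G k)"
    "\<forall>k<n. \<forall>z\<in>K. \<forall>w\<in>K. (\<forall>j<d. x j z = x j w) \<longrightarrow> G k z = G k w"
    "\<forall>k<n. \<forall>z\<in>K. norm (G k z - f k z) \<le> \<epsilon> / 8" "\<forall>z\<in>K. \<exists>k<n. G k z \<noteq> 0"
    by (elim exE conjE) (rule that; assumption)
  have G: "\<And>k. k < n \<Longrightarrow> continuous_on K (G k)"
    "\<And>k z w. k < n \<Longrightarrow> z \<in> K \<Longrightarrow> w \<in> K \<Longrightarrow> \<forall>j<d. x j z = x j w \<Longrightarrow> G k z = G k w"
    "\<And>k z. k < n \<Longrightarrow> z \<in> K \<Longrightarrow> norm (G k z - f k z) \<le> \<epsilon> / 8"
    "\<And>z. z \<in> K \<Longrightarrow> \<exists>k<n. G k z \<noteq> 0"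
    subgoal using G0(1) by blast
    subgoal using G0(2) by blast
    subgoal using G0(3) by blast
    subgoal using G0(4) by blast
    done
  define E where "E = (\<lambda>k e. disk_fun e \<and> (\<forall>z\<in>cball 0 1. norm (e z) \<le> 4 * (\<epsilon> / 8)) \<and>
    (\<forall>z\<in>K. e z = G k z - f k z))"
  have "\<exists>e. E k e" if "k < n" for k
    unfolding E_def using G(1,3)[OF that] cont_f[OF that] \<open>\<epsilon> / 8 > 0\<close>
    by (intro interpolation_bounded continuous_on_diff) auto
  then obtain e where "\<And>k. k < n \<Longrightarrow> E k (e k)" by metis
  then have e: "\<And>k. k < n \<Longrightarrow> disk_fun (e k)"
    "\<And>k z. k < n \<Longrightarrow> z \<in> cball 0 1 \<Longrightarrow> norm (e k z) \<le> 4 * (\<epsilon> / 8)"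
    "\<And>k z. k < n \<Longrightarrow> z \<in> K \<Longrightarrow> e k z = G k z - f k z"
    unfolding E_def by blast+
  define F where "F = (\<lambda>k z. f k z + e k z)"
  have df_F: "disk_fun (F k)" if "k < n" for k
    unfolding F_def using fib_fun_disk_fun[OF f[OF that]] e(1)[OF that] by (rule disk_fun_add)
  have F_K: "F k z = G k z" if "k < n" "z \<in> K" for k z using e(3)[OF that] by (simp add: F_def)
  define S where "S = (\<lambda>z. \<Sum>k<n. (norm (G k z))\<^sup>2)"
  have S: "S z > 0" if z: "z \<in> K" for z
  proof -
    obtain k where "k < n" "G k z \<noteq> 0" using G(4)[OF z] by blast
    then show ?thesis unfolding S_def by (intro sum_pos2[of _ k]) auto
  qed
  define T where "T = (\<lambda>k z. cnj (G k z) / of_real (S z))"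
  have cont_S: "continuous_on K S" unfolding S_def using G(1) by (intro continuous_intros) auto
  have S0: "complex_of_real (S z) \<noteq> 0" if "z \<in> K" for z using S[OF that] by simp
  have "continuous_on K (T k)" if "k < n" for k
    unfolding T_def using G(1)[OF that] cont_S S0 by (intro continuous_intros ballI)
  then have "\<exists>X. disk_fun X \<and> (\<forall>z\<in>K. X z = T k z)" if "k < n" for k
    using interpolation that by blast
  then obtain X where X: "\<And>k. k < n \<Longrightarrow> disk_fun (X k)" "\<And>k z. k < n \<Longrightarrow> z \<in> K \<Longrightarrow> X k z = T k z"
    by metis
  have XF: "(\<Sum>k<n. X k z * F k z) = 1" if z: "z \<in> K" for z
  proof -
    have "(\<Sum>k<n. X k z * F k z) = (\<Sum>k<n. of_real ((norm (G k z))\<^sup>2) / of_real (S z))"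
      unfolding complex_norm_square using X(2)[OF _ z] F_K[OF _ z]
      by (intro sum.cong) (simp_all add: T_def mult.commute)
    also have "\<dots> = of_real (S z) / of_real (S z)"
      by (simp only: S_def of_real_sum sum_divide_distrib)
    finally show ?thesis using S0[OF z] by simp
  qed
  have "\<epsilon> / 2 > 0" using \<open>\<epsilon> > 0\<close> by simp
  have "\<exists>g y. (\<forall>j<n. disk_fun (g j)) \<and> (\<forall>j<n. disk_fun (y j)) \<and>
    (\<forall>j<n. \<forall>z\<in>cball 0 1. norm (g j z - F j z) \<le> \<epsilon> / 2) \<and>
    (\<forall>j<n. \<forall>z\<in>K. g j z = F j z) \<and> (\<forall>j<n. \<forall>z\<in>K. y j z = X j z) \<and>
    (\<forall>z\<in>cball 0 1. (\<Sum>j<n. y j z * g j z) = 1)"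
    by (rule unimodular_perturbation_fixing_boundary_set[OF compact_K K_sphere fine_K df_F X(1) XF
          \<open>n \<ge> 2\<close> \<open>\<epsilon> / 2 > 0\<close>])
  then obtain g y where g: "\<forall>j<n. disk_fun (g j)" and y: "\<forall>j<n. disk_fun (y j)"
    and close: "\<forall>j<n. \<forall>z\<in>cball 0 1. norm (g j z - F j z) \<le> \<epsilon> / 2"
    and gK: "\<forall>j<n. \<forall>z\<in>K. g j z = F j z" and yK: "\<forall>j<n. \<forall>z\<in>K. y j z = X j z"
    and yg: "\<forall>z\<in>cball 0 1. (\<Sum>j<n. y j z * g j z) = 1"
    by (elim exE conjE) (rule that; assumption)
  have G_fib: "G k z = G k w" if "z \<in> K" "w \<in> K" "\<And>j. j \<in> {..<d} \<Longrightarrow> x j z = x j w" "k < n" for k z w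
    using G(2)[OF that(4,1,2)] that(3) by simp
  show ?thesis
  proof (rule exI[of _ g], rule exI[of _ y], intro conjI allI impI ballI)
    fix j assume j: "j < n"
    show "fib_fun K x {..<d} (g j)"
    proof (rule fib_fun_interpolant[OF g[rule_format, OF j]])
      show "g j z = G j z" if "z \<in> K" for z using gK[rule_format, OF j that] F_K[OF j that] by (rule trans)
    qed (rule G_fib[OF _ _ _ j])
    show "fib_fun K x {..<d} (y j)"
    proof (rule fib_fun_interpolant[OF y[rule_format, OF j]])
      show "y j z = T j z" if "z \<in> K" for z using yK[rule_format, OF j that] X(2)[OF j that] by (rule trans)
      fix z w assume zw: "z \<in> K" "w \<in> K" "\<And>i. i \<in> {..<d} \<Longrightarrow> x i z = x i w"
      have "G k z = G k w" if "k < n" for k by (rule G_fib[OF zw that])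
      then show "T j z = T j w" using j by (simp add: T_def S_def)
    qed
    fix z :: complex assume z: "z \<in> cball 0 1"
    show "norm (g j z - f j z) \<le> \<epsilon>"
      using close[rule_format, OF j z] e(2)[OF j z] norm_triangle_ineq[of "g j z - F j z" "e j z"]
      by (simp add: F_def)
  next
    show "(\<Sum>j<n. y j z * g j z) = 1" if "z \<in> cball 0 1" for z
      using yg that by blast
  qed
qed

lemma function_stable_range_cube:
  assumes "d < 2 * n" "n \<ge> 2"
  shows "function_stable_range (fib_fun K x {..<d}) n"
proof (rule function_stable_range_if_dense)
  fix f :: "nat \<Rightarrow> complex \<Rightarrow> complex" and \<epsilon> :: real
  assume "\<And>j. j < n \<Longrightarrow> fib_fun K x {..<d} (f j)" "\<epsilon> > 0"
  then show "\<exists>g y. (\<forall>j<n. fib_fun K x {..<d} (g j) \<and> fib_fun K x {..<d} (y j)) \<and>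
        (\<forall>j<n. \<forall>z\<in>cball 0 1. norm (g j z - f j z) \<le> \<epsilon>) \<and>
        (\<forall>z\<in>cball 0 1. (\<Sum>j<n. y j z * g j z) = 1)"
    by (rule invertible_tuples_dense[OF _ assms])
qed

text \<open>The tuple \<open>(F\<^sub>0, \<dots>, F\<^sub>m\<^sub>-\<^sub>1, 1 - \<Sum> X F)\<close> restricts on \<open>K\<close> to the complex coordinates \<open>\<zeta>\<close> of the cube
  and \<open>1 - \<bar>\<zeta>\<bar>\<^sup>2\<close>. Reducing it would extend the identity of the unit sphere to a zero-free map on
  the unit ball.\<close>

lemma not_function_stable_range_cube:
  assumes "m \<ge> 1" "{..<2*m} \<subseteq> J"
  shows "\<not> function_stable_range (fib_fun K x J) m"
proof
  assume sr: "function_stable_range (fib_fun K x J) m"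
  \<comment> \<open>Coordinates rescaled to \<open>{-1..1}\<close>, so that the cube contains the
    unit ball.\<close>
  define t where "t = (\<lambda>j z. 2 * x j z - 1)"
  define \<zeta> where "\<zeta> = (\<lambda>k z. Complex (t (2*k) z) (t (2*k+1) z))"
  have cont_t: "continuous_on K (t j)" for j unfolding t_def using cont_x by (intro continuous_intros)
  have cont_\<zeta>: "continuous_on K (\<zeta> k)" for k
    unfolding \<zeta>_def Complex_eq using cont_t by (intro continuous_intros)
  have \<zeta>_fib: "\<zeta> k z = \<zeta> k w" if "k < m" "\<And>j. j \<in> J \<Longrightarrow> x j z = x j w" for k z w
  proof -
    have "2*k \<in> J" "2*k+1 \<in> J" using assms(2) that(1) by auto
    then show ?thesis using that(2) by (simp add: \<zeta>_def t_def)
  qed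
  obtain F where F: "\<And>k. disk_fun (F k)" "\<And>k z. z \<in> K \<Longrightarrow> F k z = \<zeta> k z"
    using interpolation[OF cont_\<zeta>] by metis
  obtain X where X: "\<And>k. disk_fun (X k)" "\<And>k z. z \<in> K \<Longrightarrow> X k z = cnj (\<zeta> k z)"
    using interpolation[OF continuous_on_cnj[OF cont_\<zeta>]] by metis
  have fib_F: "fib_fun K x J (F k)" if "k < m" for k
  proof (rule fib_fun_interpolant[OF F])
    show "\<zeta> k z = \<zeta> k w" if "\<And>j. j \<in> J \<Longrightarrow> x j z = x j w" for z w
      by (rule \<zeta>_fib[OF \<open>k < m\<close> that])
  qed
  have fib_X: "fib_fun K x J (X k)" if "k < m" for k
  proof (rule fib_fun_interpolant[OF X])
    show "cnj (\<zeta> k z) = cnj (\<zeta> k w)" if "\<And>j. j \<in> J \<Longrightarrow> x j z = x j w" for z w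
      by (rule arg_cong[where f = cnj]) (rule \<zeta>_fib[OF \<open>k < m\<close> that])
  qed
  define g where "g = (\<lambda>z. 1 - (\<Sum>k<m. X k z * F k z))"
  have fib_g: "fib_fun K x J g"
    unfolding g_def using fib_F fib_X by (intro fib_fun_diff fib_fun_sum fib_fun_mult fib_fun_const) auto
  define f where "f = (\<lambda>k. if k < m then F k else g)"
  define v where "v = (\<lambda>k. if k < m then X k else (\<lambda>_. 1))"
  have "fib_fun K x J (f j)" "fib_fun K x J (v j)" for j
    using fib_F[of j] fib_X[of j] fib_g fib_fun_const[of K x J 1] by (simp_all add: f_def v_def)
  moreover have "(\<Sum>j\<le>m. v j z * f j z) = 1" for z
  proof -
    have "(\<Sum>j\<le>m. v j z * f j z) = (\<Sum>j<m. v j z * f j z) + v m z * f m z"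
      by (simp flip: lessThan_Suc_atMost)
    also have "(\<Sum>j<m. v j z * f j z) = (\<Sum>j<m. X j z * F j z)"
      by (rule sum.cong) (simp_all add: f_def v_def)
    finally show ?thesis by (simp add: f_def v_def g_def)
  qed
  ultimately have "(\<forall>j\<le>m. fib_fun K x J (f j) \<and> fib_fun K x J (v j)) \<and>
      (\<forall>z\<in>cball 0 1. (\<Sum>j\<le>m. v j z * f j z) = 1)"
    by blast
  from sr[unfolded function_stable_range_def, THEN spec, THEN spec, THEN mp, OF this]
  obtain a u where "\<forall>j<m. fib_fun K x J (a j) \<and> fib_fun K x J (u j)"
    "\<forall>z\<in>cball 0 1. (\<Sum>j<m. u j z * (f j z + a j z * f m z)) = 1"
    by (elim exE conjE) (rule that; assumption)
  then have au: "\<And>j. j < m \<Longrightarrow> fib_fun K x J (a j)" "\<And>j. j < m \<Longrightarrow> fib_fun K x J (u j)"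
    "\<And>z. z \<in> cball 0 1 \<Longrightarrow> (\<Sum>j<m. u j z * (f j z + a j z * f m z)) = 1"
    by blast+
  define G where "G = (\<lambda>j z. F j z + a j z * g z)"
  have uG: "(\<Sum>j<m. u j z * G j z) = 1" if "z \<in> cball 0 1" for z
    using au(3)[OF that] by (simp add: f_def G_def)
  have fib_G: "fib_fun K x J (G j)" if "j < m" for j
    unfolding G_def using fib_F[OF that] au(1)[OF that] fib_g by (intro fib_fun_add fib_fun_mult)
  define N where "N = 2 * m"
  \<comment> \<open>\<open>J\<close> may exceed \<open>{..<N}\<close>. On \<open>K0\<close> the
    other coordinates vanish, so there members of the algebra depend on the first \<open>N\<close>
    coordinates alone.\<close>
  define K0 where "K0 = {z \<in> K. \<forall>j\<ge>N. x j z = 0}"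
  have "compact K0"
  proof -
    have "K0 = (\<Inter>j\<in>{N..}. {z \<in> K. x j z = 0})" by (auto simp: K0_def)
    moreover have "closed {z \<in> K. x j z = 0}" for j
      using continuous_closed_preimage_constant[OF cont_x compact_imp_closed[OF compact_K]] .
    ultimately have "closed K0" by auto
    then have "compact (K \<inter> K0)" using compact_K by (rule compact_Int_closed[rotated])
    also have "K \<inter> K0 = K0" by (auto simp: K0_def)
    finally show ?thesis .
  qed
  \<comment> \<open>Clamping puts \<open>c y\<close> in the cube for every \<open>y\<close>; on the
    ball its first \<open>N\<close> entries are \<open>(y j + 1) / 2\<close>, which undoes the
    rescaling \<open>t\<close>.\<close>
  define c where "c = (\<lambda>(y :: nat \<Rightarrow> real) j. if j < N then (max (-1) (min 1 (y j)) + 1) / 2 else 0)"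
  have "c y j \<in> {0..1}" for y j by (auto simp: c_def max_def min_def)
  then have "\<exists>z. z \<in> K \<and> (\<forall>j. x j z = c y j)" for y using x_onto[of "c y"] by blast
  \<comment> \<open>Nothing makes this choice of points continuous; \<open>G k\<close> composed with
    it is continuous on the ball all the same, because \<open>G k\<close> is constant on
    fibres.\<close>
  then obtain s where s: "\<And>y. s y \<in> K" "\<And>y j. x j (s y) = c y j" by metis
  have s_K0: "s y \<in> K0" for y using s by (simp add: c_def K0_def)
  define B where "B = {y :: nat \<Rightarrow> real. (\<forall>i\<ge>N. y i = 0) \<and> (\<Sum>i<N. (y i)\<^sup>2) \<le> 1}"
  have t_s: "t j (s y) = y j" if "j < N" "y \<in> B" for j y
  proof -
    have "(y j)\<^sup>2 \<le> (\<Sum>i<N. (y i)\<^sup>2)" using that(1) by (intro member_le_sum) auto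
    also have "\<dots> \<le> 1" using that(2) by (simp add: B_def)
    finally have "\<bar>y j\<bar> \<le> 1" by (simp add: abs_square_le_1)
    then show ?thesis using s(2) that(1) by (simp add: c_def t_def)
  qed
  have cont_G: "continuous_on B (\<lambda>y. G k (s y))" if k: "k < m" for k
    unfolding continuous_on_def
  proof
    fix y0 assume y0: "y0 \<in> B"
    show "((\<lambda>y. G k (s y)) \<longlongrightarrow> G k (s y0)) (at y0 within B)"
    proof (rule tendstoI)
      fix \<epsilon> :: real assume "\<epsilon> > 0"
      have cG: "continuous_on K0 (G k)"
        using fib_fun_continuous_on[OF fib_G[OF k]] by (rule continuous_on_subset) (auto simp: K0_def)
      have cx: "continuous_on K0 (x j)" for j
        using cont_x by (rule continuous_on_subset) (auto simp: K0_def)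
      have G_fib: "G k z = G k w"
        if "z \<in> K0" "w \<in> K0" "\<And>j. j \<in> {..<N} \<Longrightarrow> x j z = x j w" for z w
      proof (rule fib_funD[OF fib_G[OF k]])
        show "x j z = x j w" for j
          using that by (cases "j < N") (auto simp: K0_def)
      qed (use that in \<open>auto simp: K0_def\<close>)
      obtain \<eta> where \<eta>: "\<eta> > 0"
        "\<And>z w. z \<in> K0 \<Longrightarrow> w \<in> K0 \<Longrightarrow> (\<Sum>j\<in>{..<N}. \<bar>x j z - x j w\<bar>) < \<eta> \<Longrightarrow> dist (G k z) (G k w) < \<epsilon>"
        by (rule uniform_continuity_over_coordinates[of K0 "G k" "{..<N}" x \<epsilon>,
              OF \<open>compact K0\<close> cG cx G_fib finite_lessThan \<open>\<epsilon> > 0\<close>]) blast+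
      have "continuous_on B (\<lambda>y. \<Sum>j<N. \<bar>y j - y0 j\<bar> / 2)"
        by (intro continuous_intros continuous_on_subset[OF continuous_on_product_coordinates]) auto
      then have "((\<lambda>y. \<Sum>j<N. \<bar>y j - y0 j\<bar> / 2) \<longlongrightarrow> (\<Sum>j<N. \<bar>y0 j - y0 j\<bar> / 2)) (at y0 within B)"
        using y0 unfolding continuous_on_def by blast
      then have "\<forall>\<^sub>F y in at y0 within B. (\<Sum>j<N. \<bar>y j - y0 j\<bar> / 2) < \<eta>"
        using \<eta>(1) by (intro order_tendstoD(2)) auto
      moreover have "\<forall>\<^sub>F y in at y0 within B. y \<in> B" by (simp add: eventually_at_filter)
      ultimately show "\<forall>\<^sub>F y in at y0 within B. dist (G k (s y)) (G k (s y0)) < \<epsilon>"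
      proof eventually_elim
        fix y assume y: "(\<Sum>j<N. \<bar>y j - y0 j\<bar> / 2) < \<eta>" "y \<in> B"
        have "\<bar>x j (s y) - x j (s y0)\<bar> = \<bar>y j - y0 j\<bar> / 2" if "j < N" for j
        proof -
          have "y j - y0 j = 2 * (x j (s y) - x j (s y0))"
            unfolding t_s[OF that y(2), symmetric] t_s[OF that y0, symmetric] t_def by simp
          then show ?thesis by (simp only: abs_mult) simp
        qed
        then have "(\<Sum>j<N. \<bar>x j (s y) - x j (s y0)\<bar>) = (\<Sum>j<N. \<bar>y j - y0 j\<bar> / 2)"
          by (intro sum.cong) simp_all
        then show "dist (G k (s y)) (G k (s y0)) < \<epsilon>" using y(1) by (intro \<eta>(2) s_K0) linarith
      qed
    qed
  qed
  define H where "H = (\<lambda>y i. if even i then Re (G (i div 2) (s y)) else Im (G (i div 2) (s y)))"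
  have "\<exists>y. (\<forall>i\<ge>N. y i = 0) \<and> (\<Sum>i<N. (y i)\<^sup>2) \<le> 1 \<and> (\<forall>i<N. H y i = 0)"
  proof (rule no_nonvanishing_extension)
    show "N \<ge> 1" using assms(1) by (simp add: N_def)
    show "continuous_on {y. (\<forall>i\<ge>N. y i = 0) \<and> (\<Sum>i<N. (y i)\<^sup>2) \<le> 1} (\<lambda>y. H y i)" if "i < N" for i
    proof -
      have "continuous_on B (\<lambda>y. G (i div 2) (s y))" using that by (intro cont_G) (simp add: N_def)
      then have "continuous_on B (\<lambda>y. H y i)"
        unfolding H_def by (cases "even i") (simp_all add: continuous_on_Re continuous_on_Im)
      then show ?thesis by (simp add: B_def)
    qed
    show "H y i = y i" if y: "\<forall>i\<ge>N. y i = 0" "(\<Sum>i<N. (y i)\<^sup>2) = 1" and i: "i < N" for y i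
    proof -
      have yB: "y \<in> B" using y by (simp add: B_def)
      have sK: "s y \<in> K" using s_K0[of y] by (simp add: K0_def)
      have \<zeta>_s: "\<zeta> k (s y) = Complex (y (2*k)) (y (2*k+1))" if "k < m" for k
        using t_s[OF _ yB] that by (simp add: \<zeta>_def N_def)
      have "(\<Sum>k<m. X k (s y) * F k (s y)) = (\<Sum>k<m. of_real ((y (2*k))\<^sup>2 + (y (2*k+1))\<^sup>2))"
        using X(2)[OF sK] F(2)[OF sK] \<zeta>_s
        by (intro sum.cong) (auto simp: complex_eq_iff power2_eq_square)
      also have "\<dots> = of_real (\<Sum>k<m. (y (2*k))\<^sup>2 + (y (2*k+1))\<^sup>2)" by simp
      also have "(\<Sum>k<m. (y (2*k))\<^sup>2 + (y (2*k+1))\<^sup>2) = (\<Sum>i<2*m. (y i)\<^sup>2)"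
        by (induction m) simp_all
      also have "\<dots> = 1" using y(2) by (simp add: N_def)
      \<comment> \<open>Over the sphere \<open>g\<close> vanishes, so the reducing terms
        \<open>a j * g\<close> have no effect and \<open>H\<close> is the identity.\<close>
      finally have "g (s y) = 0" by (simp add: g_def)
      then have G_s: "G (i div 2) (s y) = Complex (y (2*(i div 2))) (y (2*(i div 2)+1))"
        using F(2)[OF sK] \<zeta>_s[of "i div 2"] i by (simp add: G_def N_def)
      show ?thesis
      proof (cases "even i")
        case True
        then have "2 * (i div 2) = i" by simp
        then show ?thesis using True by (simp only: H_def G_s complex.sel if_True)
      next
        case False
        then have "2 * (i div 2) + 1 = i" by simp
        then show ?thesis using False by (simp only: H_def G_s complex.sel if_False)
      qed
    qed
  qed
  then obtain y where y: "\<And>i. i < N \<Longrightarrow> H y i = 0" by blast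
  have "G k (s y) = 0" if "k < m" for k
    using y[of "2*k"] y[of "2*k+1"] that by (simp add: H_def N_def complex_eq_iff)
  then have "(\<Sum>j<m. u j (s y) * G j (s y)) = 0" by simp
  moreover have "s y \<in> cball 0 1" using s_K0[of y] K_cball by (auto simp: K0_def)
  ultimately show False using uG by simp
qed

end

section \<open>The Bass stable rank of the algebras\<close>

definition fib_algebra :: "complex set \<Rightarrow> (nat \<Rightarrow> complex \<Rightarrow> real) \<Rightarrow> nat set \<Rightarrow> (complex \<Rightarrow> complex) set" where
  "fib_algebra K x J = {f \<in> extensional (cball 0 1). fib_fun K x J f}"

lemma fib_algebra_subset: "fib_algebra K x J \<subseteq> carrier disk_algebra"
  by (auto simp: fib_algebra_def disk_algebra_def fib_fun_def disk_fun_def)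

lemma fib_algebra_fib_fun: "f \<in> fib_algebra K x J \<Longrightarrow> fib_fun K x J f"
  by (simp add: fib_algebra_def)

lemma restrict_fib_algebra:
  assumes "K \<subseteq> cball 0 1" and f: "fib_fun K x J f"
  shows "(\<lambda>z\<in>cball 0 1. f z) \<in> fib_algebra K x J"
proof -
  have "fib_fun K x J (\<lambda>z\<in>cball 0 1. f z)"
  proof (rule fib_funI)
    have "(\<lambda>z\<in>cball 0 1. f z) \<in> carrier disk_algebra"
      using fib_fun_disk_fun[OF f] by (intro restrict_in_disk_algebra) (simp_all add: disk_fun_def)
    then show "disk_fun (\<lambda>z\<in>cball 0 1. f z)" by (simp add: disk_algebra_def disk_fun_def)
    fix z w assume zw: "z \<in> K" "w \<in> K" "\<And>j. j \<in> J \<Longrightarrow> x j z = x j w"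
    then have "z \<in> cball 0 1" "w \<in> cball 0 1" using assms(1) by blast+
    then show "(\<lambda>z\<in>cball 0 1. f z) z = (\<lambda>z\<in>cball 0 1. f z) w"
      using fib_funD[OF f zw] by (simp only: restrict_apply if_True)
  qed
  then show ?thesis by (simp add: fib_algebra_def)
qed

lemma a_inv_disk_algebra:
  assumes "f \<in> carrier disk_algebra"
  shows "\<ominus>\<^bsub>disk_algebra\<^esub> f = (\<lambda>z\<in>cball 0 1. - 1 * f z)"
proof -
  interpret cring disk_algebra by (rule cring_disk_algebra)
  show ?thesis
    by (rule minus_equality)
      (use assms disk_algebra_closed(3)[OF assms assms, of "-1"] in \<open>auto simp: disk_algebra_simps fun_eq_iff\<close>)
qed

lemma unital_subalgebra_fib_algebra:
  assumes "K \<subseteq> cball 0 1"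
  shows "unital_subalgebra (fib_algebra K x J)"
  unfolding unital_subalgebra_def
proof (intro conjI allI ballI)
  interpret cring disk_algebra by (rule cring_disk_algebra)
  note restr = restrict_fib_algebra[OF assms]
  show scale: "(\<lambda>z\<in>cball 0 1. c * f z) \<in> fib_algebra K x J" if "f \<in> fib_algebra K x J" for c f
    using fib_algebra_fib_fun[OF that] by (intro restr fib_fun_mult fib_fun_const)
  show "subring (fib_algebra K x J) disk_algebra"
  proof (rule subringI)
    show "fib_algebra K x J \<subseteq> carrier disk_algebra" by (rule fib_algebra_subset)
    show "\<one>\<^bsub>disk_algebra\<^esub> \<in> fib_algebra K x J"
      unfolding disk_algebra_simps by (intro restr fib_fun_const)
    show "\<ominus>\<^bsub>disk_algebra\<^esub> f \<in> fib_algebra K x J" if f: "f \<in> fib_algebra K x J" for f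
    proof -
      have "f \<in> carrier disk_algebra" using f fib_algebra_subset by blast
      then show ?thesis unfolding a_inv_disk_algebra[OF \<open>f \<in> carrier disk_algebra\<close>] using scale[OF f] by blast
    qed
    show "f \<otimes>\<^bsub>disk_algebra\<^esub> g \<in> fib_algebra K x J" "f \<oplus>\<^bsub>disk_algebra\<^esub> g \<in> fib_algebra K x J"
      if "f \<in> fib_algebra K x J" "g \<in> fib_algebra K x J" for f g
      using that[THEN fib_algebra_fib_fun] unfolding disk_algebra_simps
      by (simp_all only: restr fib_fun_mult fib_fun_add)
  qed
qed

lemma uniformly_closed_fib_algebra:
  assumes "K \<subseteq> cball 0 1"
  shows "uniformly_closed (fib_algebra K x J)"
proof -
  define C where "C = cfunspace (top_of_set (cball (0::complex) 1)) (euclidean_metric :: complex metric)"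
  interpret M: Metric_space "mspace C" "mdist C" by (rule Metric_space_mspace_mdist)
  have sub: "fib_algebra K x J \<subseteq> mspace C"
    using fib_algebra_subset carrier_disk_algebra_subset unfolding C_def by blast
  have "closedin M.mtopology (fib_algebra K x J)"
    unfolding M.metric_closedin_iff_sequentially_closed
  proof (intro conjI allI impI, rule sub)
    fix \<sigma> :: "nat \<Rightarrow> complex \<Rightarrow> complex" and l
    assume "range \<sigma> \<subseteq> fib_algebra K x J \<and> limitin M.mtopology \<sigma> l sequentially"
    then have \<sigma>: "\<And>n. \<sigma> n \<in> fib_algebra K x J" and lim: "limitin M.mtopology \<sigma> l sequentially"
      by blast+
    have l: "l \<in> mspace C" using lim by (simp add: M.limitin_metric)
    have ulim: "uniform_limit (cball 0 1) \<sigma> l sequentially"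
    proof (rule uniform_limitI)
      fix e :: real assume "e > 0"
      then have "\<forall>\<^sub>F n in sequentially. \<sigma> n \<in> mspace C \<and> mdist C (\<sigma> n) l < e"
        using lim by (simp add: M.limitin_metric)
      then show "\<forall>\<^sub>F n in sequentially. \<forall>z\<in>cball 0 1. dist (\<sigma> n z) (l z) < e"
      proof eventually_elim
        case (elim n)
        show ?case
        proof
          fix z :: complex assume "z \<in> cball 0 1"
          then have "mdist euclidean_metric (\<sigma> n z) (l z) \<le> mdist C (\<sigma> n) l"
            using elim l unfolding C_def by (intro mdist_cfunspace_imp_mdist_le[OF _ _ order_refl]) auto
          then show "dist (\<sigma> n z) (l z) < e" using elim by simp
        qed
      qed
    qed
    have "fib_fun K x J l"
    proof (rule fib_funI)
      show "disk_fun l"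
        using ulim by (rule disk_fun_uniform_limit[rotated])
          (use \<sigma> in \<open>blast intro: fib_fun_disk_fun fib_algebra_fib_fun\<close>)
      fix z w assume zw: "z \<in> K" "w \<in> K" "\<And>j. j \<in> J \<Longrightarrow> x j z = x j w"
      have "\<sigma> n z = \<sigma> n w" for n by (rule fib_funD[OF fib_algebra_fib_fun[OF \<sigma>] zw])
      moreover have "(\<lambda>n. \<sigma> n z) \<longlonglongrightarrow> l z" "(\<lambda>n. \<sigma> n w) \<longlonglongrightarrow> l w"
        using ulim zw(1,2) assms by (blast intro: tendsto_uniform_limitI)+
      ultimately show "l z = l w" by (simp add: LIMSEQ_unique)
    qed
    moreover have "l \<in> extensional (cball 0 1)" using l by (simp add: C_def)
    ultimately show "l \<in> fib_algebra K x J" by (simp add: fib_algebra_def)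
  qed
  then show ?thesis by (simp add: uniformly_closed_def mtopology_of_def C_def)
qed

section \<open>From ring operations to pointwise identities on the disk\<close>

lemma finsum_fib_algebra:
  assumes "K \<subseteq> cball 0 1" "finite I" "\<And>i. i \<in> I \<Longrightarrow> g i \<in> fib_algebra K x J"
  shows "finsum (disk_algebra\<lparr>carrier := fib_algebra K x J\<rparr>) g I = (\<lambda>z\<in>cball 0 1. \<Sum>i\<in>I. g i z)"
proof -
  define R where "R = disk_algebra\<lparr>carrier := fib_algebra K x J\<rparr>"
  interpret D: cring disk_algebra by (rule cring_disk_algebra)
  interpret ring R
    unfolding R_def using unital_subalgebra_fib_algebra[OF assms(1)]
    by (intro D.subring_is_ring) (simp add: unital_subalgebra_def)
  have ops: "carrier R = fib_algebra K x J" "\<zero>\<^bsub>R\<^esub> = (\<lambda>z\<in>cball 0 1. 0)"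
    "f \<oplus>\<^bsub>R\<^esub> h = (\<lambda>z\<in>cball 0 1. f z + h z)" for f h
    by (simp_all add: R_def disk_algebra_simps)
  have "finsum R g I = (\<lambda>z\<in>cball 0 1. \<Sum>i\<in>I. g i z)"
    using assms(2,3)
  proof (induction I rule: finite_induct)
    case empty
    show ?case by (simp add: ops)
  next
    case (insert i I)
    have "finsum R g (insert i I) = g i \<oplus>\<^bsub>R\<^esub> finsum R g I"
      using insert.hyps insert.prems by (intro finsum_insert) (auto simp: ops)
    also have "finsum R g I = (\<lambda>z\<in>cball 0 1. \<Sum>i\<in>I. g i z)" using insert.prems by (intro insert.IH) auto
    finally show ?case using insert.hyps by (simp add: ops fun_eq_iff)
  qed
  then show ?thesis by (simp add: R_def)
qed

text \<open>The coefficients may be plain functions: restricting them to the closed disk makes them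
  extensional and preserves the identity there.\<close>

lemma invertible_tuples_fib_algebra:
  assumes K: "K \<subseteq> cball 0 1"
  shows "f \<in> invertible_tuples (disk_algebra\<lparr>carrier := fib_algebra K x J\<rparr>) n \<longleftrightarrow>
    f \<in> {..<n} \<rightarrow>\<^sub>E fib_algebra K x J \<and>
    (\<exists>u. (\<forall>j<n. fib_fun K x J (u j)) \<and> (\<forall>z\<in>cball 0 1. (\<Sum>j<n. u j z * f j z) = 1))"
    (is "?L \<longleftrightarrow> ?f \<and> ?R")
proof -
  define R where "R = disk_algebra\<lparr>carrier := fib_algebra K x J\<rparr>"
  have prod: "u \<otimes>\<^bsub>R\<^esub> g = (\<lambda>z\<in>cball 0 1. u z * g z)" for u g by (simp add: R_def disk_algebra_simps)
  have sum_eq: "(\<Oplus>\<^bsub>R\<^esub>j\<in>{..<n}. u j \<otimes>\<^bsub>R\<^esub> f j) = (\<lambda>z\<in>cball 0 1. \<Sum>j<n. u j z * f j z)"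
    if "u \<in> {..<n} \<rightarrow>\<^sub>E fib_algebra K x J" ?f for u
  proof -
    have "(\<Oplus>\<^bsub>R\<^esub>j\<in>{..<n}. u j \<otimes>\<^bsub>R\<^esub> f j) = (\<lambda>z\<in>cball 0 1. \<Sum>j<n. (u j \<otimes>\<^bsub>R\<^esub> f j) z)"
      unfolding R_def
    proof (rule finsum_fib_algebra[OF K])
      fix j assume "j \<in> {..<n}"
      then have "fib_fun K x J (u j)" "fib_fun K x J (f j)"
        using that by (auto simp: PiE_iff dest: fib_algebra_fib_fun)
      then have "(\<lambda>z\<in>cball 0 1. u j z * f j z) \<in> fib_algebra K x J"
        by (intro restrict_fib_algebra[OF K] fib_fun_mult)
      then show "u j \<otimes>\<^bsub>disk_algebra\<lparr>carrier := fib_algebra K x J\<rparr>\<^esub> f j \<in> fib_algebra K x J"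
        using prod[unfolded R_def, of "u j" "f j"] by simp
    qed simp
    then show ?thesis by (simp add: prod fun_eq_iff restrict_def)
  qed
  have one: "\<one>\<^bsub>R\<^esub> = (\<lambda>z\<in>cball 0 1. 1)" by (simp add: R_def disk_algebra_simps)
  have carrier: "carrier R = fib_algebra K x J" by (simp add: R_def)
  have restr_eq: "(\<lambda>z\<in>cball 0 1. s z) = (\<lambda>z\<in>cball 0 1. 1) \<longleftrightarrow> (\<forall>z\<in>cball 0 1. s z = 1)"
    for s :: "complex \<Rightarrow> complex"
    by (auto simp: fun_eq_iff restrict_def)
  show ?thesis
    unfolding R_def[symmetric]
  proof
    assume "f \<in> invertible_tuples R n"
    then obtain u where f: ?f and u: "u \<in> {..<n} \<rightarrow>\<^sub>E fib_algebra K x J"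
      and "(\<Oplus>\<^bsub>R\<^esub>j\<in>{..<n}. u j \<otimes>\<^bsub>R\<^esub> f j) = \<one>\<^bsub>R\<^esub>"
      unfolding invertible_tuples_def carrier by blast
    then have "\<forall>z\<in>cball 0 1. (\<Sum>j<n. u j z * f j z) = 1" by (simp only: sum_eq one restr_eq)
    moreover have "\<forall>j<n. fib_fun K x J (u j)" using u by (auto simp: PiE_iff dest: fib_algebra_fib_fun)
    ultimately show "?f \<and> ?R" using f by blast
  next
    assume "?f \<and> ?R"
    then obtain u where f: ?f and u: "\<forall>j<n. fib_fun K x J (u j)"
      and one_u: "\<forall>z\<in>cball 0 1. (\<Sum>j<n. u j z * f j z) = 1"
      by blast
    define v where "v = (\<lambda>j\<in>{..<n}. \<lambda>z\<in>cball 0 1. u j z)"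
    have v: "v \<in> {..<n} \<rightarrow>\<^sub>E fib_algebra K x J"
      using u restrict_fib_algebra[OF K] by (simp add: v_def PiE_iff)
    have "(\<Sum>j<n. v j z * f j z) = (\<Sum>j<n. u j z * f j z)" if "z \<in> cball 0 1" for z
      using that by (intro sum.cong) (simp_all add: v_def)
    then have "(\<Oplus>\<^bsub>R\<^esub>j\<in>{..<n}. v j \<otimes>\<^bsub>R\<^esub> f j) = \<one>\<^bsub>R\<^esub>"
      using one_u by (simp only: sum_eq[OF v f] one restr_eq) simp
    then show "f \<in> invertible_tuples R n"
      unfolding invertible_tuples_def carrier using f v by blast
  qed
qed

lemma stable_range_fib_algebra:
  fixes x :: "nat \<Rightarrow> complex \<Rightarrow> real" and J :: "nat set"
  assumes K: "K \<subseteq> cball 0 1"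
  defines "R \<equiv> disk_algebra\<lparr>carrier := fib_algebra K x J\<rparr>"
  shows "(\<forall>f\<in>invertible_tuples R (Suc m). reducible_tuple R m f) \<longleftrightarrow>
    function_stable_range (fib_fun K x J) m"
proof
  have ops: "carrier R = fib_algebra K x J" "f \<oplus>\<^bsub>R\<^esub> h = (\<lambda>z\<in>cball 0 1. f z + h z)"
    "f \<otimes>\<^bsub>R\<^esub> h = (\<lambda>z\<in>cball 0 1. f z * h z)" for f h
    by (simp_all add: R_def disk_algebra_simps)
  note inv = invertible_tuples_fib_algebra[OF K, of _ x J, folded R_def]
  note restr = restrict_fib_algebra[OF K, of x J]
  have comb: "(f \<oplus>\<^bsub>R\<^esub> a \<otimes>\<^bsub>R\<^esub> g) z = f z + a z * g z" if "z \<in> cball 0 1" for f a g z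
    using that by (simp add: ops)
  {
    assume red: "\<forall>f\<in>invertible_tuples R (Suc m). reducible_tuple R m f"
    show "function_stable_range (fib_fun K x J) m"
      unfolding function_stable_range_def
    proof (intro allI impI, elim conjE)
      fix f u :: "nat \<Rightarrow> complex \<Rightarrow> complex"
      assume fu: "\<forall>j\<le>m. fib_fun K x J (f j) \<and> fib_fun K x J (u j)"
        and one: "\<forall>z\<in>cball 0 1. (\<Sum>j\<le>m. u j z * f j z) = 1"
      define F where "F = (\<lambda>j\<in>{..<Suc m}. \<lambda>z\<in>cball 0 1. f j z)"
      have F_eq: "F j z = f j z" if "j \<le> m" "z \<in> cball 0 1" for j z using that by (simp add: F_def)
      have "F \<in> {..<Suc m} \<rightarrow>\<^sub>E fib_algebra K x J" using fu restr by (simp add: F_def PiE_iff)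
      moreover have "(\<Sum>j<Suc m. u j z * F j z) = 1" if "z \<in> cball 0 1" for z
      proof -
        have "(\<Sum>j<Suc m. u j z * F j z) = (\<Sum>j\<le>m. u j z * f j z)"
          unfolding lessThan_Suc_atMost using that F_eq by (intro sum.cong) auto
        then show ?thesis using one that by simp
      qed
      moreover have "\<forall>j<Suc m. fib_fun K x J (u j)" using fu by simp
      ultimately have "F \<in> invertible_tuples R (Suc m)" unfolding inv by blast
      then have "reducible_tuple R m F" using red by blast
      then obtain a where a: "a \<in> {..<m} \<rightarrow>\<^sub>E fib_algebra K x J"
        and "(\<lambda>j\<in>{..<m}. F j \<oplus>\<^bsub>R\<^esub> a j \<otimes>\<^bsub>R\<^esub> F m) \<in> invertible_tuples R m"
        unfolding reducible_tuple_def ops(1) by blast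
      then obtain v where v: "\<forall>j<m. fib_fun K x J (v j)"
        and one_v: "\<forall>z\<in>cball 0 1. (\<Sum>j<m. v j z * (\<lambda>j\<in>{..<m}. F j \<oplus>\<^bsub>R\<^esub> a j \<otimes>\<^bsub>R\<^esub> F m) j z) = 1"
        unfolding inv by blast
      show "\<exists>a v. (\<forall>j<m. fib_fun K x J (a j) \<and> fib_fun K x J (v j)) \<and>
          (\<forall>z\<in>cball 0 1. (\<Sum>j<m. v j z * (f j z + a j z * f m z)) = 1)"
      proof (rule exI[of _ a], rule exI[of _ v], intro conjI allI impI ballI)
        show "fib_fun K x J (a j)" "fib_fun K x J (v j)" if "j < m" for j
          using a v that by (auto simp: PiE_iff dest: fib_algebra_fib_fun)
        fix z :: complex assume z: "z \<in> cball 0 1"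
        have "(\<Sum>j<m. v j z * (f j z + a j z * f m z))
            = (\<Sum>j<m. v j z * (\<lambda>j\<in>{..<m}. F j \<oplus>\<^bsub>R\<^esub> a j \<otimes>\<^bsub>R\<^esub> F m) j z)"
          by (rule sum.cong) (simp_all add: comb[OF z] F_eq[OF _ z])
        then show "(\<Sum>j<m. v j z * (f j z + a j z * f m z)) = 1" using one_v z by simp
      qed
    qed
  }
  {
    assume sr: "function_stable_range (fib_fun K x J) m"
    show "\<forall>f\<in>invertible_tuples R (Suc m). reducible_tuple R m f"
    proof
      fix f assume "f \<in> invertible_tuples R (Suc m)"
      then obtain u where f: "f \<in> {..<Suc m} \<rightarrow>\<^sub>E fib_algebra K x J"
        and u: "\<forall>j<Suc m. fib_fun K x J (u j)"
        and one: "\<forall>z\<in>cball 0 1. (\<Sum>j<Suc m. u j z * f j z) = 1"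
        unfolding inv by blast
      have "(\<forall>j\<le>m. fib_fun K x J (f j) \<and> fib_fun K x J (u j)) \<and>
          (\<forall>z\<in>cball 0 1. (\<Sum>j\<le>m. u j z * f j z) = 1)"
        using f u one by (auto simp: PiE_iff lessThan_Suc_atMost dest: fib_algebra_fib_fun)
      from sr[unfolded function_stable_range_def, THEN spec, THEN spec, THEN mp, OF this]
      obtain a v where av: "\<forall>j<m. fib_fun K x J (a j) \<and> fib_fun K x J (v j)"
        and one_v: "\<forall>z\<in>cball 0 1. (\<Sum>j<m. v j z * (f j z + a j z * f m z)) = 1"
        by (elim exE conjE) (rule that; assumption)
      define b where "b = (\<lambda>j\<in>{..<m}. \<lambda>z\<in>cball 0 1. a j z)"
      define h where "h = (\<lambda>j\<in>{..<m}. f j \<oplus>\<^bsub>R\<^esub> b j \<otimes>\<^bsub>R\<^esub> f m)"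
      have b: "b \<in> {..<m} \<rightarrow>\<^sub>E fib_algebra K x J" using av restr by (simp add: b_def PiE_iff)
      have ff: "fib_fun K x J (f j)" if "j \<le> m" for j
        using f that by (auto simp: PiE_iff dest: fib_algebra_fib_fun)
      have h_eq: "h j = (\<lambda>z\<in>cball 0 1. f j z + a j z * f m z)" if "j < m" for j
        using that by (simp add: h_def ops b_def fun_eq_iff)
      have "h j \<in> fib_algebra K x J" if "j < m" for j
        unfolding h_eq[OF that] using av ff that by (intro restr fib_fun_add fib_fun_mult) auto
      then have "h \<in> {..<m} \<rightarrow>\<^sub>E fib_algebra K x J" by (simp add: PiE_iff h_def)
      moreover have "(\<Sum>j<m. v j z * h j z) = 1" if z: "z \<in> cball 0 1" for z
      proof -
        have "(\<Sum>j<m. v j z * h j z) = (\<Sum>j<m. v j z * (f j z + a j z * f m z))"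
          using z by (intro sum.cong) (simp_all add: h_eq)
        then show ?thesis using one_v z by simp
      qed
      ultimately have "h \<in> invertible_tuples R m" unfolding inv using av by blast
      then show "reducible_tuple R m f"
        unfolding reducible_tuple_def ops(1) h_def using b by blast
    qed
  }
qed

text \<open>For \<open>n = \<infinity>\<close> the hypothesis \<open>upper\<close> is vacuous and
  \<open>lower\<close> empties \<open>S\<close>, whose infimum is then \<infinity>.\<close>

lemma bass_stable_rank_fib_algebra:
  assumes "K \<subseteq> cball 0 1" "n \<ge> 1"
    and upper: "\<And>m. n = enat m \<Longrightarrow> function_stable_range (fib_fun K x J) m"
    and lower: "\<And>m. 1 \<le> m \<Longrightarrow> enat m < n \<Longrightarrow> \<not> function_stable_range (fib_fun K x J) m"
  shows "bass_stable_rank (disk_algebra\<lparr>carrier := fib_algebra K x J\<rparr>) = n"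
proof -
  define S where "S = {enat m | m. m \<ge> 1 \<and> function_stable_range (fib_fun K x J) m}"
  have "bass_stable_rank (disk_algebra\<lparr>carrier := fib_algebra K x J\<rparr>) = Inf S"
    unfolding bass_stable_rank_def S_def stable_range_fib_algebra[OF assms(1)] ..
  also have "Inf S = n"
  proof (rule antisym)
    show "n \<le> Inf S"
      using lower by (intro Inf_greatest) (force simp: S_def not_less[symmetric])
    show "Inf S \<le> n"
    proof (cases n)
      case (enat m)
      then have "enat m \<in> S" using upper \<open>n \<ge> 1\<close> by (auto simp: S_def one_enat_def)
      then show ?thesis unfolding enat by (rule Inf_lower)
    qed simp
  qed
  finally show ?thesis .
qed

text \<open>For \<open>K\<close> the whole closed disk and \<open>J\<close> empty, \<^const>\<open>fib_fun\<close> describes the constant functions.\<close>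

lemma function_stable_range_constants: "function_stable_range (fib_fun (cball 0 1) x {}) 1"
  unfolding function_stable_range_def
proof (intro allI impI, elim conjE)
  fix f u :: "nat \<Rightarrow> complex \<Rightarrow> complex"
  assume fu: "\<forall>j\<le>1. fib_fun (cball 0 1) x {} (f j) \<and> fib_fun (cball 0 1) x {} (u j)"
    and one: "\<forall>z\<in>cball 0 1. (\<Sum>j\<le>1. u j z * f j z) = 1"
  have const: "f j z = f j 0" if "j \<le> 1" "z \<in> cball 0 1" for j z
    using fib_funD[of "cball 0 1" x "{}" "f j" z 0] fu that by simp
  \<comment> \<open>If the constant \<open>f 0\<close> is zero, the Bezout identity forces
    \<open>f 1\<close> to be nonzero, and adding it gives a nonzero constant.\<close>
  define a where "a = (if f 0 0 = 0 then 1 else 0 :: complex)"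
  define c where "c = f 0 0 + a * f 1 0"
  have "(\<Sum>j\<le>1. u j 0 * f j 0) = 1" using one by simp
  then have "u 0 0 * f 0 0 + u 1 0 * f 1 0 = 1" by simp
  then have "c \<noteq> 0" by (auto simp: c_def a_def)
  show "\<exists>a v. (\<forall>j<1. fib_fun (cball 0 1) x {} (a j) \<and> fib_fun (cball 0 1) x {} (v j)) \<and>
      (\<forall>z\<in>cball 0 1. (\<Sum>j<1. v j z * (f j z + a j z * f 1 z)) = 1)"
  proof (rule exI[of _ "\<lambda>_ _. a"], rule exI[of _ "\<lambda>_ _. 1 / c"], intro conjI allI impI ballI)
    fix z :: complex assume z: "z \<in> cball 0 1"
    have "f 0 z + a * f 1 z = c" using const[of 0, OF _ z] const[of 1, OF _ z] by (simp only: c_def)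
    then show "(\<Sum>j<1. 1 / c * (f j z + a * f 1 z)) = 1" using \<open>c \<noteq> 0\<close> by simp
  qed (rule fib_fun_const)+
qed

theorem corollary2p2:
  fixes n :: enat
  assumes "n \<ge> 1"
  shows "\<exists>A. unital_subalgebra A \<and> uniformly_closed A \<and>
             bass_stable_rank (disk_algebra\<lparr>carrier := A\<rparr>) = n"
proof -
  obtain K :: "complex set" and x :: "nat \<Rightarrow> complex \<Rightarrow> real" where "boundary_cube K x"
    using boundary_cube_exists by blast
  then interpret boundary_cube K x .
  have rank: "bass_stable_rank (disk_algebra\<lparr>carrier := fib_algebra K x J\<rparr>) = n"
    if "\<And>m. n = enat m \<Longrightarrow> function_stable_range (fib_fun K x J) m"
      "\<And>m. enat m < n \<Longrightarrow> {..<2*m} \<subseteq> J" for J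
    using K_cball assms that not_function_stable_range_cube by (intro bass_stable_rank_fib_algebra) auto
  have closed: "unital_subalgebra (fib_algebra K x J)" "uniformly_closed (fib_algebra K x J)" for J
    using unital_subalgebra_fib_algebra uniformly_closed_fib_algebra K_cball by blast+
  consider "n = 1" | k where "n = enat k" "k \<ge> 2" | "n = \<infinity>"
    using assms by (cases n) (force simp: one_enat_def)+
  then show ?thesis
  proof cases
    case 1
    have "bass_stable_rank (disk_algebra\<lparr>carrier := fib_algebra (cball 0 1) x {}\<rparr>) = n"
      using function_stable_range_constants 1
      by (intro bass_stable_rank_fib_algebra) (auto simp: one_enat_def)
    then show ?thesis
      using unital_subalgebra_fib_algebra[OF order_refl] uniformly_closed_fib_algebra[OF order_refl] by blast
  next
    case (2 k)
    \<comment> \<open>The index set contains \<open>{..<2*m}\<close> for every \<open>m < k\<close>,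
      and its size \<open>2*k-2\<close> is below \<open>2*k\<close>, as the upper bound
      requires.\<close>
    have "bass_stable_rank (disk_algebra\<lparr>carrier := fib_algebra K x {..<2*k-2}\<rparr>) = n"
      using function_stable_range_cube[of "2*k-2" k] 2 by (intro rank) auto
    then show ?thesis using closed by blast
  next
    case 3
    have "bass_stable_rank (disk_algebra\<lparr>carrier := fib_algebra K x UNIV\<rparr>) = n"
      using 3 by (intro rank) auto
    then show ?thesis using closed by blast
  qed
qed

end
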